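(* Let $A$ be an AH-algebra, given with an inductive limit decomposition whose eigenvalue patterns are induced by continuous maps. If $A$ has at most countably many extremal tracial states, then $A$ has mean dimension zero.
   Context: **Setting.** $A=\varinjlim(A_i,\varphi_i)$ is the inductive limit of a sequence of unital C*-algebras $A_i=\bigoplus_{l=1}^{h_i}A_{i,l}$, $A_{i,l}=p_{i,l}\mathrm{M}_{r_{i,l}}(\mathrm{C}(X_{i,l}))p_{i,l}$, with unital connecting maps $\varphi_{i,j}:A_i\to A_j$, where each $X_{i,l}$ is a connected compact Hausdorff space and $p_{i,l}$ is a projection of rank $n_{i,l}$. The eigenvalue patterns are assumed to be induced by continuous maps: for all $i<j$, $l$, $k$ there are continuous maps $\lambda_{i,j}^{l,k}(m):X_{j,k}\to X_{i,l}$, $1\le m\le m_{i,j}^{l,k}$, such that for every $x\in X_{j,k}$ the points of $X_{i,l}$ (counted with multiplicity) corresponding to the representation of $A_{i,l}$ given by $\varphi_{i,j}$ followed by evaluation at $x$ are $\lambda_{i,j}^{l,k}(1)(x),\dots,\lambda_{i,j}^{l,k}(m_{i,j}^{l,k})(x)$. **Mean dimension.** For a finite open cover $\alpha$ of a space $X$ let $\mathrm{ord}(\alpha)=\max_{x\in X}\big(\sum_{U\in\alpha}1_U(x)\big)-1$ and $\mathcal D(\alpha)=\min\{\mathrm{ord}(\beta):\beta\text{ a finite open cover refining }\alpha\}$. The cover $\alpha\vee\beta$ consists of the sets $U\cap V$, $U\in\alpha$, $V\in\beta$. Let $X_i=\bigsqcup_lX_{i,l}$. For a finite open cover $\alpha$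 of $X_i$, each member of which is contained in a connected component, inducing covers $\alpha_l$ of $X_{i,l}$, put $\varphi_{i,j}^k(\alpha)=\bigvee_{l}\bigvee_{m}(\lambda_{i,j}^{l,k}(m))^{-1}(\alpha_l)$, an open cover of $X_{j,k}$. Set $\gamma_i(A)=\sup_{\alpha}\lim_{j\to\infty}\max_{1\le k\le h_j}\mathcal D(\varphi_{i,j}^k(\alpha))/n_{j,k}$ (the limit exists since the sequence is decreasing in $j$). The mean dimension is $\gamma(A)=\lim_i\gamma_i(A)$ (an increasing limit). *)

theory Defs
  imports
    "HOL-Analysis.Analysis"
    "Jordan_Normal_Form.Schur_Decomposition"
    "Jordan_Normal_Form.DL_Rank"
begin

section \<open>Unital C*-algebras\<close>

record 'a cstar = "(complex, 'a) module" +
  star :: "'a \<Rightarrow> 'a"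
  cnorm :: "'a \<Rightarrow> real"

locale unital_cstar_algebra =
  fixes A :: "('a, 'm) cstar_scheme" (structure)
  assumes ring: "Ring.ring A"
    and module: "Module.module (class_ring :: complex ring) A"
    and smult_mult_left: "\<lbrakk>x \<in> carrier A; y \<in> carrier A\<rbrakk> \<Longrightarrow> (c \<odot> x) \<otimes> y = c \<odot> (x \<otimes> y)"
    and smult_mult_right: "\<lbrakk>x \<in> carrier A; y \<in> carrier A\<rbrakk> \<Longrightarrow> x \<otimes> (c \<odot> y) = c \<odot> (x \<otimes> y)"
    and star_closed: "x \<in> carrier A \<Longrightarrow> star A x \<in> carrier A"
    and star_star: "x \<in> carrier A \<Longrightarrow> star A (star A x) = x"
    and star_add: "\<lbrakk>x \<in> carrier A; y \<in> carrier A\<rbrakk> \<Longrightarrow> star A (x \<oplus> y) = star A x \<oplus> star A y"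
    and star_smult: "x \<in> carrier A \<Longrightarrow> star A (c \<odot> x) = cnj c \<odot> star A x"
    and star_mult: "\<lbrakk>x \<in> carrier A; y \<in> carrier A\<rbrakk> \<Longrightarrow> star A (x \<otimes> y) = star A y \<otimes> star A x"
    and norm_nonneg: "x \<in> carrier A \<Longrightarrow> 0 \<le> cnorm A x"
    and norm_eq_0: "x \<in> carrier A \<Longrightarrow> cnorm A x = 0 \<longleftrightarrow> x = \<zero>"
    and norm_triangle: "\<lbrakk>x \<in> carrier A; y \<in> carrier A\<rbrakk> \<Longrightarrow> cnorm A (x \<oplus> y) \<le> cnorm A x + cnorm A y"
    and norm_smult: "x \<in> carrier A \<Longrightarrow> cnorm A (c \<odot> x) = cmod c * cnorm A x"
    and norm_mult: "\<lbrakk>x \<in> carrier A; y \<in> carrier A\<rbrakk> \<Longrightarrow> cnorm A (x \<otimes> y) \<le> cnorm A x * cnorm A y"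
    and norm_star_mult: "x \<in> carrier A \<Longrightarrow> cnorm A (star A x \<otimes> x) = (cnorm A x)\<^sup>2"
    and complete: "\<lbrakk>\<And>n. s n \<in> carrier A;
        \<forall>e>0. \<exists>N. \<forall>m\<ge>N. \<forall>n\<ge>N. cnorm A (s m \<ominus> s n) < e\<rbrakk>
      \<Longrightarrow> \<exists>x\<in>carrier A. (\<lambda>n. cnorm A (s n \<ominus> x)) \<longlonglongrightarrow> (0::real)"

definition unital_star_hom ::
    "('a, 'm) cstar_scheme \<Rightarrow> ('b, 'n) cstar_scheme \<Rightarrow> ('a \<Rightarrow> 'b) set" where
  "unital_star_hom A B = {f \<in> Ring.ring_hom A B.
     (\<forall>c. \<forall>x\<in>carrier A. f (c \<odot>\<^bsub>A\<^esub> x) = c \<odot>\<^bsub>B\<^esub> f x) \<and>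
     (\<forall>x\<in>carrier A. f (star A x) = star B (f x))}"

text \<open>States are taken in \<^term>\<open>extensional (carrier A)\<close> so that two of them are equal as HOL
  functions exactly when they agree on the algebra; this matters when they are counted.\<close>

definition tracial_states :: "('a, 'm) cstar_scheme \<Rightarrow> ('a \<Rightarrow> complex) set" where
  "tracial_states A = {\<tau> \<in> extensional (carrier A).
     (\<forall>x\<in>carrier A. \<forall>y\<in>carrier A. \<tau> (x \<oplus>\<^bsub>A\<^esub> y) = \<tau> x + \<tau> y) \<and>
     (\<forall>c. \<forall>x\<in>carrier A. \<tau> (c \<odot>\<^bsub>A\<^esub> x) = c * \<tau> x) \<and>
     (\<forall>x\<in>carrier A. \<tau> (star A x \<otimes>\<^bsub>A\<^esub> x) \<in> \<real>\<^sub>\<ge>\<^sub>0) \<and>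
     \<tau> \<one>\<^bsub>A\<^esub> = 1 \<and>
     (\<forall>x\<in>carrier A. \<forall>y\<in>carrier A. \<tau> (x \<otimes>\<^bsub>A\<^esub> y) = \<tau> (y \<otimes>\<^bsub>A\<^esub> x))}"

definition extremal_tracial_states :: "('a, 'm) cstar_scheme \<Rightarrow> ('a \<Rightarrow> complex) set" where
  "extremal_tracial_states A = {\<tau> \<in> tracial_states A.
     \<forall>\<sigma>\<in>tracial_states A. \<forall>\<rho>\<in>tracial_states A. \<forall>t::real.
       0 < t \<and> t < 1 \<and>
       (\<forall>x\<in>carrier A. \<tau> x = complex_of_real t * \<sigma> x + complex_of_real (1 - t) * \<rho> x)
       \<longrightarrow> \<sigma> = \<tau> \<and> \<rho> = \<tau>}"


section \<open>The algebras \<open>p M\<^sub>r(C(X)) p\<close> and their direct sums\<close>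

definition mat_opnorm :: "complex mat \<Rightarrow> real" where
  "mat_opnorm M = (SUP v \<in> {v \<in> carrier_vec (dim_col M). Re (v \<bullet>c v) \<le> 1}.
     sqrt (Re ((M *\<^sub>v v) \<bullet>c (M *\<^sub>v v))))"

definition mat_fun_algebra :: "'x topology \<Rightarrow> nat \<Rightarrow> ('x \<Rightarrow> complex mat) cstar" where
  "mat_fun_algebra X r = \<lparr>
     carrier = {f \<in> topspace X \<rightarrow>\<^sub>E carrier_mat r r.
       \<forall>a<r. \<forall>b<r. continuous_map X euclidean (\<lambda>x. f x $$ (a, b))},
     mult = (\<lambda>f g. \<lambda>x\<in>topspace X. f x * g x),
     one = (\<lambda>x\<in>topspace X. 1\<^sub>m r),
     zero = (\<lambda>x\<in>topspace X. 0\<^sub>m r r),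
     add = (\<lambda>f g. \<lambda>x\<in>topspace X. f x + g x),
     smult = (\<lambda>c f. \<lambda>x\<in>topspace X. c \<cdot>\<^sub>m f x),
     star = (\<lambda>f. \<lambda>x\<in>topspace X. mat_adjoint (f x)),
     cnorm = (\<lambda>f. SUP x\<in>topspace X. mat_opnorm (f x))\<rparr>"

definition projection :: "('a, 'm) cstar_scheme \<Rightarrow> 'a \<Rightarrow> bool" where
  "projection B p \<longleftrightarrow> p \<in> carrier B \<and> p \<otimes>\<^bsub>B\<^esub> p = p \<and> star B p = p"

definition corner :: "('a, 'm) cstar_scheme \<Rightarrow> 'a \<Rightarrow> ('a, 'm) cstar_scheme" where
  "corner B p = B\<lparr>carrier := (\<lambda>f. p \<otimes>\<^bsub>B\<^esub> f \<otimes>\<^bsub>B\<^esub> p) ` carrier B, one := p\<rparr>"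

definition cstar_sum :: "nat \<Rightarrow> (nat \<Rightarrow> 'a cstar) \<Rightarrow> (nat \<Rightarrow> 'a) cstar" where
  "cstar_sum h B = \<lparr>
     carrier = (\<Pi>\<^sub>E l\<in>{..<h}. carrier (B l)),
     mult = (\<lambda>f g. \<lambda>l\<in>{..<h}. f l \<otimes>\<^bsub>B l\<^esub> g l),
     one = (\<lambda>l\<in>{..<h}. \<one>\<^bsub>B l\<^esub>),
     zero = (\<lambda>l\<in>{..<h}. \<zero>\<^bsub>B l\<^esub>),
     add = (\<lambda>f g. \<lambda>l\<in>{..<h}. f l \<oplus>\<^bsub>B l\<^esub> g l),
     smult = (\<lambda>c f. \<lambda>l\<in>{..<h}. c \<odot>\<^bsub>B l\<^esub> f l),
     star = (\<lambda>f. \<lambda>l\<in>{..<h}. star (B l) (f l)),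
     cnorm = (\<lambda>f. Max ((\<lambda>l. cnorm (B l) (f l)) ` {..<h}))\<rparr>"

definition summand_incl :: "nat \<Rightarrow> (nat \<Rightarrow> 'a cstar) \<Rightarrow> nat \<Rightarrow> 'a \<Rightarrow> nat \<Rightarrow> 'a" where
  "summand_incl h B l f = (\<lambda>l'\<in>{..<h}. if l' = l then f else \<zero>\<^bsub>B l'\<^esub>)"


section \<open>Inductive systems and their limits\<close>

definition connecting :: "(nat \<Rightarrow> 'b \<Rightarrow> 'b) \<Rightarrow> nat \<Rightarrow> nat \<Rightarrow> 'b \<Rightarrow> 'b" where
  "connecting \<phi> i j = fold \<phi> [i..<j]"

text \<open>The inductive limit, up to isomorphism: \<open>A\<close> is the completion of the algebraic direct limit
  with respect to the seminorm \<open>\<lim>\<^sub>j \<parallel>\<phi>\<^sub>i\<^sub>j(b)\<parallel>\<close>, and \<open>\<psi> i\<close> is the canonical map of the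
  \<open>i\<close>-th algebra into it. The connecting maps need not be injective.\<close>

definition cstar_inductive_limit ::
    "(nat \<Rightarrow> ('b, 'm) cstar_scheme) \<Rightarrow> (nat \<Rightarrow> 'b \<Rightarrow> 'b) \<Rightarrow>
     ('a, 'n) cstar_scheme \<Rightarrow> (nat \<Rightarrow> 'b \<Rightarrow> 'a) \<Rightarrow> bool" where
  "cstar_inductive_limit B \<phi> A \<psi> \<longleftrightarrow>
     unital_cstar_algebra A \<and>
     (\<forall>i. \<psi> i \<in> unital_star_hom (B i) A) \<and>
     (\<forall>i. \<forall>b\<in>carrier (B i). \<psi> (Suc i) (\<phi> i b) = \<psi> i b) \<and>
     (\<forall>i. \<forall>b\<in>carrier (B i).
        (\<lambda>j. cnorm (B j) (connecting \<phi> i j b)) \<longlonglongrightarrow> cnorm A (\<psi> i b)) \<and>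
     (\<forall>a\<in>carrier A. \<forall>e>0. \<exists>i. \<exists>b\<in>carrier (B i). cnorm A (a \<ominus>\<^bsub>A\<^esub> \<psi> i b) < e)"

definition AH_summand ::
    "(nat \<Rightarrow> nat \<Rightarrow> 'x topology) \<Rightarrow> (nat \<Rightarrow> nat \<Rightarrow> nat) \<Rightarrow> (nat \<Rightarrow> nat \<Rightarrow> 'x \<Rightarrow> complex mat) \<Rightarrow>
     nat \<Rightarrow> nat \<Rightarrow> ('x \<Rightarrow> complex mat) cstar" where
  "AH_summand X r p i l = corner (mat_fun_algebra (X i l) (r i l)) (p i l)"

definition AH_stage ::
    "(nat \<Rightarrow> nat) \<Rightarrow> (nat \<Rightarrow> nat \<Rightarrow> 'x topology) \<Rightarrow> (nat \<Rightarrow> nat \<Rightarrow> nat) \<Rightarrow>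
     (nat \<Rightarrow> nat \<Rightarrow> 'x \<Rightarrow> complex mat) \<Rightarrow> nat \<Rightarrow> (nat \<Rightarrow> 'x \<Rightarrow> complex mat) cstar" where
  "AH_stage h X r p i = cstar_sum (h i) (AH_summand X r p i)"

text \<open>Indices start at \<open>0\<close>. The conditions \<open>0 < h i\<close> and \<open>0 < n i l\<close> say that there are summands
  and that they are nonzero; without them the quotients and maxima in the mean dimension make
  no sense. The spaces \<open>X i l\<close> all live in one type, which may be any type.\<close>

locale AH_system =
  fixes h :: "nat \<Rightarrow> nat"
    and X :: "nat \<Rightarrow> nat \<Rightarrow> 'x topology"
    and r :: "nat \<Rightarrow> nat \<Rightarrow> nat"
    and p :: "nat \<Rightarrow> nat \<Rightarrow> 'x \<Rightarrow> complex mat"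
    and n :: "nat \<Rightarrow> nat \<Rightarrow> nat"
    and \<phi> :: "nat \<Rightarrow> (nat \<Rightarrow> 'x \<Rightarrow> complex mat) \<Rightarrow> nat \<Rightarrow> 'x \<Rightarrow> complex mat"
  assumes h_pos: "0 < h i"
    and compact: "l < h i \<Longrightarrow> compact_space (X i l)"
    and Hausdorff: "l < h i \<Longrightarrow> Hausdorff_space (X i l)"
    and connected: "l < h i \<Longrightarrow> connected_space (X i l)"
    and nonempty: "l < h i \<Longrightarrow> topspace (X i l) \<noteq> {}"
    and projection: "l < h i \<Longrightarrow> projection (mat_fun_algebra (X i l) (r i l)) (p i l)"
    and rank: "\<lbrakk>l < h i; x \<in> topspace (X i l)\<rbrakk> \<Longrightarrow> vec_space.rank (r i l) (p i l x) = n i l"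
    and n_pos: "l < h i \<Longrightarrow> 0 < n i l"
    and hom: "\<phi> i \<in> unital_star_hom (AH_stage h X r p i) (AH_stage h X r p (Suc i))"


section \<open>Eigenvalue patterns\<close>

text \<open>The irreducible representations of \<open>p M\<^sub>r(C(X)) p\<close> are the evaluations at points \<open>y\<close>, acting
  on the range of \<open>p y\<close>. The list \<open>ys\<close> holds the points of \<open>X\<close> (with multiplicity) corresponding to
  the representation \<open>\<pi>\<close> on \<open>\<complex>\<^sup>s\<close> if \<open>\<pi>\<close> is unitarily equivalent to the direct sum of the evaluations
  at the members of \<open>ys\<close> on its essential subspace and zero on the complement: \<open>V\<close> is the
  unitary from the direct sum of the ranges of the \<open>p y\<close> onto the essential subspace, extended by
  zero to a partial isometry.\<close>

definition representation_points ::
    "nat \<Rightarrow> ('x \<Rightarrow> complex mat) \<Rightarrow> ('x \<Rightarrow> complex mat) cstar \<Rightarrow> nat \<Rightarrow>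
     (('x \<Rightarrow> complex mat) \<Rightarrow> complex mat) \<Rightarrow> 'x list \<Rightarrow> bool" where
  "representation_points r p B s \<pi> ys \<longleftrightarrow>
     (\<exists>V\<in>carrier_mat s (length ys * r).
        mat_adjoint V * V = diag_block_mat (map p ys) \<and>
        (\<forall>f\<in>carrier B. \<pi> f = V * diag_block_mat (map f ys) * mat_adjoint V))"

text \<open>Here \<open>M i j l k\<close> is the number of maps \<open>\<lambda>\<^sub>i\<^sub>j\<^sup>l\<^sup>k(m)\<close>, written \<open>lam i j l k m\<close>, from
  \<open>X j k\<close> to \<open>X i l\<close>.\<close>

definition continuous_eigenvalue_maps ::
    "(nat \<Rightarrow> nat) \<Rightarrow> (nat \<Rightarrow> nat \<Rightarrow> 'x topology) \<Rightarrow> (nat \<Rightarrow> nat \<Rightarrow> nat) \<Rightarrow>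
     (nat \<Rightarrow> nat \<Rightarrow> 'x \<Rightarrow> complex mat) \<Rightarrow>
     (nat \<Rightarrow> (nat \<Rightarrow> 'x \<Rightarrow> complex mat) \<Rightarrow> nat \<Rightarrow> 'x \<Rightarrow> complex mat) \<Rightarrow>
     (nat \<Rightarrow> nat \<Rightarrow> nat \<Rightarrow> nat \<Rightarrow> nat) \<Rightarrow> (nat \<Rightarrow> nat \<Rightarrow> nat \<Rightarrow> nat \<Rightarrow> nat \<Rightarrow> 'x \<Rightarrow> 'x) \<Rightarrow> bool" where
  "continuous_eigenvalue_maps h X r p \<phi> M lam \<longleftrightarrow>
     (\<forall>i j l k. i < j \<and> l < h i \<and> k < h j \<longrightarrow>
        (\<forall>m<M i j l k. continuous_map (X j k) (X i l) (lam i j l k m)) \<and>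
        (\<forall>x\<in>topspace (X j k).
           representation_points (r i l) (p i l) (AH_summand X r p i l) (r j k)
             (\<lambda>f. connecting \<phi> i j (summand_incl (h i) (AH_summand X r p i) l f) k x)
             (map (\<lambda>m. lam i j l k m x) [0..<M i j l k])))"


section \<open>Mean dimension\<close>

definition finite_open_cover :: "'x topology \<Rightarrow> 'x set set \<Rightarrow> bool" where
  "finite_open_cover X \<alpha> \<longleftrightarrow> finite \<alpha> \<and> (\<forall>U\<in>\<alpha>. openin X U) \<and> \<Union>\<alpha> = topspace X"

definition refines :: "'x set set \<Rightarrow> 'x set set \<Rightarrow> bool" where
  "refines \<beta> \<alpha> \<longleftrightarrow> (\<forall>V\<in>\<beta>. \<exists>U\<in>\<alpha>. V \<subseteq> U)"

definition cover_ord :: "'x topology \<Rightarrow> 'x set set \<Rightarrow> nat" where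
  "cover_ord X \<alpha> = Max ((\<lambda>x. card {U\<in>\<alpha>. x \<in> U}) ` topspace X) - 1"

definition cover_dim :: "'x topology \<Rightarrow> 'x set set \<Rightarrow> nat" where
  "cover_dim X \<alpha> =
     (LEAST d. \<exists>\<beta>. finite_open_cover X \<beta> \<and> refines \<beta> \<alpha> \<and> cover_ord X \<beta> = d)"

text \<open>The join of the covers \<open>C i\<close>, \<open>i \<in> I\<close>, of \<open>X\<close>: all intersections of one member from each.
  For empty \<open>I\<close> this is the trivial cover.\<close>

definition cover_join :: "'x topology \<Rightarrow> 'i set \<Rightarrow> ('i \<Rightarrow> 'x set set) \<Rightarrow> 'x set set" where
  "cover_join X I C = {topspace X \<inter> (\<Inter>i\<in>I. s i) | s. \<forall>i\<in>I. s i \<in> C i}"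

text \<open>The finite open covers of the disjoint union of the \<open>X i l\<close>, \<open>l < h i\<close>, each of whose members
  lies in one of the connected components \<open>{l} \<times> X i l\<close>.\<close>

definition component_covers ::
    "(nat \<Rightarrow> nat) \<Rightarrow> (nat \<Rightarrow> nat \<Rightarrow> 'x topology) \<Rightarrow> nat \<Rightarrow> (nat \<times> 'x) set set set" where
  "component_covers h X i = {\<alpha>. finite_open_cover (sum_topology (X i) {..<h i}) \<alpha> \<and>
     (\<forall>U\<in>\<alpha>. \<exists>l<h i. U \<subseteq> {l} \<times> topspace (X i l))}"

definition induced_cover :: "(nat \<times> 'x) set set \<Rightarrow> nat \<Rightarrow> 'x set set" where
  "induced_cover \<alpha> l = {U. {l} \<times> U \<in> \<alpha>}"

definition eigenvalue_cover ::
    "(nat \<Rightarrow> nat) \<Rightarrow> (nat \<Rightarrow> nat \<Rightarrow> 'x topology) \<Rightarrow> (nat \<Rightarrow> nat \<Rightarrow> nat \<Rightarrow> nat \<Rightarrow> nat) \<Rightarrow>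
     (nat \<Rightarrow> nat \<Rightarrow> nat \<Rightarrow> nat \<Rightarrow> nat \<Rightarrow> 'x \<Rightarrow> 'x) \<Rightarrow> nat \<Rightarrow> nat \<Rightarrow> nat \<Rightarrow> (nat \<times> 'x) set set \<Rightarrow>
     'x set set" where
  "eigenvalue_cover h X M lam i j k \<alpha> =
     cover_join (X j k) {(l, m). l < h i \<and> m < M i j l k}
       (\<lambda>(l, m). (\<lambda>U. {x\<in>topspace (X j k). lam i j l k m x \<in> U}) ` induced_cover \<alpha> l)"

text \<open>The terms with \<open>j \<le> i\<close>, where there are no eigenvalue maps, do not affect the limit.\<close>

definition mean_dim_stage ::
    "(nat \<Rightarrow> nat) \<Rightarrow> (nat \<Rightarrow> nat \<Rightarrow> 'x topology) \<Rightarrow> (nat \<Rightarrow> nat \<Rightarrow> nat) \<Rightarrow>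
     (nat \<Rightarrow> nat \<Rightarrow> nat \<Rightarrow> nat \<Rightarrow> nat) \<Rightarrow> (nat \<Rightarrow> nat \<Rightarrow> nat \<Rightarrow> nat \<Rightarrow> nat \<Rightarrow> 'x \<Rightarrow> 'x) \<Rightarrow> nat \<Rightarrow> ereal"
    where
  "mean_dim_stage h X n M lam i =
     (SUP \<alpha>\<in>component_covers h X i. lim (\<lambda>j. ereal (Max ((\<lambda>k.
        real (cover_dim (X j k) (eigenvalue_cover h X M lam i j k \<alpha>)) / real (n j k)) ` {..<h j}))))"

definition mean_dimension ::
    "(nat \<Rightarrow> nat) \<Rightarrow> (nat \<Rightarrow> nat \<Rightarrow> 'x topology) \<Rightarrow> (nat \<Rightarrow> nat \<Rightarrow> nat) \<Rightarrow>
     (nat \<Rightarrow> nat \<Rightarrow> nat \<Rightarrow> nat \<Rightarrow> nat) \<Rightarrow> (nat \<Rightarrow> nat \<Rightarrow> nat \<Rightarrow> nat \<Rightarrow> nat \<Rightarrow> 'x \<Rightarrow> 'x) \<Rightarrow> ereal" where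
  "mean_dimension h X n M lam = lim (mean_dim_stage h X n M lam)"

end

theory Submission
  imports Defs
begin

text \<open>A cover of \<open>X j k\<close> has small dimension when it can be read off from few real coordinates. Let
finitely many functions \<open>g t\<close> with values in \<open>[0, 1]\<close> be given, and suppose that at each point at most
\<open>d\<close> of them take a value strictly between \<open>0\<close> and \<open>1\<close>. Then the sets on which the functions in \<open>S\<close>
lie above and all others below a common threshold form an open cover of order at most \<open>d\<close>, because
only the values strictly between \<open>0\<close> and \<open>1\<close> can separate two thresholds
(\<open>cover_dim_le_card_intermediate\<close>). Given a cover \<open>\<alpha>\<close> at stage \<open>i\<close>, take Urysohn functions
subordinate to it, make them steep around a level \<open>c\<close>, and compose them with the eigenvalue maps. The
members of \<open>\<alpha>\<close> are determined by the pattern of zeros and ones, so the dimension of the cover at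
stage \<open>j\<close> is at most the number of eigenvalues whose Urysohn coordinate is close to \<open>c\<close>. It remains to
choose \<open>c\<close> so that this number is eventually at most \<open>\<epsilon> * n j k\<close>, uniformly in \<open>k\<close> and in the point of
\<open>X j k\<close> (\<open>eigenvalues_rarely_near_level\<close>).

This number is controlled by tracial states. The normalized trace at a point of \<open>X j k\<close>, evaluated
at the image of a tent function around \<open>c\<close> (times the unit of the summand), is the sum of the tent
over the eigenvalues multiplied by \<open>n i l / n j k\<close>. If these values stayed large for infinitely many
\<open>j\<close>, a cluster point of the traces would be a tracial state of \<open>A\<close> that is large at the tent (\<open>tracial_state_from_points\<close>). So it
is enough that narrow tents are uniformly small on the tracial states. For one tracial state, the
narrowing tents tend to \<open>0\<close> at all but countably many levels, since those around different levels are
eventually disjoint (\<open>countable_charged_levels\<close>). As there are only countably many extremal tracial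
states, one level works for all of them. The passage to all tracial states, with uniformity, is the
maximum principle of Bauer: the limit of a decreasing sequence of continuous affine functions on a
compact convex set attains its maximum at an extreme point (\<open>Bauer_maximum_principle\<close>).

The compact convex set used here consists of the tracial states that are contractive for the norm.
It is a face of the set of all tracial states, which follows from the Cauchy-Schwarz inequality
alone, so its extreme points are extremal tracial states.\<close>

section \<open>Covers from threshold sets\<close>

lemma openin_finite_conj:
  assumes "finite T" "\<And>t. t \<in> T \<Longrightarrow> openin X {x \<in> topspace X. P t x}"
  shows "openin X {x \<in> topspace X. \<forall>t\<in>T. P t x}"
  using assms
proof (induction T rule: finite_induct)
  case empty
  then show ?case by simp
next
  case (insert t T)
  have "{x \<in> topspace X. \<forall>s\<in>insert t T. P s x}
      = {x \<in> topspace X. P t x} \<inter> {x \<in> topspace X. \<forall>s\<in>T. P s x}" by auto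
  then show ?case using insert by auto
qed

lemma cover_dim_le_cover_ord:
  assumes "finite_open_cover X \<beta>" "refines \<beta> \<alpha>"
  shows "cover_dim X \<alpha> \<le> cover_ord X \<beta>"
  unfolding cover_dim_def using assms by (intro Least_le) auto

lemma cover_ord_le:
  assumes "finite \<beta>" "topspace X \<noteq> {}"
    and "\<And>x. x \<in> topspace X \<Longrightarrow> card {U \<in> \<beta>. x \<in> U} \<le> Suc d"
  shows "cover_ord X \<beta> \<le> d"
proof -
  have "finite ((\<lambda>x. card {U \<in> \<beta>. x \<in> U}) ` topspace X)"
    using assms(3) by (auto intro!: finite_subset[of _ "{..Suc d}"])
  then have "Max ((\<lambda>x. card {U \<in> \<beta>. x \<in> U}) ` topspace X) \<le> Suc d"
    using assms(2,3) by (subst Max_le_iff) auto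
  then show ?thesis by (simp add: cover_ord_def)
qed

text \<open>The preimage of the open star of the vertex \<open>S\<close> when the cube \<open>[0, 1]\<^sup>T\<close> is
triangulated by the order of the coordinates.\<close>

definition threshold_set ::
    "'x topology \<Rightarrow> 't set \<Rightarrow> ('t \<Rightarrow> 'x \<Rightarrow> real) \<Rightarrow> 't set \<Rightarrow> 'x set" where
  "threshold_set X T g S = {x \<in> topspace X. \<exists>c. 0 < c \<and> c < 1 \<and>
     (\<forall>t\<in>T. if t \<in> S then c < g t x else g t x < c)}"

lemma openin_threshold_set:
  assumes "finite T" "\<And>t. t \<in> T \<Longrightarrow> continuous_map X euclideanreal (g t)"
  shows "openin X (threshold_set X T g S)"
proof -
  have "openin X {x \<in> topspace X. if t \<in> S then c < g t x else g t x < c}" if "t \<in> T" for t c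
  proof -
    have "openin X {x \<in> topspace X. g t x \<in> (if t \<in> S then {c<..} else {..<c})}"
      by (rule openin_continuous_map_preimage[OF assms(2)[OF that]]) auto
    then show ?thesis by (auto split: if_splits)
  qed
  then have op: "openin X {x \<in> topspace X. \<forall>t\<in>T. if t \<in> S then c < g t x else g t x < c}" for c
    by (rule openin_finite_conj[OF assms(1)])
  have eq: "threshold_set X T g S = (\<Union>c\<in>{0<..<1::real}.
      {x \<in> topspace X. \<forall>t\<in>T. if t \<in> S then c < g t x else g t x < c})"
    unfolding threshold_set_def by auto
  show ?thesis unfolding eq using op by blast
qed

lemma threshold_sets_cover:
  assumes "finite T" "x \<in> topspace X"
  obtains S where "S \<subseteq> T" "x \<in> threshold_set X T g S"
proof -
  have "infinite ({0<..<1::real} - (\<lambda>t. g t x) ` T)"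
    using assms(1) by (intro Diff_infinite_finite) auto
  then obtain c where c: "c \<in> {0<..<1} - (\<lambda>t. g t x) ` T"
    by (metis ex_in_conv finite.emptyI)
  have "x \<in> threshold_set X T g {t \<in> T. c < g t x}"
    using assms(2) c unfolding threshold_set_def
    by (auto intro!: exI[of _ c] simp: not_less order.order_iff_strict)
  then show ?thesis by (intro that[of "{t \<in> T. c < g t x}"]) auto
qed

text \<open>Moving the threshold \<open>c\<close> from \<open>0\<close> to \<open>1\<close> changes the set of coordinates above \<open>c\<close> only at values
strictly between \<open>0\<close> and \<open>1\<close>. In other words, such a set is determined by the largest value below the
threshold, which is \<open>0\<close> or an intermediate value.\<close>

lemma card_threshold_sets_at_le:
  assumes fin: "finite T" and range: "\<And>t. t \<in> T \<Longrightarrow> 0 \<le> g t x \<and> g t x \<le> (1::real)"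
  shows "card {S. S \<subseteq> T \<and> x \<in> threshold_set X T g S} \<le> Suc (card {t \<in> T. 0 < g t x \<and> g t x < 1})"
proof -
  let ?I = "{t \<in> T. 0 < g t x \<and> g t x < 1}"
  let ?A = "{S. S \<subseteq> T \<and> x \<in> threshold_set X T g S}"
  (* the value 0 stands for the case that no coordinate lies below the threshold *)
  define m where "m S = Max (insert 0 ((\<lambda>t. g t x) ` (T - S)))" for S
  have S_eq: "S = {t \<in> T. m S < g t x}" and m_in: "m S \<in> insert 0 ((\<lambda>t. g t x) ` ?I)"
    if "S \<in> ?A" for S
  proof -
    from that obtain c where c: "0 < c" "c < 1"
        "\<And>t. t \<in> T \<Longrightarrow> if t \<in> S then c < g t x else g t x < c" and "S \<subseteq> T"
      unfolding threshold_set_def by auto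
    have fin': "finite (insert 0 ((\<lambda>t. g t x) ` (T - S)))" using fin by auto
    have "m S < c" unfolding m_def using fin' c by (subst Max_less_iff) (auto split: if_splits)
    moreover have le: "g t x \<le> m S" if "t \<in> T - S" for t
      unfolding m_def using fin' that by (intro Max_ge) auto
    moreover have "m S < g t x" if "t \<in> S" for t
      using c(3)[of t] that \<open>S \<subseteq> T\<close> \<open>m S < c\<close> by auto
    ultimately show "S = {t \<in> T. m S < g t x}"
      using \<open>S \<subseteq> T\<close> by (auto simp: not_less[symmetric])
    have "m S \<in> insert 0 ((\<lambda>t. g t x) ` (T - S))" unfolding m_def using fin' by (intro Max_in) auto
    moreover have "g t x = 0 \<or> 0 < g t x \<and> g t x < 1" if "t \<in> T" "m S = g t x" for t
      using range[OF that(1)] that(2) c(2) \<open>m S < c\<close> by linarith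
    ultimately show "m S \<in> insert 0 ((\<lambda>t. g t x) ` ?I)" by fastforce
  qed
  have "inj_on m ?A"
  proof (rule inj_onI)
    fix S S' assume S: "S \<in> ?A" and S': "S' \<in> ?A" and eq: "m S = m S'"
    show "S = S'"
      by (rule trans[OF S_eq[OF S] trans[OF _ S_eq[OF S', symmetric]]]) (simp add: eq)
  qed
  moreover have "m ` ?A \<subseteq> insert 0 ((\<lambda>t. g t x) ` ?I)" using m_in by blast
  moreover have "finite ?I" using fin by auto
  ultimately have "card ?A \<le> card (insert 0 ((\<lambda>t. g t x) ` ?I))"
    by (intro card_inj_on_le) auto
  also have "\<dots> \<le> Suc (card ((\<lambda>t. g t x) ` ?I))" by (rule card_insert_le_m1) auto
  also have "\<dots> \<le> Suc (card ?I)" using \<open>finite ?I\<close> card_image_le by auto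
  finally show ?thesis .
qed

text \<open>The condition on \<open>\<alpha>\<close> says that the pattern of coordinates \<open>0\<close> and \<open>1\<close> selects a member of \<open>\<alpha>\<close>:
the set belonging to \<open>S\<close> in the statement contains the threshold set of \<open>S\<close>.\<close>

lemma cover_dim_le_card_intermediate:
  assumes fin: "finite T" and ne: "topspace X \<noteq> {}"
    and cont: "\<And>t. t \<in> T \<Longrightarrow> continuous_map X euclideanreal (g t)"
    and range: "\<And>t x. \<lbrakk>t \<in> T; x \<in> topspace X\<rbrakk> \<Longrightarrow> 0 \<le> g t x \<and> g t x \<le> 1"
    and few: "\<And>x. x \<in> topspace X \<Longrightarrow> card {t \<in> T. 0 < g t x \<and> g t x < 1} \<le> d"
    and subord: "\<And>S. S \<subseteq> T \<Longrightarrow> \<exists>U\<in>\<alpha>. \<forall>x\<in>topspace X.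
      (\<forall>t\<in>S. 0 < g t x) \<and> (\<forall>t\<in>T - S. g t x < 1) \<longrightarrow> x \<in> U"
  shows "cover_dim X \<alpha> \<le> d"
proof -
  let ?W = "threshold_set X T g"
  let ?\<beta> = "?W ` Pow T"
  have "finite_open_cover X ?\<beta>"
  proof -
    have "?W S \<subseteq> topspace X" for S by (auto simp: threshold_set_def)
    moreover have "x \<in> \<Union>?\<beta>" if "x \<in> topspace X" for x
      by (rule threshold_sets_cover[OF fin that, of g]) auto
    moreover have "openin X (?W S)" for S
      by (rule openin_threshold_set[OF fin cont])
    ultimately show ?thesis
      unfolding finite_open_cover_def using fin by blast
  qed
  moreover have "refines ?\<beta> \<alpha>"
    unfolding refines_def
  proof
    fix V assume "V \<in> ?\<beta>"
    then obtain S where S: "S \<subseteq> T" "V = ?W S" by auto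
    from subord[OF S(1)] obtain U where U: "U \<in> \<alpha>" "\<And>x. \<lbrakk>x \<in> topspace X; \<forall>t\<in>S. 0 < g t x;
        \<forall>t\<in>T - S. g t x < 1\<rbrakk> \<Longrightarrow> x \<in> U" by blast
    have "V \<subseteq> U"
    proof
      fix x assume "x \<in> V"
      then obtain c where c: "0 < c" "c < 1" "x \<in> topspace X"
          "\<And>t. t \<in> T \<Longrightarrow> if t \<in> S then c < g t x else g t x < c"
        unfolding S(2) threshold_set_def by auto
      show "x \<in> U"
      proof (rule U(2)[OF c(3)]; rule ballI)
        fix t assume "t \<in> S"
        then show "0 < g t x" using c(1) c(4)[of t] S(1) by auto
      next
        fix t assume "t \<in> T - S"
        then show "g t x < 1" using c(2) c(4)[of t] by auto
      qed
    qed
    then show "\<exists>U\<in>\<alpha>. V \<subseteq> U" using U(1) by blast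
  qed
  ultimately have "cover_dim X \<alpha> \<le> cover_ord X ?\<beta>" by (rule cover_dim_le_cover_ord)
  also have "\<dots> \<le> d"
  proof (rule cover_ord_le)
    show "finite ?\<beta>" using fin by auto
    show "topspace X \<noteq> {}" by fact
    fix x assume x: "x \<in> topspace X"
    have "{U \<in> ?\<beta>. x \<in> U} = ?W ` {S. S \<subseteq> T \<and> x \<in> ?W S}" by auto
    then have "card {U \<in> ?\<beta>. x \<in> U} \<le> card {S. S \<subseteq> T \<and> x \<in> ?W S}"
      using fin by (simp add: card_image_le)
    also have "\<dots> \<le> Suc (card {t \<in> T. 0 < g t x \<and> g t x < 1})"
      using card_threshold_sets_at_le[OF fin, of g x X] range x by blast
    finally show "card {U \<in> ?\<beta>. x \<in> U} \<le> Suc d" using few[OF x] by linarith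
  qed
  finally show ?thesis .
qed

section \<open>Levels charged by a positive functional\<close>

text \<open>A bump of height \<open>1\<close> at the level \<open>c\<close> that vanishes at distance \<open>1 / N\<close> and beyond.\<close>

definition tent :: "nat \<Rightarrow> real \<Rightarrow> real \<Rightarrow> real" where
  "tent N c y = max 0 (1 - real N * \<bar>y - c\<bar>)"

lemma tent_nonneg: "0 \<le> tent N c y" and tent_le_1: "tent N c y \<le> 1"
  by (auto simp: tent_def)

lemma tent_antimono: "N \<le> N' \<Longrightarrow> tent N' c y \<le> tent N c y"
  unfolding tent_def by (intro max.mono) (auto intro!: mult_right_mono)

lemma tent_ge_half: "\<lbrakk>2 * real N * \<bar>y - c\<bar> \<le> 1\<rbrakk> \<Longrightarrow> 1/2 \<le> tent N c y"
  unfolding tent_def by auto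

lemma continuous_map_tent:
  "continuous_map X euclideanreal g \<Longrightarrow> continuous_map X euclideanreal (\<lambda>x. tent N c (g x))"
  unfolding tent_def
  by (intro continuous_map_real_max continuous_map_diff continuous_map_real_mult
      continuous_map_real_abs continuous_map_const[THEN iffD2] disjI2) auto

text \<open>Tents around levels at distance at least \<open>2 / N\<close> have disjoint supports.\<close>

lemma sum_tent_le_1:
  assumes fin: "finite C" and sep: "\<And>c c'. \<lbrakk>c \<in> C; c' \<in> C; c \<noteq> c'\<rbrakk> \<Longrightarrow> 2 \<le> real N * \<bar>c - c'\<bar>"
  shows "(\<Sum>c\<in>C. tent N c y) \<le> 1"
proof (cases "\<exists>c\<in>C. 0 < tent N c y")
  case True
  then obtain c where c: "c \<in> C" "0 < tent N c y" by auto
  have "tent N c' y = 0" if "c' \<in> C - {c}" for c'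
  proof -
    have "2 \<le> real N * \<bar>c - c'\<bar>" using sep c that by auto
    also have "\<dots> \<le> real N * (\<bar>y - c\<bar> + \<bar>y - c'\<bar>)"
      by (intro mult_left_mono) linarith+
    also have "\<dots> = real N * \<bar>y - c\<bar> + real N * \<bar>y - c'\<bar>" by (rule distrib_left)
    finally show ?thesis using c(2) by (auto simp: tent_def)
  qed
  then have "(\<Sum>c'\<in>C. tent N c' y) = tent N c y"
    using fin c(1) by (simp add: sum.remove)
  then show ?thesis using tent_le_1 by simp
next
  case False
  then have "(\<Sum>c\<in>C. tent N c y) \<le> 0" by (intro sum_nonpos) (auto simp: not_less)
  then show ?thesis by simp
qed

text \<open>This replaces the fact that a finite measure charges at most countably many level sets of \<open>g\<close>.
If the tents around each of \<open>k + 2\<close> levels had mass at least \<open>1 / (k + 1)\<close> for every \<open>N\<close>, then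
tents so narrow that they are disjoint would have total mass above \<open>1\<close>.\<close>

lemma countable_charged_levels:
  fixes \<mu> :: "('x \<Rightarrow> real) \<Rightarrow> real"
  assumes add: "\<And>G H. \<lbrakk>continuous_map X euclideanreal G; continuous_map X euclideanreal H\<rbrakk>
      \<Longrightarrow> \<mu> (\<lambda>x. G x + H x) = \<mu> G + \<mu> H"
    and mono: "\<And>G H. \<lbrakk>continuous_map X euclideanreal G; continuous_map X euclideanreal H;
      \<And>x. x \<in> topspace X \<Longrightarrow> G x \<le> H x\<rbrakk> \<Longrightarrow> \<mu> G \<le> \<mu> H"
    and le_1: "\<mu> (\<lambda>_. 1) \<le> 1"
    and g: "continuous_map X euclideanreal g"
  shows "countable {c. \<exists>\<epsilon>>0. \<forall>N. \<epsilon> \<le> \<mu> (\<lambda>x. tent N c (g x))}"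
proof -
  define B where "B k = {c. \<forall>N. 1 / real (Suc k) \<le> \<mu> (\<lambda>x. tent N c (g x))}" for k
  have \<mu>_0: "\<mu> (\<lambda>_. 0) = 0" using add[of "\<lambda>_. 0" "\<lambda>_. 0"] by simp
  have \<mu>_sum: "\<mu> (\<lambda>x. \<Sum>c\<in>C. F c x) = (\<Sum>c\<in>C. \<mu> (F c))"
    if "finite C" "\<And>c. continuous_map X euclideanreal (F c)" for C :: "real set" and F
    using that(1)
  proof (induction C rule: finite_induct)
    case empty
    then show ?case by (simp add: \<mu>_0)
  next
    case (insert c C)
    have "continuous_map X euclideanreal (\<lambda>x. \<Sum>c\<in>C. F c x)"
      using insert that by (intro continuous_map_sum) auto
    then show ?case using insert that by (simp add: add)
  qed
  have "finite (B k)" for k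
  proof (rule ccontr)
    assume "infinite (B k)"
    then obtain C where C: "C \<subseteq> B k" "finite C" "card C = Suc (Suc k)"
      using infinite_arbitrarily_large by blast
    have "\<forall>\<^sub>F N in sequentially. 2 \<le> real N * \<bar>c - c'\<bar>" if "c \<noteq> c'" for c c' :: real
    proof -
      have "filterlim (\<lambda>N. \<bar>c - c'\<bar> * real N) at_top sequentially"
        using that by (intro filterlim_tendsto_pos_mult_at_top[OF tendsto_const _ filterlim_real_sequentially]) auto
      then show ?thesis by (simp add: filterlim_at_top mult.commute)
    qed
    then have "\<forall>\<^sub>F N in sequentially. \<forall>c\<in>C. \<forall>c'\<in>C. c \<noteq> c' \<longrightarrow> 2 \<le> real N * \<bar>c - c'\<bar>"
      using C(2) by (intro eventually_ball_finite ballI) (auto simp: eventually_conj_iff intro: eventually_mono)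
    then obtain N where N: "\<And>c c'. \<lbrakk>c \<in> C; c' \<in> C; c \<noteq> c'\<rbrakk> \<Longrightarrow> 2 \<le> real N * \<bar>c - c'\<bar>"
      by (auto simp: eventually_sequentially)
    have "real (card C) * (1 / real (Suc k)) \<le> (\<Sum>c\<in>C. \<mu> (\<lambda>x. tent N c (g x)))"
      by (rule sum_bounded_below) (use C(1) in \<open>auto simp: B_def\<close>)
    also have "\<dots> = \<mu> (\<lambda>x. \<Sum>c\<in>C. tent N c (g x))"
      using C(2) continuous_map_tent[OF g] by (intro \<mu>_sum[symmetric]) auto
    also have "\<dots> \<le> \<mu> (\<lambda>_. 1)"
      using C(2) g by (intro mono sum_tent_le_1 N continuous_map_sum continuous_map_tent) auto
    also have "\<dots> \<le> 1" by fact
    finally show False unfolding C(3) by (simp add: field_simps)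
  qed
  moreover have "{c. \<exists>\<epsilon>>0. \<forall>N. \<epsilon> \<le> \<mu> (\<lambda>x. tent N c (g x))} \<subseteq> (\<Union>k. B k)"
  proof clarify
    fix c \<epsilon> :: real assume "0 < \<epsilon>" and le: "\<forall>N. \<epsilon> \<le> \<mu> (\<lambda>x. tent N c (g x))"
    then obtain k where "1 / real (Suc k) < \<epsilon>" by (metis nat_approx_posE)
    then have "1 / real (Suc k) \<le> \<mu> (\<lambda>x. tent N c (g x))" for N
      using spec[OF le, of N] by linarith
    then have "c \<in> B k" by (auto simp: B_def)
    then show "c \<in> (\<Union>k. B k)" by blast
  qed
  ultimately show ?thesis
    by (meson countable_UN countable_finite countable_subset countableI_type)
qed

section \<open>Faces and the maximum principle\<close>

text \<open>Points of \<open>K\<close> are functionals on \<open>D\<close>, so convex combinations are compared on \<open>D\<close> only.\<close>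

definition face :: "'a set \<Rightarrow> ('a \<Rightarrow> complex) set \<Rightarrow> ('a \<Rightarrow> complex) set \<Rightarrow> bool" where
  "face D K F \<longleftrightarrow> F \<subseteq> K \<and>
     (\<forall>\<tau>\<in>F. \<forall>\<sigma>\<in>K. \<forall>\<rho>\<in>K. \<forall>t::real. 0 < t \<and> t < 1 \<and>
       (\<forall>x\<in>D. \<tau> x = complex_of_real t * \<sigma> x + complex_of_real (1 - t) * \<rho> x) \<longrightarrow>
       \<sigma> \<in> F \<and> \<rho> \<in> F)"

lemma face_subset: "face D K F \<Longrightarrow> F \<subseteq> K"
  by (simp add: face_def)

lemma faceI:
  assumes "F \<subseteq> K"
    and "\<And>\<tau> \<sigma> \<rho> t. \<lbrakk>\<tau> \<in> F; \<sigma> \<in> K; \<rho> \<in> K; 0 < t; t < (1::real);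
      \<And>x. x \<in> D \<Longrightarrow> \<tau> x = complex_of_real t * \<sigma> x + complex_of_real (1 - t) * \<rho> x\<rbrakk> \<Longrightarrow> \<sigma> \<in> F"
  shows "face D K F"
  unfolding face_def
proof (intro conjI ballI allI impI; (elim conjE)?)
  fix \<tau> \<sigma> \<rho> and t :: real
  assume *: "\<tau> \<in> F" "\<sigma> \<in> K" "\<rho> \<in> K" "0 < t" "t < 1"
    and eq: "\<forall>x\<in>D. \<tau> x = complex_of_real t * \<sigma> x + complex_of_real (1 - t) * \<rho> x"
  show "\<sigma> \<in> F" by (rule assms(2)[OF *]) (use eq in auto)
  show "\<rho> \<in> F" by (rule assms(2)[OF *(1) *(3) *(2), of "1 - t"]) (use eq * in auto)
qed fact

lemma faceD:
  assumes "face D K F" "\<tau> \<in> F" "\<sigma> \<in> K" "\<rho> \<in> K" "0 < t" "t < (1::real)"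
    "\<And>x. x \<in> D \<Longrightarrow> \<tau> x = complex_of_real t * \<sigma> x + complex_of_real (1 - t) * \<rho> x"
  shows "\<sigma> \<in> F" "\<rho> \<in> F"
  using assms unfolding face_def by blast+

lemma face_Inter:
  assumes "\<F> \<noteq> {}" "\<And>F. F \<in> \<F> \<Longrightarrow> face D K F"
  shows "face D K (\<Inter>\<F>)"
proof (rule faceI)
  show "\<Inter>\<F> \<subseteq> K" using assms face_subset by blast
next
  fix \<tau> \<sigma> \<rho> t
  assume *: "\<tau> \<in> \<Inter>\<F>" "\<sigma> \<in> K" "\<rho> \<in> K" "0 < t" "t < (1::real)"
    "\<And>x. x \<in> D \<Longrightarrow> \<tau> x = complex_of_real t * \<sigma> x + complex_of_real (1 - t) * \<rho> x"
  show "\<sigma> \<in> \<Inter>\<F>"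
  proof
    fix F assume "F \<in> \<F>"
    then show "\<sigma> \<in> F" using faceD(1)[OF assms(2) _ *(2-6)] *(1) by blast
  qed
qed

definition affine_on :: "'a set \<Rightarrow> ('a \<Rightarrow> complex) set \<Rightarrow> (('a \<Rightarrow> complex) \<Rightarrow> real) \<Rightarrow> bool" where
  "affine_on D K f \<longleftrightarrow> (\<forall>\<tau>\<in>K. \<forall>\<sigma>\<in>K. \<forall>\<rho>\<in>K. \<forall>t::real. 0 < t \<and> t < 1 \<and>
       (\<forall>x\<in>D. \<tau> x = complex_of_real t * \<sigma> x + complex_of_real (1 - t) * \<rho> x) \<longrightarrow>
       f \<tau> = t * f \<sigma> + (1 - t) * f \<rho>)"

lemma affine_on_Re: "x \<in> D \<Longrightarrow> affine_on D K (\<lambda>\<tau>. Re (\<tau> x))"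
  and affine_on_Im: "x \<in> D \<Longrightarrow> affine_on D K (\<lambda>\<tau>. Im (\<tau> x))"
  by (auto simp: affine_on_def)

text \<open>The superlevel sets decrease with \<open>n\<close>, so this is the finite intersection property.\<close>

lemma decreasing_maximizers_nonempty:
  fixes f :: "nat \<Rightarrow> 'b::topological_space \<Rightarrow> real"
  assumes K: "compact K" and cont: "\<And>n. continuous_on UNIV (f n)"
    and dec: "\<And>n \<tau>. \<tau> \<in> K \<Longrightarrow> f (Suc n) \<tau> \<le> f n \<tau>"
    and ne: "\<And>n. \<exists>\<tau>\<in>K. c \<le> f n \<tau>"
  shows "\<exists>\<tau>\<in>K. \<forall>n. c \<le> f n \<tau>"
proof -
  have "K \<inter> (\<Inter>n\<in>UNIV. {\<tau>. c \<le> f n \<tau>}) \<noteq> {}"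
  proof (rule compact_imp_fip_image[OF K])
    show "closed {\<tau>. c \<le> f n \<tau>}" for n
      by (intro closed_Collect_le cont continuous_on_const)
    fix I :: "nat set" assume I: "finite I"
    obtain \<tau> where \<tau>: "\<tau> \<in> K" "c \<le> f (Max (insert 0 I)) \<tau>" using ne by blast
    have "c \<le> f n \<tau>" if "n \<in> I" for n
    proof -
      have "f (Max (insert 0 I)) \<tau> \<le> f n \<tau>"
        by (rule lift_Suc_antimono_le[of "\<lambda>n. f n \<tau>"]) (use dec \<tau>(1) I that in auto)
      then show ?thesis using \<tau>(2) by simp
    qed
    then show "K \<inter> (\<Inter>n\<in>I. {\<tau>. c \<le> f n \<tau>}) \<noteq> {}" using \<tau>(1) by blast
  qed
  then show ?thesis by auto
qed

text \<open>The constant \<open>c\<close> is the maximum over \<open>F\<close> of the limit of the decreasing sequence \<open>f\<close>. The limit is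
affine and upper semicontinuous; hence its maximum is attained, and where it is attained at a convex
combination it is attained at both components. The lower bound \<open>b\<close> keeps the maxima of the
\<open>f n\<close> from decreasing to minus infinity.\<close>

lemma maximizers_form_face:
  assumes K: "compact K" and F: "face D K F" "closed F"
    and cont: "\<And>n. continuous_on UNIV (f n)" and aff: "\<And>n. affine_on D K (f n)"
    and dec: "\<And>n \<tau>. \<tau> \<in> K \<Longrightarrow> f (Suc n) \<tau> \<le> f n \<tau>"
    and \<tau>0: "\<tau>0 \<in> F" "\<And>n. b \<le> f n \<tau>0"
  shows "\<exists>c. b \<le> c \<and> face D K {\<tau> \<in> F. \<forall>n. c \<le> f n \<tau>} \<and>
    {\<tau> \<in> F. \<forall>n. c \<le> f n \<tau>} \<noteq> {} \<and> closed {\<tau> \<in> F. \<forall>n. c \<le> f n \<tau>}"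
proof -
  have cF: "compact F"
    using compact_Int_closed[OF K F(2)] face_subset[OF F(1)] by (simp add: inf.absorb2)
  have "\<exists>\<tau>\<in>F. \<forall>\<sigma>\<in>F. f n \<sigma> \<le> f n \<tau>" for n
    using \<tau>0(1) by (intro continuous_attains_sup[OF cF] continuous_on_subset[OF cont]) auto
  then obtain m where m: "\<And>n. m n \<in> F" "\<And>n \<sigma>. \<sigma> \<in> F \<Longrightarrow> f n \<sigma> \<le> f n (m n)" by metis
  define c where "c = (INF n. f n (m n))"
  have bdd: "bdd_below (range (\<lambda>n. f n (m n)))"
    using \<tau>0 m(2) by (intro bdd_belowI[of _ b]) (force intro: order_trans)
  have c_le: "c \<le> f n (m n)" for n
    unfolding c_def by (rule cINF_lower[OF bdd]) simp
  have upper: "\<exists>n. f n \<tau> < c + \<delta>" if "\<tau> \<in> F" "0 < \<delta>" for \<tau> \<delta>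
  proof -
    have "\<exists>n\<in>UNIV. f n (m n) < c + \<delta>"
      using bdd that(2) by (subst cINF_less_iff[symmetric]) (auto simp: c_def)
    then show ?thesis using m(2)[OF that(1)] order.strict_trans1 by blast
  qed
  have "b \<le> c" unfolding c_def using \<tau>0 m(2) by (intro cINF_greatest) (auto intro: order_trans)
  moreover have "face D K {\<tau> \<in> F. \<forall>n. c \<le> f n \<tau>}"
  proof (rule faceI)
    show "{\<tau> \<in> F. \<forall>n. c \<le> f n \<tau>} \<subseteq> K" using face_subset[OF F(1)] by blast
  next
    fix \<tau> \<sigma> \<rho> t
    assume \<tau>: "\<tau> \<in> {\<tau> \<in> F. \<forall>n. c \<le> f n \<tau>}" and K': "\<sigma> \<in> K" "\<rho> \<in> K"
      and t: "0 < t" "t < (1::real)"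
      and eq: "\<And>x. x \<in> D \<Longrightarrow> \<tau> x = complex_of_real t * \<sigma> x + complex_of_real (1 - t) * \<rho> x"
    have \<sigma>\<rho>: "\<sigma> \<in> F" "\<rho> \<in> F" using faceD[OF F(1) _ K' t eq] \<tau> by auto
    have f_eq: "f n \<tau> = t * f n \<sigma> + (1 - t) * f n \<rho>" for n
      using aff[of n] \<tau> face_subset[OF F(1)] K' t eq unfolding affine_on_def by blast
    have "c \<le> f n \<sigma>" for n
    proof (rule ccontr)
      assume "\<not> c \<le> f n \<sigma>"
      (* the second component exceeds the maximum c by less than any given amount late in the
         sequence, so it cannot make up for the deficit of the first *)
      then have gap: "0 < t * (c - f n \<sigma>)" using t by simp
      obtain k where k: "f k \<rho> < c + t * (c - f n \<sigma>)" using upper[OF \<sigma>\<rho>(2) gap] by blast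
      define N where "N = max n k"
      have "f N \<sigma> \<le> f n \<sigma>" "f N \<rho> \<le> f k \<rho>"
        by (rule lift_Suc_antimono_le[of "\<lambda>n. f n \<sigma>"], use dec K' in \<open>auto simp: N_def\<close>)
           (rule lift_Suc_antimono_le[of "\<lambda>n. f n \<rho>"], use dec K' in \<open>auto simp: N_def\<close>)
      then have "f N \<tau> \<le> t * f n \<sigma> + (1 - t) * f k \<rho>"
        unfolding f_eq using t by (intro add_mono mult_left_mono) auto
      also have "\<dots> < t * f n \<sigma> + (1 - t) * (c + t * (c - f n \<sigma>))"
        using k t by simp
      also have "\<dots> = c - t * (t * (c - f n \<sigma>))" by (simp add: algebra_simps)
      also have "\<dots> < c" using gap t by simp
      finally show False using \<tau> by (auto simp: not_less[symmetric])
    qed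
    then show "\<sigma> \<in> {\<tau> \<in> F. \<forall>n. c \<le> f n \<tau>}" using \<sigma>\<rho> by blast
  qed
  moreover have "{\<tau> \<in> F. \<forall>n. c \<le> f n \<tau>} \<noteq> {}"
  proof -
    have "\<exists>\<tau>\<in>F. \<forall>n. c \<le> f n \<tau>"
      using cF cont dec m(1) c_le face_subset[OF F(1)]
      by (intro decreasing_maximizers_nonempty) blast+
    then show ?thesis by blast
  qed
  moreover have "closed {\<tau> \<in> F. \<forall>n. c \<le> f n \<tau>}"
    using F(2) cont by (intro closed_Collect_conj closed_Collect_all closed_Collect_le) auto
  ultimately show ?thesis by blast
qed

text \<open>The argument of the Krein-Milman theorem. A minimal closed face is a single point, because the
maximizers of an evaluation on it form a smaller face unless the evaluation is constant, and
evaluations separate points. Minimality is phrased for complements to obtain unions of chains.\<close>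

lemma closed_face_contains_extreme_point:
  assumes K: "compact K" "K \<subseteq> extensional D" and F: "face D K F" "closed F" "F \<noteq> {}"
  obtains \<tau> where "\<tau> \<in> F" "face D K {\<tau>}"
proof -
  define \<A> where "\<A> = {G. G \<subseteq> F \<and> G \<noteq> {} \<and> closed G \<and> face D K G}"
  have "\<exists>U\<in>uminus ` \<A>. \<forall>V\<in>uminus ` \<A>. U \<subseteq> V \<longrightarrow> V = U"
  proof (rule subset_Zorn_nonempty)
    show "uminus ` \<A> \<noteq> {}" using F by (auto simp: \<A>_def)
  next
    fix \<C> assume ne: "\<C> \<noteq> {}" and chain: "subset.chain (uminus ` \<A>) \<C>"
    have sub: "uminus ` \<C> \<subseteq> \<A>" using chain unfolding subset.chain_def by auto
    have "K \<inter> \<Inter>(uminus ` \<C>) \<noteq> {}"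
    proof (rule compact_imp_fip_image[OF K(1), of \<C> uminus, simplified])
      show "closed (- V)" if "V \<in> \<C>" for V using sub that by (auto simp: \<A>_def)
      fix \<B> assume \<B>: "finite \<B>" "\<B> \<subseteq> \<C>"
      show "K \<inter> (\<Inter>V\<in>\<B>. - V) \<noteq> {}"
      proof (cases "\<B> = {}")
        case True
        then show ?thesis using F(3) face_subset[OF F(1)] by auto
      next
        case False
        have "\<Union>\<B> \<in> \<B>"
        proof (rule Union_in_chain[OF \<B>(1) False])
          show "subset.chain (uminus ` \<A>) \<B>"
            using \<B>(2) chain unfolding subset_chain_def by (meson subset_iff subset_trans)
        qed
        then have "- \<Union>\<B> \<in> \<A>" using \<B>(2) sub by blast
        then have "- \<Union>\<B> \<noteq> {}" "- \<Union>\<B> \<subseteq> K" using face_subset by (auto simp: \<A>_def)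
        then show ?thesis by auto
      qed
    qed
    moreover have "face D K (\<Inter>(uminus ` \<C>))"
      using ne sub by (intro face_Inter) (auto simp: \<A>_def)
    moreover have "closed (\<Inter>(uminus ` \<C>))" using sub by (intro closed_Inter) (auto simp: \<A>_def)
    moreover have "\<Inter>(uminus ` \<C>) \<subseteq> F" using ne sub unfolding \<A>_def by blast
    ultimately have "\<Inter>(uminus ` \<C>) \<in> \<A>" unfolding \<A>_def by blast
    then show "\<Union>\<C> \<in> uminus ` \<A>"
      by (intro image_eqI[of _ _ "\<Inter>(uminus ` \<C>)"]) auto
  qed
  then obtain G where G: "G \<in> \<A>" and min: "\<And>H. \<lbrakk>H \<in> \<A>; H \<subseteq> G\<rbrakk> \<Longrightarrow> H = G"
    by (auto simp: compl_le_compl_iff)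
  have const: "f \<sigma> \<le> f \<rho>" if f: "\<sigma> \<in> G" "\<rho> \<in> G" "continuous_on UNIV f" "affine_on D K f" for f \<sigma> \<rho>
  proof (rule ccontr)
    assume neg: "\<not> f \<sigma> \<le> f \<rho>"
    have G': "face D K G" "closed G" using G by (auto simp: \<A>_def)
    obtain c where c: "f \<sigma> \<le> c" "face D K {\<tau> \<in> G. c \<le> f \<tau>}" "{\<tau> \<in> G. c \<le> f \<tau>} \<noteq> {}"
        "closed {\<tau> \<in> G. c \<le> f \<tau>}"
      using maximizers_form_face[OF K(1) G', of "\<lambda>_. f" \<sigma> "f \<sigma>"] f by simp blast
    have "{\<tau> \<in> G. c \<le> f \<tau>} = G"
      using c G by (intro min) (auto simp: \<A>_def)
    then show False using that(2) c(1) neg by force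
  qed
  obtain \<tau> where \<tau>: "\<tau> \<in> G" using G by (auto simp: \<A>_def)
  have "\<sigma> = \<tau>" if \<sigma>: "\<sigma> \<in> G" for \<sigma>
  proof (rule extensionalityI)
    have "G \<subseteq> K" using G face_subset by (auto simp: \<A>_def)
    then show "\<sigma> \<in> extensional D" "\<tau> \<in> extensional D" using \<sigma> \<tau> K(2) by auto
    fix x assume x: "x \<in> D"
    have "continuous_on UNIV (\<lambda>\<tau>::'a \<Rightarrow> complex. Re (\<tau> x))" "continuous_on UNIV (\<lambda>\<tau>::'a \<Rightarrow> complex. Im (\<tau> x))"
      by (intro continuous_intros continuous_on_product_coordinates)+
    then show "\<sigma> x = \<tau> x"
      using const[OF \<sigma> \<tau>] const[OF \<tau> \<sigma>] affine_on_Re[OF x] affine_on_Im[OF x]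
      by (intro complex_eqI order_antisym) blast+
  qed
  then have "G = {\<tau>}" using \<tau> by blast
  then show thesis using G that by (auto simp: \<A>_def)
qed

text \<open>The case needed here: a lower bound \<open>b\<close> on the limit of a decreasing sequence of continuous affine
functions that holds at some point of \<open>K\<close> holds at an extreme point.\<close>

lemma Bauer_maximum_principle:
  assumes K: "compact K" "closed K" "K \<subseteq> extensional D"
    and cont: "\<And>n. continuous_on UNIV (f n)" and aff: "\<And>n. affine_on D K (f n)"
    and dec: "\<And>n \<tau>. \<tau> \<in> K \<Longrightarrow> f (Suc n) \<tau> \<le> f n \<tau>"
    and \<sigma>: "\<sigma> \<in> K" "\<And>n. b \<le> f n \<sigma>"
  obtains \<tau> where "\<tau> \<in> K" "face D K {\<tau>}" "\<And>n::nat. b \<le> f n \<tau>"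
proof -
  have "face D K K" by (rule faceI) auto
  from maximizers_form_face[where f = f and b = b, OF K(1) this K(2) cont aff dec \<sigma>]
  obtain c where c: "b \<le> c" "face D K {\<tau> \<in> K. \<forall>n. c \<le> f n \<tau>}" "{\<tau> \<in> K. \<forall>n. c \<le> f n \<tau>} \<noteq> {}"
    "closed {\<tau> \<in> K. \<forall>n. c \<le> f n \<tau>}" by blast
  from closed_face_contains_extreme_point[OF K(1,3) c(2,4,3)]
  obtain \<tau> where "\<tau> \<in> {\<tau> \<in> K. \<forall>n. c \<le> f n \<tau>}" "face D K {\<tau>}" .
  then show thesis using c(1) by (intro that[of \<tau>]) (auto intro: order_trans)
qed

section \<open>Traces and norms of matrices\<close>

definition tr :: "nat \<Rightarrow> complex mat \<Rightarrow> complex" where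
  "tr r M = (\<Sum>a<r. M $$ (a, a))"

lemma tr_add: "\<lbrakk>M \<in> carrier_mat r r; N \<in> carrier_mat r r\<rbrakk> \<Longrightarrow> tr r (M + N) = tr r M + tr r N"
  by (simp add: tr_def sum.distrib)

lemma tr_smult: "M \<in> carrier_mat r r \<Longrightarrow> tr r (c \<cdot>\<^sub>m M) = c * tr r M"
  by (simp add: tr_def sum_distrib_left)

lemma index_mult_mat_sum:
  "\<lbrakk>M \<in> carrier_mat r s; N \<in> carrier_mat s q; a < r; b < q\<rbrakk>
    \<Longrightarrow> (M * N) $$ (a, b) = (\<Sum>c<s. M $$ (a, c) * N $$ (c, b))"
  by (simp add: scalar_prod_def atLeast0LessThan)

lemma tr_mult_comm:
  assumes "M \<in> carrier_mat r s" "N \<in> carrier_mat s r"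
  shows "tr r (M * N) = tr s (N * M)"
proof -
  have "tr r (M * N) = (\<Sum>a<r. \<Sum>b<s. M $$ (a, b) * N $$ (b, a))"
    using assms by (simp add: tr_def scalar_prod_def atLeast0LessThan)
  also have "\<dots> = (\<Sum>b<s. \<Sum>a<r. M $$ (a, b) * N $$ (b, a))" by (rule sum.swap)
  also have "\<dots> = tr s (N * M)"
    using assms by (simp add: tr_def scalar_prod_def atLeast0LessThan mult.commute)
  finally show ?thesis .
qed

lemma mat_adjoint_carrier: "M \<in> carrier_mat r s \<Longrightarrow> mat_adjoint M \<in> carrier_mat s r"
  by (auto simp: mat_adjoint_def mat_of_rows_def)

lemma index_mat_adjoint:
  "\<lbrakk>M \<in> carrier_mat r s; a < s; b < r\<rbrakk> \<Longrightarrow> mat_adjoint M $$ (a, b) = cnj (M $$ (b, a))"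
  by (auto simp: mat_adjoint_def mat_of_rows_def)

lemma tr_adjoint_mult:
  assumes "M \<in> carrier_mat r r"
  shows "tr r (mat_adjoint M * M) = complex_of_real (\<Sum>b<r. \<Sum>a<r. (cmod (M $$ (a, b)))\<^sup>2)"
proof -
  have norm_sq: "cnj z * z = complex_of_real ((cmod z)\<^sup>2)" for z
    by (subst mult.commute) (rule complex_norm_square[symmetric])
  have "tr r (mat_adjoint M * M) = (\<Sum>b<r. \<Sum>a<r. cnj (M $$ (a, b)) * M $$ (a, b))"
    using assms mat_adjoint_carrier[OF assms]
    by (simp add: tr_def scalar_prod_def atLeast0LessThan index_mat_adjoint)
  also have "\<dots> = (\<Sum>b<r. \<Sum>a<r. complex_of_real ((cmod (M $$ (a, b)))\<^sup>2))"
    unfolding norm_sq by (rule refl)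
  finally show ?thesis by simp
qed

lemma tr_one: "tr r (1\<^sub>m r) = of_nat r"
  by (simp add: tr_def)

text \<open>If the columns of \<open>C\<close> are a basis of the column space of \<open>P\<close> then \<open>P = C * E\<close> for some \<open>E\<close>. As \<open>P\<close>
fixes its columns, \<open>C * (E * C) = C\<close>, so \<open>E * C\<close> is the identity of size \<open>rank P\<close>, and it has the same
trace as \<open>P\<close>.\<close>

lemma tr_idempotent_eq_rank:
  assumes P: "P \<in> carrier_mat r r" "P * P = P"
  shows "tr r P = of_nat (vec_space.rank r P)"
proof -
  interpret vec_space "TYPE(complex)" r .
  obtain S where S: "maximal S (\<lambda>T. T \<subseteq> set (cols P) \<and> lin_indpt T)"
    using maximal_exists_superset[of "set (cols P)" "\<lambda>T. T \<subseteq> set (cols P) \<and> lin_indpt T" "{}"]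
    by (auto simp: finite_lin_indpt2)
  then have S_sub: "S \<subseteq> set (cols P)" and indpt: "lin_indpt S"
    by (auto simp: maximal_def)
  have card: "rank P = card S" by (rule rank_card_indpt[OF P(1) S])
  have cols_P: "set (cols P) \<subseteq> carrier_vec r" using P(1) cols_dim by blast
  then have S_car: "S \<subseteq> carrier_vec r" using S_sub by blast
  have fin: "finite S" using S_sub finite_subset by blast
  have in_span: "v \<in> span S" if v: "v \<in> set (cols P)" for v
  proof (cases "v \<in> S")
    case True
    then show ?thesis using S_car span_mem by blast
  next
    case False
    have "\<not> lin_indpt (insert v S)"
      using S v S_sub False unfolding maximal_def by blast
    then show ?thesis
      using lin_dep_iff_in_span[OF S_car indpt _ False] v cols_P by auto
  qed
  obtain bs where bs: "set bs = S" "distinct bs" using finite_distinct_list[OF fin] by blast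
  define n where "n = length bs"
  have n: "n = rank P" using bs distinct_card card n_def by metis
  define C where "C = mat_of_cols r bs"
  have C: "C \<in> carrier_mat r n" unfolding C_def n_def by simp
  have cols_C: "cols C = bs" unfolding C_def using S_car bs by (intro cols_mat_of_cols) auto
  have "\<exists>e. e \<in> carrier_vec n \<and> C *\<^sub>v e = v" if v: "v \<in> set (cols P)" for v
  proof -
    obtain a where "v = lincomb a S"
      using in_span[OF v] fin S_car finite_in_span by blast
    then have "C *\<^sub>v vec n (\<lambda>i. a (col C i)) = v"
      using mat_mult_eq_lincomb[OF C, of a] cols_C bs by simp
    then show ?thesis by (intro exI[of _ "vec n (\<lambda>i. a (col C i))"]) auto
  qed
  then obtain e where e: "\<And>v. v \<in> set (cols P) \<Longrightarrow> e v \<in> carrier_vec n \<and> C *\<^sub>v e v = v" by metis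
  define E where "E = mat_of_cols n (map e (cols P))"
  have E: "E \<in> carrier_mat n r"
    unfolding E_def using mat_of_cols_carrier(1)[of n "map e (cols P)"] P(1) by (simp only: length_map cols_length carrier_matD)
  have CE: "C * E = P"
  proof (rule mat_col_eqI)
    fix j assume "j < dim_col P"
    then have j: "j < r" "col P j \<in> set (cols P)" using P(1) by (auto simp: cols_def)
    have "col (C * E) j = C *\<^sub>v col E j" using C E j(1) by (intro col_mult2)
    also have "col E j = e (col P j)"
      unfolding E_def using P(1) j e by (subst col_mat_of_cols) auto
    also have "C *\<^sub>v e (col P j) = col P j" using e j by blast
    finally show "col (C * E) j = col P j" .
  qed (use C E P in auto)
  have PC: "P * C = C"
  proof (rule mat_col_eqI)
    fix j assume j: "j < dim_col C"
    have "col C j \<in> set (cols C)" using j C by (auto simp: cols_def)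
    then have "col C j \<in> set (cols P)" using cols_C bs S_sub by auto
    then obtain i where i: "i < r" "col C j = col P i" using P(1) by (auto simp: cols_def)
    have "col (P * C) j = P *\<^sub>v col C j" using P C j by (intro col_mult2) auto
    also have "\<dots> = col (P * P) i" unfolding i(2) using P i(1) by (intro col_mult2[symmetric])
    also have "\<dots> = col C j" using P(2) i(2) by simp
    finally show "col (P * C) j = col C j" .
  qed (use C P in auto)
  have EC: "E * C = 1\<^sub>m n"
  proof (rule mat_col_eqI)
    fix j assume "j < dim_col (1\<^sub>m n)"
    then have j: "j < n" by simp
    let ?w = "col (E * C) j - col (1\<^sub>m n) j"
    have w: "?w \<in> carrier_vec n" using E C j by auto
    (* the columns of C are independent, so the difference vanishes *)
    have "C *\<^sub>v ?w = C *\<^sub>v col (E * C) j - C *\<^sub>v col (1\<^sub>m n) j"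
      using C E j by (intro mult_minus_distrib_mat_vec) auto
    also have "C *\<^sub>v col (E * C) j = col (C * (E * C)) j"
      using C E j by (intro col_mult2[symmetric]) auto
    also have "C * (E * C) = C" using assoc_mult_mat[OF C E C] CE PC by simp
    also have "C *\<^sub>v col (1\<^sub>m n) j = col (C * 1\<^sub>m n) j"
      using C j by (intro col_mult2[symmetric]) auto
    also have "C * 1\<^sub>m n = C" using C by simp
    finally have "C *\<^sub>v ?w = 0\<^sub>v r" using C j by simp
    then have "?w = 0\<^sub>v n"
      using lin_depI[OF C w] cols_C bs indpt by auto
    then have "?w $ i = 0" if "i < n" for i using that by simp
    then show "col (E * C) j = col (1\<^sub>m n) j"
      using E C j by (intro eq_vecI) auto
  qed (use E C in auto)
  have "tr r P = tr n (E * C)" using tr_mult_comm[OF C E] CE by simp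
  then show ?thesis by (simp add: EC tr_one n)
qed

lemma diag_block_mat_equal_blocks:
  assumes "\<And>N. N \<in> set Ns \<Longrightarrow> N \<in> carrier_mat r r"
  shows "diag_block_mat Ns \<in> carrier_mat (length Ns * r) (length Ns * r)"
    and "tr (length Ns * r) (diag_block_mat Ns) = (\<Sum>N\<leftarrow>Ns. tr r N)"
  using assms
proof (induction Ns)
  case Nil
  case 1 show ?case by simp
next
  case Nil
  case 2 show ?case by (simp add: tr_def)
next
  case (Cons N Ns)
  case 1
  have N: "N \<in> carrier_mat r r" and D: "diag_block_mat Ns \<in> carrier_mat (length Ns * r) (length Ns * r)"
    using Cons 1 by auto
  then show ?case by (auto simp: Let_def)
next
  case (Cons N Ns)
  case 2
  let ?D = "diag_block_mat Ns" and ?q = "length Ns * r"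
  have split: "(\<Sum>a<r + q. F a) = (\<Sum>a<r. F a) + (\<Sum>a<q. F (r + a))" for F :: "nat \<Rightarrow> complex" and q
    by (induction q) (auto simp: add.assoc)
  have N: "N \<in> carrier_mat r r" and D: "?D \<in> carrier_mat ?q ?q" and IH: "tr ?q ?D = (\<Sum>N\<leftarrow>Ns. tr r N)"
    using Cons 2 by auto
  have "tr (r + ?q) (diag_block_mat (N # Ns))
      = (\<Sum>a<r + ?q. if a < r then N $$ (a, a) else ?D $$ (a - r, a - r))"
    unfolding tr_def using N D by (intro sum.cong) (auto simp: Let_def)
  also have "\<dots> = tr r N + tr ?q ?D"
    unfolding tr_def split by simp
  finally show ?case by (simp add: IH)
qed

lemma diag_block_mat_mult:
  fixes f g :: "'y \<Rightarrow> complex mat"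
  assumes "\<And>y. y \<in> set ys \<Longrightarrow> f y \<in> carrier_mat r r \<and> g y \<in> carrier_mat r r"
  shows "diag_block_mat (map f ys) * diag_block_mat (map g ys) = diag_block_mat (map (\<lambda>y. f y * g y) ys)"
  using assms
proof (induction ys)
  case Nil
  then show ?case by simp
next
  case (Cons y ys)
  let ?F = "diag_block_mat (map f ys)" and ?G = "diag_block_mat (map g ys)" and ?q = "length ys * r"
  have c: "f y \<in> carrier_mat r r" "g y \<in> carrier_mat r r" "?F \<in> carrier_mat ?q ?q" "?G \<in> carrier_mat ?q ?q"
    using Cons.prems diag_block_mat_equal_blocks(1)[of "map f ys" r] diag_block_mat_equal_blocks(1)[of "map g ys" r]
    by auto
  have IH: "?F * ?G = diag_block_mat (map (\<lambda>y. f y * g y) ys)" using Cons by auto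
  have "four_block_mat (f y) (0\<^sub>m r ?q) (0\<^sub>m ?q r) ?F * four_block_mat (g y) (0\<^sub>m r ?q) (0\<^sub>m ?q r) ?G
      = four_block_mat (f y * g y) (0\<^sub>m r ?q) (0\<^sub>m ?q r) (?F * ?G)"
    using c by (subst mult_four_block_mat[OF c(1) _ _ c(3) c(2) _ _ c(4)]) auto
  then show ?case using c by (simp add: Let_def IH[symmetric])
qed

text \<open>The trace is cyclic, so \<open>V\<close> and its adjoint combine to the diagonal sum of the \<open>p y\<close>, which act as units on
the \<open>f y\<close>.\<close>

lemma tr_representation:
  assumes f: "\<And>y. y \<in> set ys \<Longrightarrow> f y \<in> carrier_mat r r \<and> p y \<in> carrier_mat r r \<and> f y * p y = f y"
    and V: "V \<in> carrier_mat s (length ys * r)" "mat_adjoint V * V = diag_block_mat (map p ys)"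
  shows "tr s (V * diag_block_mat (map f ys) * mat_adjoint V) = (\<Sum>y\<leftarrow>ys. tr r (f y))"
proof -
  let ?q = "length ys * r" and ?F = "diag_block_mat (map f ys)"
  have V': "mat_adjoint V \<in> carrier_mat ?q s" by (rule mat_adjoint_carrier[OF V(1)])
  have F: "?F \<in> carrier_mat ?q ?q" using diag_block_mat_equal_blocks(1)[of "map f ys" r] f by auto
  have "tr s (V * ?F * mat_adjoint V) = tr ?q (mat_adjoint V * (V * ?F))"
    using V V' F by (intro tr_mult_comm) auto
  also have "mat_adjoint V * (V * ?F) = diag_block_mat (map p ys) * ?F"
    using V V' F by (simp add: assoc_mult_mat[symmetric])
  also have "tr ?q \<dots> = tr ?q (?F * diag_block_mat (map p ys))"
    using diag_block_mat_equal_blocks(1)[of "map p ys" r] f F by (intro tr_mult_comm) auto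
  also have "?F * diag_block_mat (map p ys) = diag_block_mat (map (\<lambda>y. f y * p y) ys)"
    using f by (intro diag_block_mat_mult) auto
  also have "map (\<lambda>y. f y * p y) ys = map f ys" using f by auto
  also have "tr ?q (diag_block_mat (map f ys)) = (\<Sum>y\<leftarrow>ys. tr r (f y))"
    by (subst diag_block_mat_equal_blocks(2)[of "map f ys" r, simplified length_map]) (use f in \<open>auto simp: comp_def\<close>)
  finally show ?thesis .
qed

definition sqnorm :: "complex vec \<Rightarrow> real" where
  "sqnorm v = (\<Sum>a<dim_vec v. (cmod (v $ a))\<^sup>2)"

lemma inner_self_eq_sqnorm: "Re (v \<bullet>c v) = sqnorm v"
  unfolding scalar_prod_def sqnorm_def atLeast0LessThan Re_sum dim_vec_conjugate
  by (intro sum.cong refl) (simp add: cmod_power2, simp add: power2_eq_square)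

lemma sqnorm_nonneg: "0 \<le> sqnorm v"
  by (simp add: sqnorm_def sum_nonneg)

text \<open>A crude bound, used only to see that the suprema that define the norms are finite.\<close>

lemma sqrt_sqnorm_mult_le_entries:
  assumes "M \<in> carrier_mat r r" "\<And>a b. \<lbrakk>a < r; b < r\<rbrakk> \<Longrightarrow> cmod (M $$ (a, b)) \<le> B"
    and "v \<in> carrier_vec r" "sqnorm v \<le> 1"
  shows "sqrt (sqnorm (M *\<^sub>v v)) \<le> real r * real r * B"
proof -
  have v1: "cmod (v $ b) \<le> 1" if "b < r" for b
  proof -
    have "(cmod (v $ b))\<^sup>2 \<le> sqnorm v"
      unfolding sqnorm_def using assms(3) that by (intro member_le_sum) auto
    then have "(cmod (v $ b))\<^sup>2 \<le> 1\<^sup>2" using assms(4) by simp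
    then show ?thesis by (rule power2_le_imp_le) simp
  qed
  have entry: "cmod ((M *\<^sub>v v) $ a) \<le> real r * B" if "a < r" for a
  proof -
    have "(M *\<^sub>v v) $ a = (\<Sum>b<r. M $$ (a, b) * v $ b)"
      using assms(1,3) that by (simp add: scalar_prod_def atLeast0LessThan)
    also have "cmod \<dots> \<le> (\<Sum>b<r. cmod (M $$ (a, b) * v $ b))" by (rule norm_sum)
    also have "\<dots> \<le> (\<Sum>b<r. B)"
    proof (rule sum_mono)
      fix b assume "b \<in> {..<r}"
      then have "cmod (M $$ (a, b)) * cmod (v $ b) \<le> B * 1"
        using assms(2)[OF that, of b] v1 norm_ge_zero[of "M $$ (a, b)"]
        by (intro mult_mono) (auto intro: order_trans[OF norm_ge_zero])
      then show "cmod (M $$ (a, b) * v $ b) \<le> B" by (simp add: norm_mult)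
    qed
    finally show ?thesis by simp
  qed
  have "sqrt (sqnorm (M *\<^sub>v v)) = L2_set (\<lambda>a. cmod ((M *\<^sub>v v) $ a)) {..<r}"
    using assms(1) by (simp add: sqnorm_def L2_set_def)
  also have "\<dots> \<le> (\<Sum>a<r. cmod ((M *\<^sub>v v) $ a))"
    by (intro L2_set_le_sum) auto
  also have "\<dots> \<le> (\<Sum>a<r. real r * B)" using entry by (intro sum_mono) auto
  finally show ?thesis by simp
qed

lemma mat_opnorm_sqnorm:
  "mat_opnorm M = (SUP v \<in> {v \<in> carrier_vec (dim_col M). sqnorm v \<le> 1}. sqrt (sqnorm (M *\<^sub>v v)))"
  unfolding mat_opnorm_def inner_self_eq_sqnorm by (rule refl)

lemma mat_opnorm_le:
  assumes "M \<in> carrier_mat r r" "\<And>a b. \<lbrakk>a < r; b < r\<rbrakk> \<Longrightarrow> cmod (M $$ (a, b)) \<le> B"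
  shows "mat_opnorm M \<le> real r * real r * B"
  unfolding mat_opnorm_sqnorm
proof (rule cSUP_least)
  have "0\<^sub>v r \<in> {v \<in> carrier_vec (dim_col M). sqnorm v \<le> 1}" using assms by (simp add: sqnorm_def)
  then show "{v \<in> carrier_vec (dim_col M). sqnorm v \<le> 1} \<noteq> {}" by blast
qed (use assms sqrt_sqnorm_mult_le_entries in auto)

lemma sqrt_sqnorm_mult_le:
  assumes M: "M \<in> carrier_mat r r" and v: "v \<in> carrier_vec r"
  shows "sqrt (sqnorm (M *\<^sub>v v)) \<le> mat_opnorm M * sqrt (sqnorm v)"
proof -
  let ?c = "sqrt (sqnorm v)"
  have sq_smult: "sqnorm (c \<cdot>\<^sub>v w) = (cmod c)\<^sup>2 * sqnorm w" for c w
    by (simp add: sqnorm_def norm_mult power_mult_distrib sum_distrib_left)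
  have scale: "sqrt (sqnorm (c \<cdot>\<^sub>v w)) = cmod c * sqrt (sqnorm w)" for c w
    by (simp add: sq_smult real_sqrt_mult)
  show ?thesis
  proof (cases "?c = 0")
    case True
    then have "(\<Sum>a<r. (cmod (v $ a))\<^sup>2) = 0" using v by (simp add: sqnorm_def)
    then have "v $ a = 0" if "a < r" for a using that by (subst (asm) sum_nonneg_eq_0_iff) auto
    then have "v = 0\<^sub>v r" using v by (intro eq_vecI) auto
    then have "M *\<^sub>v v = 0\<^sub>v r" using M by auto
    then show ?thesis using True by (simp add: sqnorm_def)
  next
    case False
    then have c: "0 < ?c" using sqnorm_nonneg[of v] by (simp add: order.order_iff_strict)
    define w where "w = complex_of_real (1 / ?c) \<cdot>\<^sub>v v"
    have w: "w \<in> carrier_vec r" using v by (simp add: w_def)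
    have "sqrt (sqnorm w) = 1" using c by (simp add: w_def scale norm_divide)
    then have w1: "sqnorm w \<le> 1" by simp
    have "sqrt (sqnorm (M *\<^sub>v w)) \<le> mat_opnorm M"
      unfolding mat_opnorm_sqnorm
    proof (rule cSUP_upper)
      show "w \<in> {v \<in> carrier_vec (dim_col M). sqnorm v \<le> 1}" using w w1 M by simp
      show "bdd_above ((\<lambda>v. sqrt (sqnorm (M *\<^sub>v v))) ` {v \<in> carrier_vec (dim_col M). sqnorm v \<le> 1})"
      proof (rule bdd_aboveI2)
        fix v assume "v \<in> {v \<in> carrier_vec (dim_col M). sqnorm v \<le> 1}"
        then have "v \<in> carrier_vec r" "sqnorm v \<le> 1" using M by auto
        then show "sqrt (sqnorm (M *\<^sub>v v)) \<le> real r * real r * (\<Sum>a<r. \<Sum>b<r. cmod (M $$ (a, b)))"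
        proof (rule sqrt_sqnorm_mult_le_entries[OF M, rotated])
          fix a b assume ab: "a < r" "b < r"
          have "cmod (M $$ (a, b)) \<le> (\<Sum>b<r. cmod (M $$ (a, b)))"
            using ab by (intro member_le_sum[of b "{..<r}" "\<lambda>b. cmod (M $$ (a, b))"]) auto
          also have "\<dots> \<le> (\<Sum>a<r. \<Sum>b<r. cmod (M $$ (a, b)))"
            using ab by (intro member_le_sum[of a "{..<r}" "\<lambda>a. \<Sum>b<r. cmod (M $$ (a, b))"]) (auto intro: sum_nonneg)
          finally show "cmod (M $$ (a, b)) \<le> (\<Sum>a<r. \<Sum>b<r. cmod (M $$ (a, b)))" .
        qed
      qed
    qed
    also have "M *\<^sub>v w = complex_of_real (1 / ?c) \<cdot>\<^sub>v (M *\<^sub>v v)"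
      unfolding w_def using M v by (simp add: mult_mat_vec)
    finally have "(1 / ?c) * sqrt (sqnorm (M *\<^sub>v v)) \<le> mat_opnorm M" using c by (simp add: scale norm_divide)
    then show ?thesis using c by (simp add: field_simps)
  qed
qed

text \<open>The trace of \<open>P * M * P\<close> is the sum of the values of the quadratic form of \<open>M\<close> at the columns of \<open>P\<close>,
whose squared lengths add up to the trace of \<open>P\<close>. So the bound involves the rank of \<open>P\<close> instead of
the ambient size, and the normalized traces below are contractive.\<close>

lemma cmod_tr_le:
  assumes M: "M \<in> carrier_mat r r" and P: "P \<in> carrier_mat r r" "P * P = P" "mat_adjoint P = P"
    and MP: "P * M = M" "M * P = M"
  shows "cmod (tr r M) \<le> mat_opnorm M * Re (tr r P)"
proof -
  have "tr r M = tr r (P * (M * P))" using MP by simp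
  also have "\<dots> = (\<Sum>a<r. \<Sum>c<r. cnj (col P a $ c) * (M *\<^sub>v col P a) $ c)"
    unfolding tr_def
  proof (rule sum.cong[OF refl])
    fix a assume a: "a \<in> {..<r}"
    have "(P * (M * P)) $$ (a, a) = (\<Sum>c<r. P $$ (a, c) * (M * P) $$ (c, a))"
      using a M P by (intro index_mult_mat_sum) auto
    also have "\<dots> = (\<Sum>c<r. cnj (col P a $ c) * (M *\<^sub>v col P a) $ c)"
    proof (rule sum.cong[OF refl])
      fix c assume c: "c \<in> {..<r}"
      have "P $$ (a, c) = cnj (P $$ (c, a))"
        using index_mat_adjoint[OF P(1), of a c] P(3) a c by simp
      then show "P $$ (a, c) * (M * P) $$ (c, a) = cnj (col P a $ c) * (M *\<^sub>v col P a) $ c"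
        using a c M P(1) by simp
    qed
    finally show "(P * (M * P)) $$ (a, a) = (\<Sum>c<r. cnj (col P a $ c) * (M *\<^sub>v col P a) $ c)" .
  qed
  also have "cmod \<dots> \<le> (\<Sum>a<r. mat_opnorm M * sqnorm (col P a))"
  proof (rule sum_norm_le)
    fix a assume a: "a \<in> {..<r}"
    let ?v = "col P a"
    have v: "?v \<in> carrier_vec r" using P(1) a by auto
    have "cmod (\<Sum>c<r. cnj (?v $ c) * (M *\<^sub>v ?v) $ c) \<le> (\<Sum>c<r. \<bar>cmod (?v $ c)\<bar> * \<bar>cmod ((M *\<^sub>v ?v) $ c)\<bar>)"
      by (intro sum_norm_le) (simp add: norm_mult)
    also have "\<dots> \<le> L2_set (\<lambda>c. cmod (?v $ c)) {..<r} * L2_set (\<lambda>c. cmod ((M *\<^sub>v ?v) $ c)) {..<r}"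
      by (rule L2_set_mult_ineq)
    also have "\<dots> = sqrt (sqnorm ?v) * sqrt (sqnorm (M *\<^sub>v ?v))"
      using v M P(1) by (simp add: L2_set_def sqnorm_def)
    also have "\<dots> \<le> sqrt (sqnorm ?v) * (mat_opnorm M * sqrt (sqnorm ?v))"
      using sqrt_sqnorm_mult_le[OF M v] sqnorm_nonneg by (intro mult_left_mono) auto
    also have "\<dots> = mat_opnorm M * sqnorm ?v"
      using sqnorm_nonneg[of ?v] by (simp add: ac_simps)
    finally show "cmod (\<Sum>c<r. cnj (?v $ c) * (M *\<^sub>v ?v) $ c) \<le> mat_opnorm M * sqnorm ?v" .
  qed
  also have "\<dots> = mat_opnorm M * (\<Sum>a<r. \<Sum>c<r. (cmod (P $$ (c, a)))\<^sup>2)"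
    using P(1) by (simp add: sum_distrib_left sqnorm_def)
  also have "(\<Sum>a<r. \<Sum>c<r. (cmod (P $$ (c, a)))\<^sup>2) = Re (tr r (mat_adjoint P * P))"
    unfolding tr_adjoint_mult[OF P(1)] by simp
  also have "mat_adjoint P * P = P" using P by simp
  finally show ?thesis .
qed

section \<open>The stages of an AH system\<close>

lemma continuous_map_complex_mult:
  fixes f g :: "'x \<Rightarrow> complex"
  assumes "continuous_map X euclidean f" "continuous_map X euclidean g"
  shows "continuous_map X euclidean (\<lambda>x. f x * g x)"
proof -
  have "continuous_map X euclidean (\<lambda>x. (f x, g x))"
    using continuous_map_pairedI[OF assms] by (simp add: euclidean_product_topology)
  moreover have "continuous_map euclidean euclidean (\<lambda>z. fst z * snd z :: complex)"
    by (auto intro!: continuous_intros)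
  ultimately show ?thesis
    using continuous_map_compose[of X euclidean "\<lambda>x. (f x, g x)" euclidean "\<lambda>z. fst z * snd z"]
    by (simp add: o_def)
qed

lemma continuous_map_euclidean_comp:
  assumes "continuous_map X euclidean f" "continuous_on UNIV g"
  shows "continuous_map X euclidean (\<lambda>x. g (f x))"
  using continuous_map_compose[of X euclidean f euclidean g] assms by (simp add: o_def)

lemma mat_fun_mem:
  "f \<in> carrier (mat_fun_algebra X r) \<longleftrightarrow> f \<in> extensional (topspace X) \<and>
    (\<forall>x\<in>topspace X. f x \<in> carrier_mat r r) \<and>
    (\<forall>a<r. \<forall>b<r. continuous_map X euclidean (\<lambda>x. f x $$ (a, b)))"
  by (auto simp: mat_fun_algebra_def PiE_iff)

lemma mat_fun_ops [simp]:
  "mult (mat_fun_algebra X r) f g = (\<lambda>x\<in>topspace X. f x * g x)"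
  "one (mat_fun_algebra X r) = (\<lambda>x\<in>topspace X. 1\<^sub>m r)"
  "zero (mat_fun_algebra X r) = (\<lambda>x\<in>topspace X. 0\<^sub>m r r)"
  "add (mat_fun_algebra X r) f g = (\<lambda>x\<in>topspace X. f x + g x)"
  "smult (mat_fun_algebra X r) c f = (\<lambda>x\<in>topspace X. c \<cdot>\<^sub>m f x)"
  "star (mat_fun_algebra X r) f = (\<lambda>x\<in>topspace X. mat_adjoint (f x))"
  "cnorm (mat_fun_algebra X r) f = (SUP x\<in>topspace X. mat_opnorm (f x))"
  by (simp_all add: mat_fun_algebra_def)

lemma continuous_map_restrict_entry:
  assumes "\<And>x. x \<in> topspace X \<Longrightarrow> F x = f x" "continuous_map X euclidean f"
  shows "continuous_map X euclidean F"
  using continuous_map_eq[OF assms(2), of F] assms(1) by auto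

lemma mat_fun_closed:
  assumes f: "f \<in> carrier (mat_fun_algebra X r)" and g: "g \<in> carrier (mat_fun_algebra X r)"
  shows "(\<lambda>x\<in>topspace X. f x * g x) \<in> carrier (mat_fun_algebra X r)"
    and "(\<lambda>x\<in>topspace X. f x + g x) \<in> carrier (mat_fun_algebra X r)"
    and "(\<lambda>x\<in>topspace X. mat_adjoint (f x)) \<in> carrier (mat_fun_algebra X r)"
proof -
  have fc: "\<And>x. x \<in> topspace X \<Longrightarrow> f x \<in> carrier_mat r r"
      "\<And>a b. \<lbrakk>a < r; b < r\<rbrakk> \<Longrightarrow> continuous_map X euclidean (\<lambda>x. f x $$ (a, b))"
    and gc: "\<And>x. x \<in> topspace X \<Longrightarrow> g x \<in> carrier_mat r r"
      "\<And>a b. \<lbrakk>a < r; b < r\<rbrakk> \<Longrightarrow> continuous_map X euclidean (\<lambda>x. g x $$ (a, b))"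
    using f g by (auto simp: mat_fun_mem)
  show "(\<lambda>x\<in>topspace X. f x * g x) \<in> carrier (mat_fun_algebra X r)"
    unfolding mat_fun_mem
  proof (intro conjI allI impI)
    show "\<forall>x\<in>topspace X. (\<lambda>x\<in>topspace X. f x * g x) x \<in> carrier_mat r r"
      using fc(1) gc(1) by (auto intro!: mult_carrier_mat)
    fix a b assume ab: "a < r" "b < r"
    have eq: "(\<lambda>x\<in>topspace X. f x * g x) x $$ (a, b) = (\<Sum>c<r. f x $$ (a, c) * g x $$ (c, b))"
      if "x \<in> topspace X" for x
      using index_mult_mat_sum[OF fc(1)[OF that] gc(1)[OF that] ab] that by simp
    show "continuous_map X euclidean (\<lambda>x. (\<lambda>x\<in>topspace X. f x * g x) x $$ (a, b))"
      by (rule continuous_map_restrict_entry[OF eq], assumption)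
         (intro continuous_map_sum continuous_map_complex_mult fc(2) gc(2), use ab in auto)
  qed auto
  show "(\<lambda>x\<in>topspace X. f x + g x) \<in> carrier (mat_fun_algebra X r)"
    unfolding mat_fun_mem
  proof (intro conjI allI impI)
    show "\<forall>x\<in>topspace X. (\<lambda>x\<in>topspace X. f x + g x) x \<in> carrier_mat r r"
      using fc(1) gc(1) by (auto intro!: add_carrier_mat)
    fix a b assume ab: "a < r" "b < r"
    have eq: "(\<lambda>x\<in>topspace X. f x + g x) x $$ (a, b) = f x $$ (a, b) + g x $$ (a, b)"
      if "x \<in> topspace X" for x
      using fc(1)[OF that] gc(1)[OF that] ab that by simp
    show "continuous_map X euclidean (\<lambda>x. (\<lambda>x\<in>topspace X. f x + g x) x $$ (a, b))"
      by (rule continuous_map_restrict_entry[OF eq], assumption)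
         (intro continuous_map_add fc(2) gc(2), use ab in auto)
  qed auto
  show "(\<lambda>x\<in>topspace X. mat_adjoint (f x)) \<in> carrier (mat_fun_algebra X r)"
    unfolding mat_fun_mem
  proof (intro conjI allI impI)
    show "\<forall>x\<in>topspace X. (\<lambda>x\<in>topspace X. mat_adjoint (f x)) x \<in> carrier_mat r r"
      using fc(1) by (auto intro!: mat_adjoint_carrier)
    fix a b assume ab: "a < r" "b < r"
    have eq: "(\<lambda>x\<in>topspace X. mat_adjoint (f x)) x $$ (a, b) = cnj (f x $$ (b, a))"
      if "x \<in> topspace X" for x
      using index_mat_adjoint[OF fc(1)[OF that] ab] that by simp
    show "continuous_map X euclidean (\<lambda>x. (\<lambda>x\<in>topspace X. mat_adjoint (f x)) x $$ (a, b))"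
      by (rule continuous_map_restrict_entry[OF eq], assumption)
         (intro continuous_map_euclidean_comp[OF fc(2)] continuous_intros, use ab in auto)
  qed auto
qed

lemma mat_fun_scalar_mult_closed:
  assumes f: "f \<in> carrier (mat_fun_algebra X r)" and G: "continuous_map X euclidean G"
  shows "(\<lambda>x\<in>topspace X. G x \<cdot>\<^sub>m f x) \<in> carrier (mat_fun_algebra X r)"
proof -
  have fc: "\<And>x. x \<in> topspace X \<Longrightarrow> f x \<in> carrier_mat r r"
      "\<And>a b. \<lbrakk>a < r; b < r\<rbrakk> \<Longrightarrow> continuous_map X euclidean (\<lambda>x. f x $$ (a, b))"
    using f by (auto simp: mat_fun_mem)
  show ?thesis
    unfolding mat_fun_mem
  proof (intro conjI allI impI)
    show "\<forall>x\<in>topspace X. (\<lambda>x\<in>topspace X. G x \<cdot>\<^sub>m f x) x \<in> carrier_mat r r"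
      using fc(1) by (auto intro!: smult_carrier_mat)
    fix a b assume ab: "a < r" "b < r"
    have eq: "(\<lambda>x\<in>topspace X. G x \<cdot>\<^sub>m f x) x $$ (a, b) = G x * f x $$ (a, b)"
      if "x \<in> topspace X" for x
      using fc(1)[OF that] ab that by simp
    show "continuous_map X euclidean (\<lambda>x. (\<lambda>x\<in>topspace X. G x \<cdot>\<^sub>m f x) x $$ (a, b))"
      by (rule continuous_map_restrict_entry[OF eq], assumption)
         (intro continuous_map_complex_mult G fc(2), use ab in auto)
  qed auto
qed

lemma mat_opnorm_le_cnorm:
  assumes X: "compact_space X" and f: "f \<in> carrier (mat_fun_algebra X r)" and x: "x \<in> topspace X"
  shows "mat_opnorm (f x) \<le> cnorm (mat_fun_algebra X r) f"
proof -
  have fc: "\<And>x. x \<in> topspace X \<Longrightarrow> f x \<in> carrier_mat r r"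
      "\<And>a b. \<lbrakk>a < r; b < r\<rbrakk> \<Longrightarrow> continuous_map X euclidean (\<lambda>x. f x $$ (a, b))"
    using f by (auto simp: mat_fun_mem)
  have "\<exists>B. \<forall>x\<in>topspace X. cmod (f x $$ (a, b)) \<le> B" if "a < r" "b < r" for a b
  proof -
    have "compactin euclidean ((\<lambda>x. f x $$ (a, b)) ` topspace X)"
      using X fc(2)[OF that] by (intro image_compactin[of X]) (auto simp: compact_space_def)
    then have "bounded ((\<lambda>x. f x $$ (a, b)) ` topspace X)" by (simp add: compact_imp_bounded)
    then show ?thesis by (auto simp: bounded_iff)
  qed
  then obtain B where B: "\<And>a b x. \<lbrakk>a < r; b < r; x \<in> topspace X\<rbrakk> \<Longrightarrow> cmod (f x $$ (a, b)) \<le> B a b"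
    by metis
  have "cmod (f x $$ (a, b)) \<le> (\<Sum>a<r. \<Sum>b<r. \<bar>B a b\<bar>)" if ab: "a < r" "b < r" and "x \<in> topspace X" for a b x
  proof -
    have "cmod (f x $$ (a, b)) \<le> \<bar>B a b\<bar>" using B[OF that] by linarith
    also have "\<dots> \<le> (\<Sum>b<r. \<bar>B a b\<bar>)"
      using ab by (intro member_le_sum[of b "{..<r}" "\<lambda>b. \<bar>B a b\<bar>"]) auto
    also have "\<dots> \<le> (\<Sum>a<r. \<Sum>b<r. \<bar>B a b\<bar>)"
      using ab by (intro member_le_sum[of a "{..<r}" "\<lambda>a. \<Sum>b<r. \<bar>B a b\<bar>"]) (auto intro: sum_nonneg)
    finally show ?thesis .
  qed
  then have "bdd_above ((\<lambda>x. mat_opnorm (f x)) ` topspace X)"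
    using fc(1) by (intro bdd_aboveI2[of _ _ "real r * real r * (\<Sum>a<r. \<Sum>b<r. \<bar>B a b\<bar>)"] mat_opnorm_le) auto
  then show ?thesis unfolding mat_fun_ops using x by (intro cSUP_upper)
qed

lemma corner_ops [simp]:
  "mult (corner B p) = mult B" "add (corner B p) = add B" "zero (corner B p) = zero B"
  "one (corner B p) = p" "smult (corner B p) = smult B" "star (corner B p) = star B"
  "cnorm (corner B p) = cnorm B"
  by (simp_all add: corner_def)

context
  fixes X :: "'x topology" and r :: nat and p :: "'x \<Rightarrow> complex mat"
  assumes proj: "projection (mat_fun_algebra X r) p"
begin

lemma projection_mem: "p \<in> carrier (mat_fun_algebra X r)"
  using proj by (simp add: projection_def)

lemma projection_pointwise:
  assumes "x \<in> topspace X"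
  shows "p x \<in> carrier_mat r r" "p x * p x = p x" "mat_adjoint (p x) = p x"
proof -
  show "p x \<in> carrier_mat r r" using projection_mem assms by (simp add: mat_fun_mem)
  have "(\<lambda>x\<in>topspace X. p x * p x) x = p x" "(\<lambda>x\<in>topspace X. mat_adjoint (p x)) x = p x"
    using proj by (simp_all add: projection_def)
  then show "p x * p x = p x" "mat_adjoint (p x) = p x" using assms by simp_all
qed

text \<open>Cutting down by \<open>p\<close> acts as the identity on the corner, as \<open>p\<close> is idempotent.\<close>

lemma corner_mem:
  "f \<in> carrier (corner (mat_fun_algebra X r) p) \<longleftrightarrow> f \<in> carrier (mat_fun_algebra X r) \<and>
    (\<forall>x\<in>topspace X. p x * f x = f x \<and> f x * p x = f x)"
proof
  assume "f \<in> carrier (corner (mat_fun_algebra X r) p)"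
  then obtain g where g: "g \<in> carrier (mat_fun_algebra X r)"
      "f = (\<lambda>x\<in>topspace X. (\<lambda>x\<in>topspace X. p x * g x) x * p x)"
    by (auto simp: corner_def)
  have "f \<in> carrier (mat_fun_algebra X r)"
    unfolding g(2) using g(1) projection_mem by (intro mat_fun_closed)
  moreover have "p x * f x = f x \<and> f x * p x = f x" if x: "x \<in> topspace X" for x
  proof -
    have gx: "g x \<in> carrier_mat r r" using g(1) x by (simp add: mat_fun_mem)
    note px = projection_pointwise[OF x]
    have fx: "f x = p x * g x * p x" using g(2) x by simp
    have "p x * f x = (p x * p x) * g x * p x"
      unfolding fx using px(1) gx by (simp add: assoc_mult_mat[of _ r r _ r _ r])
    moreover have "f x * p x = p x * g x * (p x * p x)"
      unfolding fx using px(1) gx by (simp add: assoc_mult_mat[of _ r r _ r _ r])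
    ultimately show ?thesis by (simp add: px fx)
  qed
  ultimately show "f \<in> carrier (mat_fun_algebra X r) \<and>
    (\<forall>x\<in>topspace X. p x * f x = f x \<and> f x * p x = f x)" by blast
next
  assume f: "f \<in> carrier (mat_fun_algebra X r) \<and>
    (\<forall>x\<in>topspace X. p x * f x = f x \<and> f x * p x = f x)"
  then have "f = (\<lambda>x\<in>topspace X. (\<lambda>x\<in>topspace X. p x * f x) x * p x)"
    by (intro extensionalityI[of _ "topspace X"]) (auto simp: mat_fun_mem)
  then show "f \<in> carrier (corner (mat_fun_algebra X r) p)"
    using f by (auto simp: corner_def intro!: image_eqI[of _ _ f])
qed

lemma corner_closed:
  assumes f: "f \<in> carrier (corner (mat_fun_algebra X r) p)"
    and g: "g \<in> carrier (corner (mat_fun_algebra X r) p)"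
  shows "(\<lambda>x\<in>topspace X. f x * g x) \<in> carrier (corner (mat_fun_algebra X r) p)"
    and "(\<lambda>x\<in>topspace X. f x + g x) \<in> carrier (corner (mat_fun_algebra X r) p)"
    and "(\<lambda>x\<in>topspace X. mat_adjoint (f x)) \<in> carrier (corner (mat_fun_algebra X r) p)"
    and "(\<lambda>x\<in>topspace X. c \<cdot>\<^sub>m f x) \<in> carrier (corner (mat_fun_algebra X r) p)"
proof -
  have fM: "f \<in> carrier (mat_fun_algebra X r)" and gM: "g \<in> carrier (mat_fun_algebra X r)"
    using f g by (auto simp: corner_mem)
  have pt: "f x \<in> carrier_mat r r" "g x \<in> carrier_mat r r" "p x * f x = f x" "f x * p x = f x"
     "p x * g x = g x" "g x * p x = g x" if "x \<in> topspace X" for x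
    using f g that by (auto simp: corner_mem mat_fun_mem)
  note p = projection_pointwise
  show "(\<lambda>x\<in>topspace X. f x * g x) \<in> carrier (corner (mat_fun_algebra X r) p)"
    unfolding corner_mem using mat_fun_closed(1)[OF fM gM] pt p
    by (auto simp: assoc_mult_mat[of _ r r _ r _ r] assoc_mult_mat[of _ r r _ r _ r, symmetric, of "p _" "f _"])
  show "(\<lambda>x\<in>topspace X. f x + g x) \<in> carrier (corner (mat_fun_algebra X r) p)"
    unfolding corner_mem using mat_fun_closed(2)[OF fM gM] pt p
    by (auto simp: mult_add_distrib_mat[of _ r r _ r] add_mult_distrib_mat[of _ r r _ _ r])
  show "(\<lambda>x\<in>topspace X. c \<cdot>\<^sub>m f x) \<in> carrier (corner (mat_fun_algebra X r) p)"
    unfolding corner_mem using mat_fun_scalar_mult_closed[OF fM, of "\<lambda>_. c"] pt p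
    by (auto simp: mult_smult_distrib[of _ r r _ r] mult_smult_assoc_mat[of _ r r _ r])
  have adj: "mat_adjoint (a * b) = mat_adjoint b * mat_adjoint a"
    if "a \<in> carrier_mat r r" "b \<in> carrier_mat r r" for a b :: "complex mat"
    using that mat_adjoint_carrier[OF that(1)] mat_adjoint_carrier[OF that(2)]
      mat_adjoint_carrier[OF mult_carrier_mat[OF that]]
    by (intro eq_matI) (auto simp: index_mat_adjoint[of _ r r] index_mat_adjoint[OF mult_carrier_mat[OF that]]
        scalar_prod_def mult.commute)
  show "(\<lambda>x\<in>topspace X. mat_adjoint (f x)) \<in> carrier (corner (mat_fun_algebra X r) p)"
    unfolding corner_mem
  proof (intro conjI ballI)
    fix x assume x: "x \<in> topspace X"
    show "p x * (\<lambda>x\<in>topspace X. mat_adjoint (f x)) x = (\<lambda>x\<in>topspace X. mat_adjoint (f x)) x"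
      using adj[OF pt(1)[OF x] p(1)[OF x]] x by (simp add: pt p)
    show "(\<lambda>x\<in>topspace X. mat_adjoint (f x)) x * p x = (\<lambda>x\<in>topspace X. mat_adjoint (f x)) x"
      using adj[OF p(1)[OF x] pt(1)[OF x]] x by (simp add: pt p)
  qed (rule mat_fun_closed(3)[OF fM gM])
qed

lemma scalar_function_mem_corner:
  assumes "continuous_map X euclidean G"
  shows "(\<lambda>x\<in>topspace X. G x \<cdot>\<^sub>m p x) \<in> carrier (corner (mat_fun_algebra X r) p)"
  unfolding corner_mem
  using mat_fun_scalar_mult_closed[OF projection_mem assms] projection_pointwise
  by (auto simp: mult_smult_distrib[of _ r r _ r] mult_smult_assoc_mat[of _ r r _ r])

end

lemma cstar_sum_ops [simp]:
  "carrier (cstar_sum h B) = (\<Pi>\<^sub>E l\<in>{..<h}. carrier (B l))"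
  "mult (cstar_sum h B) f g = (\<lambda>l\<in>{..<h}. f l \<otimes>\<^bsub>B l\<^esub> g l)"
  "one (cstar_sum h B) = (\<lambda>l\<in>{..<h}. \<one>\<^bsub>B l\<^esub>)"
  "zero (cstar_sum h B) = (\<lambda>l\<in>{..<h}. \<zero>\<^bsub>B l\<^esub>)"
  "add (cstar_sum h B) f g = (\<lambda>l\<in>{..<h}. f l \<oplus>\<^bsub>B l\<^esub> g l)"
  "smult (cstar_sum h B) c f = (\<lambda>l\<in>{..<h}. c \<odot>\<^bsub>B l\<^esub> f l)"
  "star (cstar_sum h B) f = (\<lambda>l\<in>{..<h}. star (B l) (f l))"
  "cnorm (cstar_sum h B) f = Max ((\<lambda>l. cnorm (B l) (f l)) ` {..<h})"
  by (simp_all add: cstar_sum_def)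

lemma unital_star_homI:
  assumes "\<And>x. x \<in> carrier A \<Longrightarrow> f x \<in> carrier B"
    "\<And>x y. \<lbrakk>x \<in> carrier A; y \<in> carrier A\<rbrakk> \<Longrightarrow> f (x \<otimes>\<^bsub>A\<^esub> y) = f x \<otimes>\<^bsub>B\<^esub> f y"
    "\<And>x y. \<lbrakk>x \<in> carrier A; y \<in> carrier A\<rbrakk> \<Longrightarrow> f (x \<oplus>\<^bsub>A\<^esub> y) = f x \<oplus>\<^bsub>B\<^esub> f y"
    "f \<one>\<^bsub>A\<^esub> = \<one>\<^bsub>B\<^esub>"
    "\<And>c x. x \<in> carrier A \<Longrightarrow> f (c \<odot>\<^bsub>A\<^esub> x) = c \<odot>\<^bsub>B\<^esub> f x"
    "\<And>x. x \<in> carrier A \<Longrightarrow> f (star A x) = star B (f x)"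
  shows "f \<in> unital_star_hom A B"
  using assms unfolding unital_star_hom_def Ring.ring_hom_def by auto

lemma unital_star_homD:
  assumes "f \<in> unital_star_hom A B"
  shows "x \<in> carrier A \<Longrightarrow> f x \<in> carrier B"
    "\<lbrakk>x \<in> carrier A; y \<in> carrier A\<rbrakk> \<Longrightarrow> f (x \<otimes>\<^bsub>A\<^esub> y) = f x \<otimes>\<^bsub>B\<^esub> f y"
    "\<lbrakk>x \<in> carrier A; y \<in> carrier A\<rbrakk> \<Longrightarrow> f (x \<oplus>\<^bsub>A\<^esub> y) = f x \<oplus>\<^bsub>B\<^esub> f y"
    "f \<one>\<^bsub>A\<^esub> = \<one>\<^bsub>B\<^esub>"
    "x \<in> carrier A \<Longrightarrow> f (c \<odot>\<^bsub>A\<^esub> x) = c \<odot>\<^bsub>B\<^esub> f x"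
    "x \<in> carrier A \<Longrightarrow> f (star A x) = star B (f x)"
  using assms unfolding unital_star_hom_def Ring.ring_hom_def by auto

lemma connecting_same: "connecting \<phi> i i b = b"
  and connecting_Suc: "i \<le> j \<Longrightarrow> connecting \<phi> i (Suc j) b = \<phi> j (connecting \<phi> i j b)"
  and connecting_step: "i < j \<Longrightarrow> connecting \<phi> (Suc i) j (\<phi> i b) = connecting \<phi> i j b"
  by (simp_all add: connecting_def upt_conv_Cons)

context AH_system
begin

abbreviation "B i \<equiv> AH_stage h X r p i"

lemma stage_mem:
  "b \<in> carrier (B i) \<longleftrightarrow> b \<in> extensional {..<h i} \<and> (\<forall>l<h i. b l \<in> carrier (AH_summand X r p i l))"
  by (auto simp: AH_stage_def PiE_iff)

lemma stage_closed:
  shows "\<lbrakk>b \<in> carrier (B i); b' \<in> carrier (B i)\<rbrakk> \<Longrightarrow> b \<otimes>\<^bsub>B i\<^esub> b' \<in> carrier (B i)"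
    "\<lbrakk>b \<in> carrier (B i); b' \<in> carrier (B i)\<rbrakk> \<Longrightarrow> b \<oplus>\<^bsub>B i\<^esub> b' \<in> carrier (B i)"
    "b \<in> carrier (B i) \<Longrightarrow> c \<odot>\<^bsub>B i\<^esub> b \<in> carrier (B i)"
    "b \<in> carrier (B i) \<Longrightarrow> star (B i) b \<in> carrier (B i)"
proof -
  have closed: "b \<otimes>\<^bsub>B i\<^esub> b' \<in> carrier (B i) \<and> b \<oplus>\<^bsub>B i\<^esub> b' \<in> carrier (B i) \<and>
      c \<odot>\<^bsub>B i\<^esub> b \<in> carrier (B i) \<and> star (B i) b \<in> carrier (B i)"
    if b: "b \<in> carrier (B i)" "b' \<in> carrier (B i)" for b b'
  proof -
    have "b l \<in> carrier (corner (mat_fun_algebra (X i l) (r i l)) (p i l))"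
      "b' l \<in> carrier (corner (mat_fun_algebra (X i l) (r i l)) (p i l))" if "l < h i" for l
      using b that by (auto simp: stage_mem AH_summand_def)
    note closed = corner_closed[OF projection this]
    show ?thesis unfolding stage_mem by (simp add: AH_stage_def AH_summand_def closed)
  qed
  show "\<lbrakk>b \<in> carrier (B i); b' \<in> carrier (B i)\<rbrakk> \<Longrightarrow> b \<otimes>\<^bsub>B i\<^esub> b' \<in> carrier (B i)"
    "\<lbrakk>b \<in> carrier (B i); b' \<in> carrier (B i)\<rbrakk> \<Longrightarrow> b \<oplus>\<^bsub>B i\<^esub> b' \<in> carrier (B i)"
    "b \<in> carrier (B i) \<Longrightarrow> c \<odot>\<^bsub>B i\<^esub> b \<in> carrier (B i)"
    "b \<in> carrier (B i) \<Longrightarrow> star (B i) b \<in> carrier (B i)"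
    using closed by blast+
qed

lemma connecting_hom: "i \<le> j \<Longrightarrow> connecting \<phi> i j \<in> unital_star_hom (B i) (B j)"
proof (induction rule: dec_induct)
  case base
  show ?case by (rule unital_star_homI) (simp_all add: connecting_same)
next
  case (step j)
  note IH = unital_star_homD[OF step.IH] and \<phi> = unital_star_homD[OF hom[of j]]
  show ?case
    by (rule unital_star_homI) (use step.hyps IH \<phi> in \<open>simp_all add: connecting_Suc\<close>)
qed

text \<open>The normalized trace of the representation given by evaluation at \<open>x\<close> in the summand \<open>k\<close>.\<close>

definition point_trace :: "nat \<Rightarrow> nat \<Rightarrow> 'x \<Rightarrow> (nat \<Rightarrow> 'x \<Rightarrow> complex mat) \<Rightarrow> complex" where
  "point_trace j k x b = tr (r j k) (b k x) / of_nat (n j k)"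

context
  fixes j k x assumes k: "k < h j" and x: "x \<in> topspace (X j k)"
begin

lemma stage_pointwise:
  assumes "b \<in> carrier (B j)"
  shows "b k x \<in> carrier_mat (r j k) (r j k)" "p j k x * b k x = b k x" "b k x * p j k x = b k x"
  using assms k x by (auto simp: stage_mem AH_summand_def corner_mem[OF projection] mat_fun_mem)

lemma point_trace_add:
  "\<lbrakk>b \<in> carrier (B j); b' \<in> carrier (B j)\<rbrakk>
    \<Longrightarrow> point_trace j k x (b \<oplus>\<^bsub>B j\<^esub> b') = point_trace j k x b + point_trace j k x b'"
  using stage_pointwise k x
  by (simp add: point_trace_def AH_stage_def AH_summand_def tr_add add_divide_distrib)

lemma point_trace_smult:
  "b \<in> carrier (B j) \<Longrightarrow> point_trace j k x (c \<odot>\<^bsub>B j\<^esub> b) = c * point_trace j k x b"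
  using stage_pointwise k x
  by (simp add: point_trace_def AH_stage_def AH_summand_def tr_smult)

lemma point_trace_comm:
  "\<lbrakk>b \<in> carrier (B j); b' \<in> carrier (B j)\<rbrakk>
    \<Longrightarrow> point_trace j k x (b \<otimes>\<^bsub>B j\<^esub> b') = point_trace j k x (b' \<otimes>\<^bsub>B j\<^esub> b)"
  using stage_pointwise k x tr_mult_comm[of "b k x" "r j k" "r j k" "b' k x"]
  by (simp add: point_trace_def AH_stage_def AH_summand_def)

lemma point_trace_pos:
  assumes "b \<in> carrier (B j)"
  shows "point_trace j k x (star (B j) b \<otimes>\<^bsub>B j\<^esub> b) \<in> \<real>\<^sub>\<ge>\<^sub>0"
proof -
  have "point_trace j k x (star (B j) b \<otimes>\<^bsub>B j\<^esub> b)
      = complex_of_real ((\<Sum>c<r j k. \<Sum>a<r j k. (cmod (b k x $$ (a, c)))\<^sup>2) / real (n j k))"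
    using tr_adjoint_mult[OF stage_pointwise(1)[OF assms]] k x
    by (simp add: point_trace_def AH_stage_def AH_summand_def)
  also have "\<dots> \<in> \<real>\<^sub>\<ge>\<^sub>0"
    unfolding nonneg_Reals_of_real_iff by (intro divide_nonneg_nonneg sum_nonneg) auto
  finally show ?thesis .
qed

lemma tr_projection: "tr (r j k) (p j k x) = of_nat (n j k)"
  using tr_idempotent_eq_rank projection_pointwise[OF projection[OF k] x] rank[OF k x] by metis

lemma point_trace_one: "point_trace j k x \<one>\<^bsub>B j\<^esub> = 1"
  using tr_projection k x n_pos[OF k]
  by (simp add: point_trace_def AH_stage_def AH_summand_def)

lemma point_trace_norm:
  assumes b: "b \<in> carrier (B j)"
  shows "cmod (point_trace j k x b) \<le> cnorm (B j) b"
proof -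
  note pt = projection_pointwise[OF projection[OF k] x]
  have "cmod (tr (r j k) (b k x)) \<le> mat_opnorm (b k x) * Re (tr (r j k) (p j k x))"
    using stage_pointwise[OF b] pt by (intro cmod_tr_le)
  then have "cmod (tr (r j k) (b k x)) \<le> mat_opnorm (b k x) * real (n j k)"
    by (simp add: tr_projection)
  then have "cmod (point_trace j k x b) \<le> mat_opnorm (b k x)"
    using n_pos[OF k] by (simp add: point_trace_def norm_divide field_simps)
  also have "\<dots> \<le> cnorm (AH_summand X r p j k) (b k)"
    unfolding AH_summand_def corner_ops
    using b k x compact by (intro mat_opnorm_le_cnorm) (auto simp: stage_mem AH_summand_def corner_mem[OF projection])
  also have "\<dots> \<le> cnorm (B j) b"
    unfolding AH_stage_def cstar_sum_ops using k by (intro Max_ge) auto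
  finally show ?thesis .
qed

end

text \<open>The central element \<open>G * 1\<close> of stage \<open>i\<close>, where \<open>G\<close> is a real function on the disjoint union of the
spaces \<open>X i l\<close>. On these elements tracial states act as measures.\<close>

definition central :: "nat \<Rightarrow> (nat \<Rightarrow> 'x \<Rightarrow> real) \<Rightarrow> nat \<Rightarrow> 'x \<Rightarrow> complex mat" where
  "central i G = (\<lambda>l\<in>{..<h i}. \<lambda>x\<in>topspace (X i l). complex_of_real (G l x) \<cdot>\<^sub>m p i l x)"

lemma central_mem:
  assumes "\<And>l. l < h i \<Longrightarrow> continuous_map (X i l) euclideanreal (G l)"
  shows "central i G \<in> carrier (B i)"
proof -
  have "(\<lambda>x\<in>topspace (X i l). complex_of_real (G l x) \<cdot>\<^sub>m p i l x)
      \<in> carrier (corner (mat_fun_algebra (X i l) (r i l)) (p i l))" if l: "l < h i" for l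
    by (intro scalar_function_mem_corner[OF projection[OF l]]
        continuous_map_euclidean_comp[OF assms[OF l]] continuous_intros)
  then show ?thesis unfolding stage_mem by (simp add: central_def AH_summand_def)
qed

lemma central_add: "central i (\<lambda>l x. G l x + H l x) = central i G \<oplus>\<^bsub>B i\<^esub> central i H"
proof -
  have "complex_of_real (G l x + H l x) \<cdot>\<^sub>m p i l x
      = complex_of_real (G l x) \<cdot>\<^sub>m p i l x + complex_of_real (H l x) \<cdot>\<^sub>m p i l x" for l x
    by (intro eq_matI) (auto simp: algebra_simps)
  then show ?thesis
    unfolding central_def AH_stage_def AH_summand_def cstar_sum_ops corner_ops mat_fun_ops
    by (intro restrict_ext) (simp cong: restrict_cong)
qed

lemma central_one: "central i (\<lambda>_ _. 1) = \<one>\<^bsub>B i\<^esub>"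
proof -
  have "(\<lambda>x\<in>topspace (X i l). complex_of_real 1 \<cdot>\<^sub>m p i l x) = p i l" if "l < h i" for l
    using projection_mem[OF projection[OF that]]
    by (intro extensionalityI[of _ "topspace (X i l)"]) (auto simp: mat_fun_mem)
  then show ?thesis by (auto simp: central_def AH_stage_def AH_summand_def intro!: restrict_ext)
qed

text \<open>Nonnegative functions thus give elements at which tracial states are nonnegative.\<close>

lemma central_square:
  "central i (\<lambda>l x. (G l x)\<^sup>2) = star (B i) (central i G) \<otimes>\<^bsub>B i\<^esub> central i G"
proof -
  have "complex_of_real ((G l x)\<^sup>2) \<cdot>\<^sub>m p i l x
      = mat_adjoint (complex_of_real (G l x) \<cdot>\<^sub>m p i l x) * (complex_of_real (G l x) \<cdot>\<^sub>m p i l x)"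
    if l: "l < h i" and x: "x \<in> topspace (X i l)" for l x
  proof -
    note pt = projection_pointwise[OF projection[OF l] x]
    let ?c = "complex_of_real (G l x)"
    have "mat_adjoint (?c \<cdot>\<^sub>m p i l x) = ?c \<cdot>\<^sub>m mat_adjoint (p i l x)"
      using pt(1) mat_adjoint_carrier[OF pt(1)] mat_adjoint_carrier[OF smult_carrier_mat[OF pt(1)], of ?c]
      by (intro eq_matI)
         (auto simp: index_mat_adjoint[of _ "r i l" "r i l"] index_mat_adjoint[OF smult_carrier_mat[OF pt(1)]])
    then have "mat_adjoint (?c \<cdot>\<^sub>m p i l x) * (?c \<cdot>\<^sub>m p i l x) = ?c \<cdot>\<^sub>m (?c \<cdot>\<^sub>m (p i l x * p i l x))"
      using pt by (simp add: mult_smult_distrib[of _ "r i l" "r i l" _ "r i l"]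
          mult_smult_assoc_mat[of _ "r i l" "r i l" _ "r i l"])
    also have "\<dots> = (?c * ?c) \<cdot>\<^sub>m p i l x" unfolding pt(2) by (intro eq_matI) auto
    also have "?c * ?c = complex_of_real ((G l x)\<^sup>2)" by (simp add: power2_eq_square)
    finally show ?thesis by (rule sym)
  qed
  then show ?thesis
    unfolding central_def AH_stage_def AH_summand_def cstar_sum_ops corner_ops mat_fun_ops
    by (intro restrict_ext) (simp cong: restrict_cong)
qed

lemma central_single_summand:
  assumes l: "l < h i"
  shows "central i (\<lambda>l'. if l' = l then G else (\<lambda>_. 0))
    = summand_incl (h i) (AH_summand X r p i) l (\<lambda>x\<in>topspace (X i l). complex_of_real (G x) \<cdot>\<^sub>m p i l x)"
proof -
  have "0 \<cdot>\<^sub>m p i l' x = 0\<^sub>m (r i l') (r i l')" if "l' < h i" "x \<in> topspace (X i l')" for l' x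
    using projection_pointwise(1)[OF projection[OF that(1)] that(2)] by (intro eq_matI) auto
  then show ?thesis
    by (auto simp: central_def summand_incl_def AH_summand_def intro!: restrict_ext)
qed

text \<open>The trace of stage \<open>j\<close> at \<open>x\<close>, pulled back to stage \<open>i\<close>, is integration against the counting
measure of the eigenvalues of \<open>x\<close> with a suitable normalization.\<close>

lemma point_trace_connecting_central:
  assumes ev: "continuous_eigenvalue_maps h X r p \<phi> M lam"
    and ij: "i < j" and l: "l < h i" and k: "k < h j" and x: "x \<in> topspace (X j k)"
    and G: "continuous_map (X i l) euclideanreal G"
  shows "point_trace j k x (connecting \<phi> i j (central i (\<lambda>l'. if l' = l then G else (\<lambda>_. 0))))
    = complex_of_real ((\<Sum>m<M i j l k. G (lam i j l k m x)) * real (n i l) / real (n j k))"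
proof -
  let ?ys = "map (\<lambda>m. lam i j l k m x) [0..<M i j l k]"
  let ?f = "\<lambda>x\<in>topspace (X i l). complex_of_real (G x) \<cdot>\<^sub>m p i l x"
  have lam: "lam i j l k m x \<in> topspace (X i l)" if "m < M i j l k" for m
    using ev ij l k x that unfolding continuous_eigenvalue_maps_def
    by (metis continuous_map_image_subset_topspace image_subset_iff)
  have "?f \<in> carrier (AH_summand X r p i l)"
    unfolding AH_summand_def
    by (intro scalar_function_mem_corner[OF projection[OF l]] continuous_map_euclidean_comp[OF G] continuous_intros)
  then obtain V where V: "V \<in> carrier_mat (r j k) (length ?ys * r i l)"
      "mat_adjoint V * V = diag_block_mat (map (p i l) ?ys)"
      "connecting \<phi> i j (summand_incl (h i) (AH_summand X r p i) l ?f) k x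
        = V * diag_block_mat (map ?f ?ys) * mat_adjoint V"
  proof -
    have "representation_points (r i l) (p i l) (AH_summand X r p i l) (r j k)
       (\<lambda>f. connecting \<phi> i j (summand_incl (h i) (AH_summand X r p i) l f) k x) ?ys"
      using ev ij l k x unfolding continuous_eigenvalue_maps_def by blast
    then obtain V where "V \<in> carrier_mat (r j k) (length ?ys * r i l)"
        "mat_adjoint V * V = diag_block_mat (map (p i l) ?ys)"
        "\<forall>f\<in>carrier (AH_summand X r p i l). connecting \<phi> i j (summand_incl (h i) (AH_summand X r p i) l f) k x
          = V * diag_block_mat (map f ?ys) * mat_adjoint V"
      unfolding representation_points_def by blast
    then show thesis using \<open>?f \<in> carrier (AH_summand X r p i l)\<close> by (intro that) auto
  qed
  have pt: "p i l y \<in> carrier_mat (r i l) (r i l)" "p i l y * p i l y = p i l y"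
      "tr (r i l) (p i l y) = of_nat (n i l)" if "y \<in> topspace (X i l)" for y
    using projection_pointwise[OF projection[OF l] that] tr_projection[OF l that] by auto
  have "tr (r j k) (V * diag_block_mat (map ?f ?ys) * mat_adjoint V) = (\<Sum>y\<leftarrow>?ys. tr (r i l) (?f y))"
    by (rule tr_representation[OF _ V(1,2)])
       (use lam pt in \<open>auto simp: mult_smult_assoc_mat[of _ "r i l" "r i l" _ "r i l"]\<close>)
  also have "\<dots> = (\<Sum>y\<leftarrow>?ys. complex_of_real (G y * real (n i l)))"
    by (intro arg_cong[of _ _ sum_list] map_cong refl) (use lam pt in \<open>auto simp: tr_smult\<close>)
  also have "\<dots> = complex_of_real ((\<Sum>m<M i j l k. G (lam i j l k m x)) * real (n i l))"
    by (simp add: sum_distrib_right interv_sum_list_conv_sum_set_nat comp_def atLeast0LessThan)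
  finally show ?thesis
    unfolding central_single_summand[OF l] point_trace_def V(3) by simp
qed

end

section \<open>Tracial states of a C*-algebra\<close>

context unital_cstar_algebra
begin

lemma ring_A: "Ring.ring A" and module_A: "Module.module class_ring A"
  by (fact ring module)+

sublocale A: Ring.ring A by (rule ring_A)
sublocale A: Module.module "class_ring :: complex ring" A by (rule module_A)

lemma smult_mem: "x \<in> carrier A \<Longrightarrow> c \<odot> x \<in> carrier A"
  using A.smult_closed[of c x] by simp

lemma smult_minus_one:
  assumes "x \<in> carrier A"
  shows "(-1) \<odot> x = \<ominus> x"
proof -
  have "(-1) \<odot> x \<oplus> x = (-1 + 1) \<odot> x"
    using A.smult_l_distr[of "-1" 1 x] A.smult_one[of x] assms by (simp add: class_ring_simps)
  also have "\<dots> = \<zero>" using A.smult_l_null[of x] assms by (simp add: class_ring_simps)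
  finally show ?thesis using assms smult_mem by (intro A.minus_equality[symmetric]) auto
qed

lemma star_one: "star A \<one> = \<one>"
proof -
  have "\<one> = star A (star A \<one>)" by (simp add: star_star)
  also have "\<dots> = star A (star A \<one> \<otimes> \<one>)" using star_closed[of \<one>] by simp
  also have "\<dots> = star A \<one> \<otimes> star A (star A \<one>)"
    by (rule star_mult[OF star_closed]) simp_all
  also have "\<dots> = star A \<one>" using star_closed[of \<one>] by (simp add: star_star)
  finally show ?thesis by simp
qed

lemma star_minus:
  assumes "x \<in> carrier A" "y \<in> carrier A"
  shows "star A (x \<ominus> y) = star A x \<ominus> star A y"
proof -
  have "star A (x \<oplus> (-1) \<odot> y) = star A x \<oplus> (-1) \<odot> star A y"
    using assms smult_mem star_smult[of y "-1"] by (simp add: star_add)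
  then show ?thesis using assms star_closed by (simp add: smult_minus_one a_minus_def)
qed

lemma norm_star_le: "x \<in> carrier A \<Longrightarrow> cnorm A x \<le> cnorm A (star A x)"
proof (cases "cnorm A x = 0")
  case False
  assume x: "x \<in> carrier A"
  have "cnorm A x * cnorm A x \<le> cnorm A (star A x) * cnorm A x"
    using norm_mult[OF star_closed[OF x] x] norm_star_mult[OF x] by (simp add: power2_eq_square)
  then show ?thesis using False norm_nonneg[OF x] by simp
qed (auto simp: norm_nonneg star_closed)

lemma norm_star: "x \<in> carrier A \<Longrightarrow> cnorm A (star A x) = cnorm A x"
  using norm_star_le[of x] norm_star_le[of "star A x"] by (simp add: star_closed star_star)

lemma norm_zero: "cnorm A \<zero> = 0"
  by (simp add: norm_eq_0)

lemma norm_minus: "x \<in> carrier A \<Longrightarrow> cnorm A (\<ominus> x) = cnorm A x"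
  using norm_smult[of x "-1"] by (simp add: smult_minus_one)

lemma norm_minus_commute:
  assumes "x \<in> carrier A" "y \<in> carrier A"
  shows "cnorm A (x \<ominus> y) = cnorm A (y \<ominus> x)"
proof -
  have "\<ominus> (x \<ominus> y) = y \<ominus> x" using assms by (simp add: a_minus_def A.minus_add A.a_comm)
  then show ?thesis using norm_minus[of "x \<ominus> y"] assms by simp
qed

lemma norm_minus_triangle:
  assumes "x \<in> carrier A" "y \<in> carrier A" "z \<in> carrier A"
  shows "cnorm A (x \<ominus> z) \<le> cnorm A (x \<ominus> y) + cnorm A (y \<ominus> z)"
proof -
  have "x \<ominus> z = (x \<ominus> y) \<oplus> (y \<ominus> z)" using assms by algebra
  then show ?thesis using norm_triangle[of "x \<ominus> y" "y \<ominus> z"] assms by simp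
qed

lemma norm_one_le: "cnorm A \<one> \<le> 1"
proof -
  have "(cnorm A \<one>)\<^sup>2 = cnorm A \<one>" using norm_star_mult[of \<one>] by (simp add: star_one)
  then have "cnorm A \<one> * (cnorm A \<one> - 1) = 0" by (simp add: power2_eq_square algebra_simps)
  then show ?thesis by auto
qed

text \<open>Norm convergence, for an algebra given by its carrier and not by a type class.\<close>

definition converges :: "(nat \<Rightarrow> 'a) \<Rightarrow> 'a \<Rightarrow> bool" where
  "converges u a \<longleftrightarrow> a \<in> carrier A \<and> (\<forall>q. u q \<in> carrier A) \<and> (\<lambda>q. cnorm A (a \<ominus> u q)) \<longlonglongrightarrow> 0"

lemma convergesI:
  assumes "a \<in> carrier A" "\<And>q. u q \<in> carrier A" "\<And>q. cnorm A (a \<ominus> u q) \<le> e q" "e \<longlonglongrightarrow> 0"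
  shows "converges u a"
  unfolding converges_def
proof (intro conjI allI)
  show "(\<lambda>q. cnorm A (a \<ominus> u q)) \<longlonglongrightarrow> 0"
    by (rule Lim_null_comparison[OF _ assms(4)]) (use assms norm_nonneg in auto)
qed (use assms in auto)

lemma converges_add:
  assumes "converges u a" "converges v b"
  shows "converges (\<lambda>q. u q \<oplus> v q) (a \<oplus> b)"
proof (rule convergesI)
  fix q
  have c: "a \<in> carrier A" "b \<in> carrier A" "u q \<in> carrier A" "v q \<in> carrier A"
    using assms by (auto simp: converges_def)
  then show "u q \<oplus> v q \<in> carrier A" by simp
  have "(a \<oplus> b) \<ominus> (u q \<oplus> v q) = (a \<ominus> u q) \<oplus> (b \<ominus> v q)" using c by algebra
  then show "cnorm A ((a \<oplus> b) \<ominus> (u q \<oplus> v q)) \<le> cnorm A (a \<ominus> u q) + cnorm A (b \<ominus> v q)"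
    using norm_triangle[of "a \<ominus> u q" "b \<ominus> v q"] c by simp
next
  show "(\<lambda>q. cnorm A (a \<ominus> u q) + cnorm A (b \<ominus> v q)) \<longlonglongrightarrow> 0"
    using assms by (auto simp: converges_def intro: tendsto_add_zero)
qed (use assms in \<open>auto simp: converges_def\<close>)

lemma converges_smult:
  assumes "converges u a"
  shows "converges (\<lambda>q. c \<odot> u q) (c \<odot> a)"
proof (rule convergesI)
  fix q
  have car: "a \<in> carrier A" "u q \<in> carrier A"
    using assms by (auto simp: converges_def)
  then show "c \<odot> u q \<in> carrier A" by (simp add: smult_mem)
  have "c \<odot> a \<ominus> c \<odot> u q = c \<odot> (a \<ominus> u q)"
    using car smult_mem A.smult_r_distr[of c a "\<ominus> u q"] A.smult_r_minus[of c "u q"] by (simp add: a_minus_def)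
  then show "cnorm A (c \<odot> a \<ominus> c \<odot> u q) \<le> cmod c * cnorm A (a \<ominus> u q)"
    using norm_smult[of "a \<ominus> u q" c] car by simp
next
  show "(\<lambda>q. cmod c * cnorm A (a \<ominus> u q)) \<longlonglongrightarrow> 0"
    using assms by (auto simp: converges_def intro: tendsto_mult_right_zero)
qed (use assms in \<open>auto simp: converges_def smult_mem\<close>)

lemma converges_star:
  assumes "converges u a"
  shows "converges (\<lambda>q. star A (u q)) (star A a)"
proof (rule convergesI)
  fix q
  have car: "a \<in> carrier A" "u q \<in> carrier A"
    using assms by (auto simp: converges_def)
  then show "star A (u q) \<in> carrier A" by (simp add: star_closed)
  show "cnorm A (star A a \<ominus> star A (u q)) \<le> cnorm A (a \<ominus> u q)"
    using car norm_star[of "a \<ominus> u q"] by (simp add: star_minus)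
qed (use assms in \<open>auto simp: converges_def star_closed\<close>)

lemma converges_mult:
  assumes "converges u a" "converges v b"
  shows "converges (\<lambda>q. u q \<otimes> v q) (a \<otimes> b)"
proof (rule convergesI)
  fix q
  have c: "a \<in> carrier A" "b \<in> carrier A" "u q \<in> carrier A" "v q \<in> carrier A"
    using assms by (auto simp: converges_def)
  then show "u q \<otimes> v q \<in> carrier A" by simp
  let ?s = "(a \<ominus> u q) \<otimes> b" and ?t = "a \<otimes> (b \<ominus> v q)" and ?w = "(a \<ominus> u q) \<otimes> (b \<ominus> v q)"
  have car: "?s \<in> carrier A" "?t \<in> carrier A" "?w \<in> carrier A" using c by auto
  have eq: "a \<otimes> b \<ominus> u q \<otimes> v q = ?s \<oplus> (?t \<oplus> \<ominus> ?w)" using c by algebra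
  have "cnorm A (?s \<oplus> (?t \<oplus> \<ominus> ?w)) \<le> cnorm A ?s + (cnorm A ?t + cnorm A ?w)"
    using norm_triangle[of ?s "?t \<oplus> \<ominus> ?w"] norm_triangle[of ?t "\<ominus> ?w"] norm_minus[of ?w] car by simp
  moreover have "cnorm A ?s \<le> cnorm A (a \<ominus> u q) * cnorm A b"
    "cnorm A ?t \<le> cnorm A a * cnorm A (b \<ominus> v q)"
    "cnorm A ?w \<le> cnorm A (a \<ominus> u q) * cnorm A (b \<ominus> v q)"
    using c by (auto intro!: norm_mult)
  ultimately show "cnorm A (a \<otimes> b \<ominus> u q \<otimes> v q) \<le> cnorm A (a \<ominus> u q) * cnorm A b
      + (cnorm A a * cnorm A (b \<ominus> v q) + cnorm A (a \<ominus> u q) * cnorm A (b \<ominus> v q))"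
    unfolding eq by linarith
next
  have "(\<lambda>q. cnorm A (a \<ominus> u q)) \<longlonglongrightarrow> 0" "(\<lambda>q. cnorm A (b \<ominus> v q)) \<longlonglongrightarrow> 0"
    using assms by (auto simp: converges_def)
  then show "(\<lambda>q. cnorm A (a \<ominus> u q) * cnorm A b + (cnorm A a * cnorm A (b \<ominus> v q)
      + cnorm A (a \<ominus> u q) * cnorm A (b \<ominus> v q))) \<longlonglongrightarrow> 0"
    by (intro tendsto_add_zero tendsto_mult_left_zero tendsto_mult_right_zero tendsto_mult_zero)
qed (use assms in \<open>auto simp: converges_def\<close>)

lemma tracial_statesD:
  assumes "\<tau> \<in> tracial_states A"
  shows "\<lbrakk>x \<in> carrier A; y \<in> carrier A\<rbrakk> \<Longrightarrow> \<tau> (x \<oplus> y) = \<tau> x + \<tau> y"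
    "x \<in> carrier A \<Longrightarrow> \<tau> (c \<odot> x) = c * \<tau> x"
    "x \<in> carrier A \<Longrightarrow> \<tau> (star A x \<otimes> x) \<in> \<real>\<^sub>\<ge>\<^sub>0"
    "\<tau> \<one> = 1"
  using assms by (auto simp: tracial_states_def)

text \<open>Positivity at \<open>x + c 1\<close> for \<open>c = 1\<close> and \<open>c = \<i>\<close> shows that the functional is hermitian, and for
\<open>c = - \<tau> x\<close> it gives the inequality.\<close>

lemma tracial_state_Cauchy_Schwarz:
  assumes \<tau>: "\<tau> \<in> tracial_states A" and x: "x \<in> carrier A"
  shows "(cmod (\<tau> x))\<^sup>2 \<le> Re (\<tau> (star A x \<otimes> x))"
proof -
  define s a b where "s = \<tau> (star A x \<otimes> x)" and "a = \<tau> x" and "b = \<tau> (star A x)"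
  note \<tau>D = tracial_statesD[OF \<tau>]
  have pos: "s + c * b + cnj c * a + cnj c * c \<in> \<real>\<^sub>\<ge>\<^sub>0" for c
  proof -
    have c1: "c \<odot> \<one> \<in> carrier A" by (simp add: smult_mem)
    have car: "star A x \<in> carrier A" "x \<in> carrier A" "cnj c \<odot> \<one> \<in> carrier A" "star A x \<otimes> x \<in> carrier A"
      using x star_closed smult_mem by auto
    have "star A (x \<oplus> c \<odot> \<one>) \<otimes> (x \<oplus> c \<odot> \<one>)
        = (star A x \<oplus> cnj c \<odot> \<one>) \<otimes> (x \<oplus> c \<odot> \<one>)"
      using x c1 by (simp add: star_add star_smult star_one)
    also have "\<dots> = star A x \<otimes> x \<oplus> star A x \<otimes> (c \<odot> \<one>) \<oplus> ((cnj c \<odot> \<one>) \<otimes> x \<oplus> (cnj c \<odot> \<one>) \<otimes> (c \<odot> \<one>))"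
      using car c1 by algebra
    also have "\<dots> = star A x \<otimes> x \<oplus> c \<odot> star A x \<oplus> (cnj c \<odot> x \<oplus> cnj c \<odot> (c \<odot> \<one>))"
      using car c1 smult_mult_right[of "star A x" \<one> c] smult_mult_left[of \<one> x "cnj c"]
        smult_mult_left[of \<one> "c \<odot> \<one>" "cnj c"] by simp
    finally have eq: "star A (x \<oplus> c \<odot> \<one>) \<otimes> (x \<oplus> c \<odot> \<one>)
        = star A x \<otimes> x \<oplus> c \<odot> star A x \<oplus> (cnj c \<odot> x \<oplus> cnj c \<odot> (c \<odot> \<one>))" .
    have "\<tau> (star A (x \<oplus> c \<odot> \<one>) \<otimes> (x \<oplus> c \<odot> \<one>)) = s + c * b + (cnj c * a + cnj c * (c * 1))"
      unfolding eq s_def a_def b_def using car c1 smult_mem by (simp add: \<tau>D)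
    moreover have "\<tau> (star A (x \<oplus> c \<odot> \<one>) \<otimes> (x \<oplus> c \<odot> \<one>)) \<in> \<real>\<^sub>\<ge>\<^sub>0"
      using x c1 by (intro \<tau>D(3)) simp
    ultimately show ?thesis by (simp add: add.assoc)
  qed
  have s: "Im s = 0" using pos[of 0] by (auto simp: complex_nonneg_Reals_iff)
  have "Im b = - Im a" using pos[of 1] s by (auto simp: complex_nonneg_Reals_iff)
  moreover have "Re b = Re a" using pos[of \<i>] s by (auto simp: complex_nonneg_Reals_iff)
  ultimately have b: "b = cnj a" by (simp add: complex_eq_iff)
  have "0 \<le> Re (s + (- a) * b + cnj (- a) * a + cnj (- a) * (- a))"
    using pos[of "- a"] by (simp only: complex_nonneg_Reals_iff)
  also have "s + (- a) * b + cnj (- a) * a + cnj (- a) * (- a) = s - a * cnj a"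
    by (simp add: b algebra_simps)
  also have "Re (s - a * cnj a) = Re s - (cmod a)\<^sup>2"
    by (simp add: complex_mult_cnj cmod_power2)
  finally show ?thesis by (simp add: s_def a_def)
qed

text \<open>If \<open>s\<close> is the norm of the functional, then the Cauchy-Schwarz inequality and the C*-identity give
\<open>s\<^sup>2 \<le> s\<close>.\<close>

lemma tracial_state_contractive_if_bounded:
  assumes \<tau>: "\<tau> \<in> tracial_states A" and C: "\<And>x. x \<in> carrier A \<Longrightarrow> cmod (\<tau> x) \<le> C * cnorm A x"
    and x: "x \<in> carrier A"
  shows "cmod (\<tau> x) \<le> cnorm A x"
proof -
  define S where "S = {x \<in> carrier A. cnorm A x \<le> 1}"
  define s where "s = (SUP x\<in>S. cmod (\<tau> x))"
  have le_C: "cmod (\<tau> x) \<le> \<bar>C\<bar>" if "x \<in> S" for x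
  proof -
    have "cmod (\<tau> x) \<le> C * cnorm A x" using that C by (auto simp: S_def)
    also have "\<dots> \<le> \<bar>C\<bar> * 1" using that norm_nonneg[of x] by (intro mult_mono) (auto simp: S_def)
    finally show ?thesis by simp
  qed
  have le_s: "cmod (\<tau> x) \<le> s" if "x \<in> S" for x
    unfolding s_def using that le_C by (intro cSUP_upper bdd_aboveI2) auto
  have one: "\<one> \<in> S" using norm_one_le by (simp add: S_def)
  have s1: "1 \<le> s" using le_s[OF one] tracial_statesD(4)[OF \<tau>] by simp
  have "cmod (\<tau> x) \<le> sqrt s" if "x \<in> S" for x
  proof -
    have "x \<in> carrier A" "cnorm A x \<le> 1" using that by (auto simp: S_def)
    then have "star A x \<otimes> x \<in> S"
      using norm_nonneg[of x] by (simp add: S_def star_closed norm_star_mult power_le_one)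
    have "(cmod (\<tau> x))\<^sup>2 \<le> Re (\<tau> (star A x \<otimes> x))"
      using \<open>x \<in> carrier A\<close> by (rule tracial_state_Cauchy_Schwarz[OF \<tau>])
    also have "\<dots> \<le> cmod (\<tau> (star A x \<otimes> x))" by (rule complex_Re_le_cmod)
    also have "\<dots> \<le> s" using le_s \<open>star A x \<otimes> x \<in> S\<close> by blast
    finally show ?thesis by (rule real_le_rsqrt)
  qed
  then have "s \<le> sqrt s" unfolding s_def using one by (intro cSUP_least) auto
  then have "s * s \<le> s"
    using s1 power_mono[of s "sqrt s" 2] by (simp add: power2_eq_square)
  then have s_le: "s \<le> 1" using s1 by simp
  show ?thesis
  proof (cases "cnorm A x = 0")
    case True
    then show ?thesis using C[OF x] by simp
  next
    case False
    then have pos: "0 < cnorm A x" using norm_nonneg[OF x] by simp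
    let ?c = "complex_of_real (1 / cnorm A x)"
    have "?c \<odot> x \<in> S" using x pos by (simp add: S_def smult_mem norm_smult norm_divide)
    then have "cmod (\<tau> (?c \<odot> x)) \<le> 1" using le_s s_le by force
    then have "cmod (\<tau> x) / cnorm A x \<le> 1"
      using pos by (simp add: tracial_statesD(2)[OF \<tau> x] norm_mult norm_divide)
    then show ?thesis using pos by (simp add: field_simps)
  qed
qed

definition contractive_tracial_states :: "('a \<Rightarrow> complex) set" where
  "contractive_tracial_states = {\<tau> \<in> tracial_states A. \<forall>x\<in>carrier A. cmod (\<tau> x) \<le> cnorm A x}"

text \<open>This says that the contractive tracial states form a face of the tracial states. The component
\<open>\<sigma>\<close> is dominated by \<open>\<tau> / t\<close> on positive elements, so it is bounded, hence contractive.\<close>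

lemma contractive_component:
  assumes \<tau>: "\<tau> \<in> contractive_tracial_states" and \<sigma>: "\<sigma> \<in> tracial_states A" and \<rho>: "\<rho> \<in> tracial_states A"
    and t: "0 < t" "t < (1::real)"
    and eq: "\<And>x. x \<in> carrier A \<Longrightarrow> \<tau> x = complex_of_real t * \<sigma> x + complex_of_real (1 - t) * \<rho> x"
  shows "\<sigma> \<in> contractive_tracial_states"
proof -
  have "cmod (\<sigma> x) \<le> sqrt (1 / t) * cnorm A x" if x: "x \<in> carrier A" for x
  proof -
    let ?y = "star A x \<otimes> x"
    have y: "?y \<in> carrier A" using x by (simp add: star_closed)
    have "0 \<le> Re (\<rho> ?y)" using tracial_statesD(3)[OF \<rho> x] by (simp add: complex_nonneg_Reals_iff)
    then have "t * Re (\<sigma> ?y) \<le> Re (\<tau> ?y)" using eq[OF y] t by simp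
    also have "\<dots> \<le> cmod (\<tau> ?y)" by (rule complex_Re_le_cmod)
    also have "\<dots> \<le> (cnorm A x)\<^sup>2"
      using \<tau> y norm_star_mult[OF x] by (auto simp: contractive_tracial_states_def)
    finally have "Re (\<sigma> ?y) \<le> 1 / t * (cnorm A x)\<^sup>2" using t by (simp add: field_simps)
    then have "(cmod (\<sigma> x))\<^sup>2 \<le> 1 / t * (cnorm A x)\<^sup>2"
      using tracial_state_Cauchy_Schwarz[OF \<sigma> x] by linarith
    then have "cmod (\<sigma> x) \<le> sqrt (1 / t * (cnorm A x)\<^sup>2)" by (rule real_le_rsqrt)
    also have "\<dots> = sqrt (1 / t) * cnorm A x"
      using norm_nonneg[OF x] by (simp only: real_sqrt_mult real_sqrt_abs abs_of_nonneg)
    finally show ?thesis .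
  qed
  then show ?thesis
    using tracial_state_contractive_if_bounded[OF \<sigma>] \<sigma> by (auto simp: contractive_tracial_states_def)
qed

text \<open>Extreme points of a face are extreme points of the whole set.\<close>

lemma extreme_contractive_tracial_state_extremal:
  assumes "face (carrier A) contractive_tracial_states {\<tau>}"
  shows "\<tau> \<in> extremal_tracial_states A"
proof -
  have \<tau>: "\<tau> \<in> contractive_tracial_states" using face_subset[OF assms] by simp
  have "\<sigma> = \<tau> \<and> \<rho> = \<tau>"
    if st: "\<sigma> \<in> tracial_states A" "\<rho> \<in> tracial_states A" "0 < t" "t < 1"
      and eq: "\<forall>x\<in>carrier A. \<tau> x = complex_of_real t * \<sigma> x + complex_of_real (1 - t) * \<rho> x" for \<sigma> \<rho> t
  proof -
    have "\<sigma> \<in> contractive_tracial_states"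
      using contractive_component[OF \<tau> st] eq by blast
    moreover have "\<rho> \<in> contractive_tracial_states"
      by (rule contractive_component[OF \<tau> st(2,1), of "1 - t"]) (use eq st in auto)
    ultimately show ?thesis using faceD[OF assms _ _ _ st(3,4)] eq by blast
  qed
  then show ?thesis
    using \<tau> unfolding extremal_tracial_states_def contractive_tracial_states_def by blast
qed

lemma closed_contractive_tracial_states: "closed contractive_tracial_states"
proof -
  have ev: "continuous_on UNIV (\<lambda>\<tau>::'a \<Rightarrow> complex. \<tau> x)" for x by simp
  have "closed {\<tau>::'a \<Rightarrow> complex. \<tau> x \<in> \<real>\<^sub>\<ge>\<^sub>0}" for x
    using closed_vimage[OF closed_nonneg_Reals_complex ev[of x]] by (simp add: vimage_def)
  then have "closed {\<tau>::'a \<Rightarrow> complex.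
     (\<forall>x. x \<notin> carrier A \<longrightarrow> \<tau> x = undefined) \<and>
     (\<forall>x. x \<in> carrier A \<longrightarrow> (\<forall>y. y \<in> carrier A \<longrightarrow> \<tau> (x \<oplus> y) = \<tau> x + \<tau> y)) \<and>
     (\<forall>c x. x \<in> carrier A \<longrightarrow> \<tau> (c \<odot> x) = c * \<tau> x) \<and>
     (\<forall>x. x \<in> carrier A \<longrightarrow> \<tau> (star A x \<otimes> x) \<in> \<real>\<^sub>\<ge>\<^sub>0) \<and> \<tau> \<one> = 1 \<and>
     (\<forall>x. x \<in> carrier A \<longrightarrow> (\<forall>y. y \<in> carrier A \<longrightarrow> \<tau> (x \<otimes> y) = \<tau> (y \<otimes> x))) \<and>
     (\<forall>x. x \<in> carrier A \<longrightarrow> cmod (\<tau> x) \<le> cnorm A x)}"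
    by (intro closed_Collect_conj closed_Collect_all closed_Collect_imp closed_Collect_eq closed_Collect_le
        open_Collect_const continuous_intros ev)
  also have "{\<tau>::'a \<Rightarrow> complex.
     (\<forall>x. x \<notin> carrier A \<longrightarrow> \<tau> x = undefined) \<and>
     (\<forall>x. x \<in> carrier A \<longrightarrow> (\<forall>y. y \<in> carrier A \<longrightarrow> \<tau> (x \<oplus> y) = \<tau> x + \<tau> y)) \<and>
     (\<forall>c x. x \<in> carrier A \<longrightarrow> \<tau> (c \<odot> x) = c * \<tau> x) \<and>
     (\<forall>x. x \<in> carrier A \<longrightarrow> \<tau> (star A x \<otimes> x) \<in> \<real>\<^sub>\<ge>\<^sub>0) \<and> \<tau> \<one> = 1 \<and>
     (\<forall>x. x \<in> carrier A \<longrightarrow> (\<forall>y. y \<in> carrier A \<longrightarrow> \<tau> (x \<otimes> y) = \<tau> (y \<otimes> x))) \<and>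
     (\<forall>x. x \<in> carrier A \<longrightarrow> cmod (\<tau> x) \<le> cnorm A x)} = contractive_tracial_states"
    by (auto simp: contractive_tracial_states_def tracial_states_def extensional_def)
  finally show ?thesis .
qed

end

lemma compact_PiE_fun:
  fixes S :: "'i \<Rightarrow> 'b::topological_space set"
  assumes "\<And>i. compact (S i)"
  shows "compact {f. \<forall>i. f i \<in> S i}"
proof -
  have "compactin (product_topology (\<lambda>i. euclidean) UNIV) (PiE UNIV S)"
    using assms by (auto simp: compactin_PiE)
  then show ?thesis by (simp add: euclidean_product_topology PiE_UNIV_domain Pi_def)
qed

context unital_cstar_algebra
begin

lemma compact_contractive_tracial_states: "compact contractive_tracial_states"
proof -
  let ?S = "\<lambda>x. if x \<in> carrier A then cball 0 (cnorm A x) else {undefined :: complex}"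
  have "compact {f. \<forall>x. f x \<in> ?S x}" by (rule compact_PiE_fun) auto
  then have "compact ({f. \<forall>x. f x \<in> ?S x} \<inter> contractive_tracial_states)"
    by (rule compact_Int_closed[OF _ closed_contractive_tracial_states])
  also have "{f. \<forall>x. f x \<in> ?S x} \<inter> contractive_tracial_states = contractive_tracial_states"
    by (auto simp: contractive_tracial_states_def tracial_states_def extensional_def)
  finally show ?thesis .
qed

text \<open>The maximum principle for the contractive tracial states. By compactness, states that are large at
each single \<open>a n\<close> yield one that is large at all of them.\<close>

lemma large_at_extremal_tracial_state:
  assumes a: "\<And>n::nat. a n \<in> carrier A"
    and dec: "\<And>n \<tau>. \<tau> \<in> contractive_tracial_states \<Longrightarrow> Re (\<tau> (a (Suc n))) \<le> Re (\<tau> (a n))"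
    and large: "\<And>n. \<exists>\<tau>\<in>contractive_tracial_states. \<epsilon> \<le> Re (\<tau> (a n))"
  shows "\<exists>\<tau>\<in>extremal_tracial_states A \<inter> contractive_tracial_states. \<forall>n. \<epsilon> \<le> Re (\<tau> (a n))"
proof -
  let ?f = "\<lambda>n (\<tau> :: 'a \<Rightarrow> complex). Re (\<tau> (a n))"
  have cont: "continuous_on UNIV (?f n)" for n by (intro continuous_intros) simp
  obtain \<sigma> where \<sigma>: "\<sigma> \<in> contractive_tracial_states" "\<And>n. \<epsilon> \<le> ?f n \<sigma>"
    using decreasing_maximizers_nonempty[of contractive_tracial_states ?f, OF compact_contractive_tracial_states cont dec large]
    by blast
  have "contractive_tracial_states \<subseteq> extensional (carrier A)"
    by (auto simp: contractive_tracial_states_def tracial_states_def)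
  from Bauer_maximum_principle[where f = ?f and b = \<epsilon>, OF compact_contractive_tracial_states
      closed_contractive_tracial_states this cont affine_on_Re[OF a] dec \<sigma>]
  obtain \<tau> where "\<tau> \<in> contractive_tracial_states" "face (carrier A) contractive_tracial_states {\<tau>}"
      "\<And>n. \<epsilon> \<le> ?f n \<tau>" by blast
  then show ?thesis using extreme_contractive_tracial_state_extremal by blast
qed

end

section \<open>Tracial states of the limit\<close>

locale AH_limit = AH_system h X r p n \<phi>
  for h :: "nat \<Rightarrow> nat" and X :: "nat \<Rightarrow> nat \<Rightarrow> 'x topology" and r :: "nat \<Rightarrow> nat \<Rightarrow> nat"
    and p :: "nat \<Rightarrow> nat \<Rightarrow> 'x \<Rightarrow> complex mat" and n :: "nat \<Rightarrow> nat \<Rightarrow> nat"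
    and \<phi> :: "nat \<Rightarrow> (nat \<Rightarrow> 'x \<Rightarrow> complex mat) \<Rightarrow> nat \<Rightarrow> 'x \<Rightarrow> complex mat" +
  fixes A :: "'a cstar" and \<psi> :: "nat \<Rightarrow> (nat \<Rightarrow> 'x \<Rightarrow> complex mat) \<Rightarrow> 'a"
  assumes limit: "cstar_inductive_limit (AH_stage h X r p) \<phi> A \<psi>"

sublocale AH_limit \<subseteq> A: unital_cstar_algebra A
  using limit by (simp add: cstar_inductive_limit_def)

context AH_limit
begin

lemma \<psi>_hom: "\<psi> i \<in> unital_star_hom (B i) A"
  and \<psi>_step: "b \<in> carrier (B i) \<Longrightarrow> \<psi> (Suc i) (\<phi> i b) = \<psi> i b"
  and norm_limit: "b \<in> carrier (B i) \<Longrightarrow>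
        (\<lambda>j. cnorm (B j) (connecting \<phi> i j b)) \<longlonglongrightarrow> cnorm A (\<psi> i b)"
  and dense: "\<lbrakk>a \<in> carrier A; 0 < e\<rbrakk> \<Longrightarrow> \<exists>i. \<exists>b\<in>carrier (B i). cnorm A (a \<ominus>\<^bsub>A\<^esub> \<psi> i b) < e"
  using limit by (auto simp: cstar_inductive_limit_def)

lemmas \<psi>_simps = unital_star_homD[OF \<psi>_hom]
lemmas connecting_simps = unital_star_homD[OF connecting_hom]

lemma \<psi>_connecting:
  assumes "i \<le> j" "b \<in> carrier (B i)"
  shows "\<psi> j (connecting \<phi> i j b) = \<psi> i b"
  using assms
proof (induction rule: dec_induct)
  case (step j)
  then show ?case using \<psi>_step[OF connecting_simps(1)[of i j b]] by (simp add: connecting_Suc)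
next
  case base
  show ?case by (simp add: connecting_same)
qed

text \<open>A compatible family of tracial functionals on the stages that is dominated by the norm of
  the limit extends by continuity to a tracial state.\<close>

context
  fixes T :: "nat \<Rightarrow> (nat \<Rightarrow> 'x \<Rightarrow> complex mat) \<Rightarrow> complex"
  assumes T_add: "\<lbrakk>b \<in> carrier (B i); b' \<in> carrier (B i)\<rbrakk> \<Longrightarrow> T i (b \<oplus>\<^bsub>B i\<^esub> b') = T i b + T i b'"
    and T_smult: "b \<in> carrier (B i) \<Longrightarrow> T i (c \<odot>\<^bsub>B i\<^esub> b) = c * T i b"
    and T_comm: "\<lbrakk>b \<in> carrier (B i); b' \<in> carrier (B i)\<rbrakk> \<Longrightarrow> T i (b \<otimes>\<^bsub>B i\<^esub> b') = T i (b' \<otimes>\<^bsub>B i\<^esub> b)"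
    and T_pos: "b \<in> carrier (B i) \<Longrightarrow> T i (star (B i) b \<otimes>\<^bsub>B i\<^esub> b) \<in> \<real>\<^sub>\<ge>\<^sub>0"
    and T_one: "T i \<one>\<^bsub>B i\<^esub> = 1"
    and T_step: "b \<in> carrier (B i) \<Longrightarrow> T (Suc i) (\<phi> i b) = T i b"
    and T_norm: "b \<in> carrier (B i) \<Longrightarrow> cmod (T i b) \<le> cnorm A (\<psi> i b)"
begin

lemma T_connecting:
  assumes "i \<le> j" "b \<in> carrier (B i)"
  shows "T j (connecting \<phi> i j b) = T i b"
  using assms
proof (induction rule: dec_induct)
  case (step j)
  then show ?case using T_step[OF connecting_simps(1)[of i j b]] by (simp add: connecting_Suc)
next
  case base
  show ?case by (simp add: connecting_same)
qed

lemma T_diff: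
  assumes b: "b \<in> carrier (B i)" and b': "b' \<in> carrier (B i')"
  shows "cmod (T i b - T i' b') \<le> cnorm A (\<psi> i b \<ominus>\<^bsub>A\<^esub> \<psi> i' b')"
proof -
  define j where "j = max i i'"
  let ?c = "connecting \<phi> i j b" and ?c' = "connecting \<phi> i' j b'"
  have c: "?c \<in> carrier (B j)" "?c' \<in> carrier (B j)"
    using b b' by (auto simp: j_def intro!: connecting_simps(1))
  have c'': "(-1) \<odot>\<^bsub>B j\<^esub> ?c' \<in> carrier (B j)" using c by (intro stage_closed)
  have "T j (?c \<oplus>\<^bsub>B j\<^esub> (-1) \<odot>\<^bsub>B j\<^esub> ?c') = T i b - T i' b'"
    using T_connecting[of i j b] T_connecting[of i' j b'] b b' c c'' by (simp add: j_def T_add T_smult)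
  moreover have "\<psi> j (?c \<oplus>\<^bsub>B j\<^esub> (-1) \<odot>\<^bsub>B j\<^esub> ?c') = \<psi> j ?c \<oplus>\<^bsub>A\<^esub> (-1) \<odot>\<^bsub>A\<^esub> \<psi> j ?c'"
    using c c'' by (simp add: \<psi>_simps)
  moreover have "\<dots> = \<psi> i b \<ominus>\<^bsub>A\<^esub> \<psi> i' b'"
    using \<psi>_connecting[of i j b] \<psi>_connecting[of i' j b'] b b'
    by (simp add: j_def A.smult_minus_one \<psi>_simps a_minus_def)
  moreover have "cmod (T j (?c \<oplus>\<^bsub>B j\<^esub> (-1) \<odot>\<^bsub>B j\<^esub> ?c'))
      \<le> cnorm A (\<psi> j (?c \<oplus>\<^bsub>B j\<^esub> (-1) \<odot>\<^bsub>B j\<^esub> ?c'))"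
    using c c'' by (intro T_norm stage_closed)
  ultimately show ?thesis by simp
qed

text \<open>The values of \<open>T\<close> along approximants of \<open>a\<close> form a Cauchy sequence. The inequality for
all \<open>i\<close> and \<open>b\<close> at once determines the limit \<open>z\<close>, as the right-hand side can be made small.\<close>

lemma extension_value_exists:
  assumes a: "a \<in> carrier A"
  shows "\<exists>z. \<forall>i. \<forall>b\<in>carrier (B i). cmod (z - T i b) \<le> cnorm A (a \<ominus>\<^bsub>A\<^esub> \<psi> i b)"
proof -
  have "\<exists>i b. b \<in> carrier (B i) \<and> cnorm A (a \<ominus>\<^bsub>A\<^esub> \<psi> i b) < 1 / real (Suc q)" for q
    using dense[OF a, of "1 / real (Suc q)"] by auto
  then obtain i b where b: "\<And>q::nat. b q \<in> carrier (B (i q))"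
      and close: "\<And>q. cnorm A (a \<ominus>\<^bsub>A\<^esub> \<psi> (i q) (b q)) < 1 / real (Suc q)"
    by metis
  let ?t = "\<lambda>q. T (i q) (b q)"
  have bound: "cmod (?t q - T i' b') \<le> 1 / real (Suc q) + cnorm A (a \<ominus>\<^bsub>A\<^esub> \<psi> i' b')"
    if b': "b' \<in> carrier (B i')" for q i' b'
  proof -
    have "cmod (?t q - T i' b') \<le> cnorm A (\<psi> (i q) (b q) \<ominus>\<^bsub>A\<^esub> \<psi> i' b')" by (rule T_diff[OF b b'])
    moreover have "cnorm A (\<psi> (i q) (b q) \<ominus>\<^bsub>A\<^esub> \<psi> i' b')
        \<le> cnorm A (\<psi> (i q) (b q) \<ominus>\<^bsub>A\<^esub> a) + cnorm A (a \<ominus>\<^bsub>A\<^esub> \<psi> i' b')"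
      using a b b' by (intro A.norm_minus_triangle) (auto simp: \<psi>_simps)
    moreover have "cnorm A (\<psi> (i q) (b q) \<ominus>\<^bsub>A\<^esub> a) = cnorm A (a \<ominus>\<^bsub>A\<^esub> \<psi> (i q) (b q))"
      using a b by (intro A.norm_minus_commute) (auto simp: \<psi>_simps)
    ultimately show ?thesis using close[of q] by linarith
  qed
  have "Cauchy ?t"
  proof (rule metric_CauchyI)
    fix e :: real assume "0 < e"
    then obtain N where N: "1 / real (Suc N) < e / 2" by (metis half_gt_zero nat_approx_posE)
    have "dist (?t q) (?t q') < e" if "N \<le> q" "N \<le> q'" for q q'
    proof -
      have "1 / real (Suc q) \<le> 1 / real (Suc N)" "1 / real (Suc q') \<le> 1 / real (Suc N)"
        using that by (auto intro!: divide_left_mono)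
      then show ?thesis using bound[OF b, of q q'] close[of q'] N unfolding dist_norm by linarith
    qed
    then show "\<exists>N. \<forall>q\<ge>N. \<forall>q'\<ge>N. dist (?t q) (?t q') < e" by blast
  qed
  then obtain z where z: "?t \<longlonglongrightarrow> z" using Cauchy_convergent_iff convergent_def by blast
  have "cmod (z - T i' b') \<le> cnorm A (a \<ominus>\<^bsub>A\<^esub> \<psi> i' b')" if b': "b' \<in> carrier (B i')" for i' b'
  proof (rule tendsto_le[OF sequentially_bot])
    show "(\<lambda>q. cmod (?t q - T i' b')) \<longlonglongrightarrow> cmod (z - T i' b')"
      by (intro tendsto_intros z)
    show "(\<lambda>q. 1 / real (Suc q) + cnorm A (a \<ominus>\<^bsub>A\<^esub> \<psi> i' b')) \<longlonglongrightarrow> cnorm A (a \<ominus>\<^bsub>A\<^esub> \<psi> i' b')"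
      using tendsto_add[OF LIMSEQ_Suc[OF lim_1_over_n] tendsto_const, of "cnorm A (a \<ominus>\<^bsub>A\<^esub> \<psi> i' b')"] by simp
    show "\<forall>\<^sub>F q in sequentially. cmod (?t q - T i' b') \<le> 1 / real (Suc q) + cnorm A (a \<ominus>\<^bsub>A\<^esub> \<psi> i' b')"
      using bound[OF b'] by simp
  qed
  then show ?thesis by blast
qed

text \<open>Approximants of two elements can be moved to a common stage, where they can be added and
multiplied.\<close>

lemma simultaneous_approximation:
  assumes "a \<in> carrier A" "a' \<in> carrier A"
  obtains i b b' where "\<And>q::nat. b q \<in> carrier (B (i q))" "\<And>q. b' q \<in> carrier (B (i q))"
    "A.converges (\<lambda>q. \<psi> (i q) (b q)) a" "A.converges (\<lambda>q. \<psi> (i q) (b' q)) a'"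
proof -
  have "\<exists>i b b'. b \<in> carrier (B i) \<and> b' \<in> carrier (B i) \<and>
      cnorm A (a \<ominus>\<^bsub>A\<^esub> \<psi> i b) \<le> 1 / real (Suc q) \<and> cnorm A (a' \<ominus>\<^bsub>A\<^esub> \<psi> i b') \<le> 1 / real (Suc q)" for q
  proof -
    obtain i b where b: "b \<in> carrier (B i)" "cnorm A (a \<ominus>\<^bsub>A\<^esub> \<psi> i b) < 1 / real (Suc q)"
      using dense[OF assms(1), of "1 / real (Suc q)"] by auto
    obtain i' b' where b': "b' \<in> carrier (B i')" "cnorm A (a' \<ominus>\<^bsub>A\<^esub> \<psi> i' b') < 1 / real (Suc q)"
      using dense[OF assms(2), of "1 / real (Suc q)"] by auto
    let ?j = "max i i'"
    have "connecting \<phi> i ?j b \<in> carrier (B ?j)" "connecting \<phi> i' ?j b' \<in> carrier (B ?j)"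
      "\<psi> ?j (connecting \<phi> i ?j b) = \<psi> i b" "\<psi> ?j (connecting \<phi> i' ?j b') = \<psi> i' b'"
      using b(1) b'(1) by (simp_all add: connecting_simps \<psi>_connecting)
    then show ?thesis using b(2) b'(2) less_imp_le by metis
  qed
  then obtain i b b' where *: "\<And>q::nat. b q \<in> carrier (B (i q))" "\<And>q. b' q \<in> carrier (B (i q))"
      "\<And>q. cnorm A (a \<ominus>\<^bsub>A\<^esub> \<psi> (i q) (b q)) \<le> 1 / real (Suc q)"
      "\<And>q. cnorm A (a' \<ominus>\<^bsub>A\<^esub> \<psi> (i q) (b' q)) \<le> 1 / real (Suc q)"
    by metis
  have lim0: "(\<lambda>q. 1 / real (Suc q)) \<longlonglongrightarrow> 0" by (rule LIMSEQ_Suc[OF lim_1_over_n])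
  show thesis
    by (rule that[OF *(1,2)]; rule A.convergesI[OF _ _ _ lim0]) (use * assms \<psi>_simps in auto)
qed

lemma tracial_state_extending:
  obtains \<tau> where "\<tau> \<in> A.contractive_tracial_states" "\<And>i b. b \<in> carrier (B i) \<Longrightarrow> \<tau> (\<psi> i b) = T i b"
proof -
  from extension_value_exists obtain z where
    z: "\<And>a i b. \<lbrakk>a \<in> carrier A; b \<in> carrier (B i)\<rbrakk> \<Longrightarrow> cmod (z a - T i b) \<le> cnorm A (a \<ominus>\<^bsub>A\<^esub> \<psi> i b)"
    by metis
  define \<tau> where "\<tau> = restrict z (carrier A)"
  have lim: "(\<lambda>q. T (i q) (b q)) \<longlonglongrightarrow> \<tau> a"
    if "\<And>q. b q \<in> carrier (B (i q))" "A.converges (\<lambda>q. \<psi> (i q) (b q)) a" for i b a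
  proof -
    have a: "a \<in> carrier A" and 0: "(\<lambda>q. cnorm A (a \<ominus>\<^bsub>A\<^esub> \<psi> (i q) (b q))) \<longlonglongrightarrow> 0"
      using that(2) by (auto simp: A.converges_def)
    have "(\<lambda>q. T (i q) (b q) - z a) \<longlonglongrightarrow> 0"
      by (rule Lim_null_comparison[OF always_eventually 0])
         (use z[OF a that(1)] in \<open>auto simp: norm_minus_commute\<close>)
    then show ?thesis using a by (simp add: \<tau>_def LIM_zero_iff)
  qed
  have on_stage: "\<tau> (\<psi> i b) = T i b" if b: "b \<in> carrier (B i)" for i b
  proof -
    have \<psi>c: "\<psi> i b \<in> carrier A" using b by (rule \<psi>_simps)
    then have zero: "\<psi> i b \<ominus>\<^bsub>A\<^esub> \<psi> i b = \<zero>\<^bsub>A\<^esub>" by algebra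
    have "cmod (z (\<psi> i b) - T i b) \<le> 0" using z[OF \<psi>c b] unfolding zero A.norm_zero .
    then show ?thesis using \<psi>c by (simp add: \<tau>_def)
  qed
  have "\<tau> \<in> A.contractive_tracial_states"
    unfolding A.contractive_tracial_states_def tracial_states_def
  proof (intro CollectI conjI ballI allI)
    show "\<tau> \<in> extensional (carrier A)" by (simp add: \<tau>_def)
    show "\<tau> \<one>\<^bsub>A\<^esub> = 1"
      using on_stage[of "\<one>\<^bsub>B 0\<^esub>" 0] T_one \<psi>_simps(4)[of 0] central_mem[of 0 "\<lambda>_ _. 1"] by (simp add: central_one)
  next
    fix a a' assume aa: "a \<in> carrier A" "a' \<in> carrier A"
    obtain i b b' where b: "\<And>q::nat. b q \<in> carrier (B (i q))" "\<And>q. b' q \<in> carrier (B (i q))"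
      and cv: "A.converges (\<lambda>q. \<psi> (i q) (b q)) a" "A.converges (\<lambda>q. \<psi> (i q) (b' q)) a'"
      by (rule simultaneous_approximation[OF aa]) blast
    have "(\<lambda>q. T (i q) (b q \<oplus>\<^bsub>B (i q)\<^esub> b' q)) \<longlonglongrightarrow> \<tau> (a \<oplus>\<^bsub>A\<^esub> a')"
      by (rule lim) (use b A.converges_add[OF cv] in \<open>simp_all add: stage_closed \<psi>_simps\<close>)
    moreover have "(\<lambda>q. T (i q) (b q) + T (i q) (b' q)) \<longlonglongrightarrow> \<tau> a + \<tau> a'"
      by (intro tendsto_add lim b cv)
    ultimately show "\<tau> (a \<oplus>\<^bsub>A\<^esub> a') = \<tau> a + \<tau> a'" using b by (simp add: T_add LIMSEQ_unique)
    have "(\<lambda>q. T (i q) (b q \<otimes>\<^bsub>B (i q)\<^esub> b' q)) \<longlonglongrightarrow> \<tau> (a \<otimes>\<^bsub>A\<^esub> a')"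
      by (rule lim) (use b A.converges_mult[OF cv] in \<open>simp_all add: stage_closed \<psi>_simps\<close>)
    moreover have "(\<lambda>q. T (i q) (b q \<otimes>\<^bsub>B (i q)\<^esub> b' q)) \<longlonglongrightarrow> \<tau> (a' \<otimes>\<^bsub>A\<^esub> a)"
      by (subst T_comm[OF b], rule lim)
         (use b A.converges_mult[OF cv(2,1)] in \<open>simp_all add: stage_closed \<psi>_simps\<close>)
    ultimately show "\<tau> (a \<otimes>\<^bsub>A\<^esub> a') = \<tau> (a' \<otimes>\<^bsub>A\<^esub> a)" by (rule LIMSEQ_unique)
  next
    fix a c assume a: "a \<in> carrier A"
    obtain i b where b: "\<And>q::nat. b q \<in> carrier (B (i q))"
      and cv: "A.converges (\<lambda>q. \<psi> (i q) (b q)) a"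
      by (rule simultaneous_approximation[OF a a]) blast
    have "(\<lambda>q. T (i q) (c \<odot>\<^bsub>B (i q)\<^esub> b q)) \<longlonglongrightarrow> \<tau> (c \<odot>\<^bsub>A\<^esub> a)"
      by (rule lim) (use b A.converges_smult[OF cv] in \<open>simp_all add: stage_closed \<psi>_simps\<close>)
    moreover have "(\<lambda>q. c * T (i q) (b q)) \<longlonglongrightarrow> c * \<tau> a"
      by (intro tendsto_mult_left lim b cv)
    ultimately show "\<tau> (c \<odot>\<^bsub>A\<^esub> a) = c * \<tau> a" using b by (simp add: T_smult LIMSEQ_unique)
  next
    fix a assume a: "a \<in> carrier A"
    obtain i b where b: "\<And>q::nat. b q \<in> carrier (B (i q))"
      and cv: "A.converges (\<lambda>q. \<psi> (i q) (b q)) a"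
      by (rule simultaneous_approximation[OF a a]) blast
    have "(\<lambda>q. T (i q) (star (B (i q)) (b q) \<otimes>\<^bsub>B (i q)\<^esub> b q)) \<longlonglongrightarrow> \<tau> (star A a \<otimes>\<^bsub>A\<^esub> a)"
      by (rule lim) (use b A.converges_mult[OF A.converges_star[OF cv] cv] in \<open>simp_all add: stage_closed \<psi>_simps\<close>)
    from closed_sequentially[OF closed_nonneg_Reals_complex _ this]
    show "\<tau> (star A a \<otimes>\<^bsub>A\<^esub> a) \<in> \<real>\<^sub>\<ge>\<^sub>0" using T_pos[OF b] by blast
    have "(\<lambda>q. cmod (T (i q) (b q))) \<longlonglongrightarrow> cmod (\<tau> a)" by (intro tendsto_norm lim b cv)
    moreover have "(\<lambda>q. cnorm A a + cnorm A (a \<ominus>\<^bsub>A\<^esub> \<psi> (i q) (b q))) \<longlonglongrightarrow> cnorm A a + 0"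
      using cv by (intro tendsto_intros) (auto simp: A.converges_def)
    moreover have "cmod (T (i q) (b q)) \<le> cnorm A a + cnorm A (a \<ominus>\<^bsub>A\<^esub> \<psi> (i q) (b q))" for q
    proof -
      have \<psi>c: "\<psi> (i q) (b q) \<in> carrier A" using b by (simp add: \<psi>_simps)
      have "cmod (T (i q) (b q)) \<le> cnorm A (\<psi> (i q) (b q))" using b by (rule T_norm)
      moreover have "a \<oplus>\<^bsub>A\<^esub> \<ominus>\<^bsub>A\<^esub> (a \<ominus>\<^bsub>A\<^esub> \<psi> (i q) (b q)) = \<psi> (i q) (b q)"
        using a \<psi>c by algebra
      moreover have "cnorm A (a \<oplus>\<^bsub>A\<^esub> \<ominus>\<^bsub>A\<^esub> (a \<ominus>\<^bsub>A\<^esub> \<psi> (i q) (b q)))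
          \<le> cnorm A a + cnorm A (\<ominus>\<^bsub>A\<^esub> (a \<ominus>\<^bsub>A\<^esub> \<psi> (i q) (b q)))"
        using a \<psi>c by (intro A.norm_triangle) auto
      ultimately show ?thesis using a \<psi>c by (simp add: A.norm_minus)
    qed
    ultimately show "cmod (\<tau> a) \<le> cnorm A a" by (intro LIMSEQ_le) auto
  qed
  then show thesis using on_stage by (rule that)
qed

end

text \<open>Instead of a convergent subnet, a finer filter along which \<open>S\<close> converges. The function spaces to
which this is applied need not be sequentially compact.\<close>

lemma cluster_filter:
  fixes S :: "nat \<Rightarrow> 'b::topological_space"
  assumes "compact K" "\<And>j. S j \<in> K" "F \<noteq> bot"
  obtains T G where "G \<noteq> bot" "G \<le> F" "(S \<longlongrightarrow> T) G"
proof -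
  have "filtermap S F \<noteq> bot" using assms(3) by (simp add: filtermap_bot_iff)
  moreover have "\<forall>\<^sub>F y in filtermap S F. y \<in> K" using assms(2) by (simp add: eventually_filtermap)
  ultimately obtain T where T: "inf (nhds T) (filtermap S F) \<noteq> bot"
    using assms(1) unfolding compact_filter by blast
  let ?G = "inf (filtercomap S (nhds T)) F"
  have "?G \<noteq> bot"
  proof
    assume "?G = bot"
    then obtain P Q where PQ: "eventually P (filtercomap S (nhds T))" "eventually Q F" "\<And>j. \<lbrakk>P j; Q j\<rbrakk> \<Longrightarrow> False"
      by (auto simp: trivial_limit_def eventually_inf)
    then obtain P' where P': "eventually P' (nhds T)" "\<And>j. P' (S j) \<Longrightarrow> P j"
      by (auto simp: eventually_filtercomap)
    have "eventually (\<lambda>y. \<exists>j. y = S j \<and> Q j) (filtermap S F)"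
      using PQ(2) by (auto simp: eventually_filtermap elim: eventually_mono)
    then have "eventually (\<lambda>_. False) (inf (nhds T) (filtermap S F))"
      unfolding eventually_inf using P' PQ(3) by (intro exI[of _ P'] exI conjI) auto
    then show False using T by (simp add: trivial_limit_def)
  qed
  moreover have "(S \<longlongrightarrow> T) ?G"
    unfolding filterlim_iff_le_filtercomap by simp
  ultimately show thesis using that by (metis inf_le2)
qed

text \<open>The traces at the given points, regarded as functions on all pairs of a stage and an element, lie in
a product of discs. A cluster point inherits the algebraic laws of traces and the norm
bound of the limit algebra, so it extends to \<open>A\<close>.\<close>

lemma tracial_state_from_points:
  assumes b0: "b0 \<in> carrier (B i0)"
    and freq: "\<exists>\<^sub>F j in sequentially. \<exists>k<h j. \<exists>x\<in>topspace (X j k).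
      \<epsilon> \<le> Re (point_trace j k x (connecting \<phi> i0 j b0))"
  shows "\<exists>\<tau>\<in>A.contractive_tracial_states. \<epsilon> \<le> Re (\<tau> (\<psi> i0 b0))"
proof -
  let ?good = "\<lambda>j. \<exists>k<h j. \<exists>x\<in>topspace (X j k). \<epsilon> \<le> Re (point_trace j k x (connecting \<phi> i0 j b0))"
  have "\<exists>k x. k < h j \<and> x \<in> topspace (X j k) \<and>
      (?good j \<longrightarrow> \<epsilon> \<le> Re (point_trace j k x (connecting \<phi> i0 j b0)))" for j
    using h_pos[of j] nonempty[of 0 j] by blast
  then obtain k x where kx: "\<And>j. k j < h j" "\<And>j. x j \<in> topspace (X j (k j))"
      and good: "\<And>j. ?good j \<Longrightarrow> \<epsilon> \<le> Re (point_trace j (k j) (x j) (connecting \<phi> i0 j b0))"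
    by metis
  let ?t = "\<lambda>j. point_trace j (k j) (x j)"
  define S where "S j = (\<lambda>(i, b). if i \<le> j \<and> b \<in> carrier (B i) then ?t j (connecting \<phi> i j b) else 0)" for j
  have conn: "connecting \<phi> i j b \<in> carrier (B j)" if "i \<le> j" "b \<in> carrier (B i)" for i j b
    using that by (rule connecting_simps(1))
  have "\<exists>R. \<forall>j. cmod (S j (i, b)) \<le> R" for i b
  proof (cases "b \<in> carrier (B i)")
    case True
    have "Bseq (\<lambda>j. cnorm (B j) (connecting \<phi> i j b))"
      by (rule convergent_imp_Bseq) (use norm_limit[OF True] in \<open>auto simp: convergent_def\<close>)
    then obtain R where R: "0 < R" "\<And>j. norm (cnorm (B j) (connecting \<phi> i j b)) \<le> R"
      by (auto simp: Bseq_def)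
    have "cmod (S j (i, b)) \<le> R" for j
    proof (cases "i \<le> j")
      case ij: True
      have "cmod (S j (i, b)) \<le> cnorm (B j) (connecting \<phi> i j b)"
        using point_trace_norm[OF kx conn[OF ij True]] ij True by (simp add: S_def)
      then show ?thesis using R(2)[of j] by simp
    qed (use R(1) in \<open>simp add: S_def\<close>)
    then show ?thesis by blast
  qed (auto simp: S_def)
  then obtain R where R: "\<And>i b j. cmod (S j (i, b)) \<le> R i b" by metis
  have K: "compact {f. \<forall>z. f z \<in> cball (0::complex) (R (fst z) (snd z))}"
    by (rule compact_PiE_fun) auto
  have SK: "S j \<in> {f. \<forall>z. f z \<in> cball (0::complex) (R (fst z) (snd z))}" for j using R by auto
  (* the stages where the trace is large, not all stages *)
  have "inf sequentially (principal {j. ?good j}) \<noteq> bot"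
    using freq by (simp add: frequently_def trivial_limit_def eventually_inf_principal)
  from cluster_filter[of _ S, OF K SK this] obtain T G where
    G: "G \<noteq> bot" "G \<le> inf sequentially (principal {j. ?good j})" and T: "(S \<longlongrightarrow> T) G" by blast
  have Gseq: "G \<le> sequentially" using G(2) by simp
  have ev_ge: "\<forall>\<^sub>F j in G. i \<le> j" for i
    using filter_leD[OF Gseq eventually_ge_at_top] .
  have ev_good: "\<forall>\<^sub>F j in G. ?good j"
    using filter_leD[OF G(2), of ?good] by (simp add: eventually_inf_principal)
  have lim: "((\<lambda>j. ?t j (connecting \<phi> i j b)) \<longlongrightarrow> T (i, b)) G" if b: "b \<in> carrier (B i)" for i b
  proof -
    have "((\<lambda>j. S j (i, b)) \<longlongrightarrow> T (i, b)) G"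
      by (rule continuous_on_tendsto_compose[OF continuous_on_product_coordinates T]) auto
    moreover have "\<forall>\<^sub>F j in G. S j (i, b) = ?t j (connecting \<phi> i j b)"
      using ev_ge[of i] by eventually_elim (simp add: S_def b)
    ultimately show ?thesis by (simp add: filterlim_cong)
  qed
  (* an identity between the values at the stages beyond i passes to the cluster point *)
  have unique: "T (i, b) = z" if "b \<in> carrier (B i)" "((\<lambda>j. f j) \<longlongrightarrow> z) G"
    "\<And>j. i < j \<Longrightarrow> ?t j (connecting \<phi> i j b) = f j" for i b f z
  proof (rule tendsto_unique[OF G(1) lim[OF that(1)]])
    have "\<forall>\<^sub>F j in G. f j = ?t j (connecting \<phi> i j b)"
      using ev_ge[of "Suc i"] by eventually_elim (simp add: that(3))
    then show "((\<lambda>j. ?t j (connecting \<phi> i j b)) \<longlongrightarrow> z) G"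
      using that(2) by (simp add: filterlim_cong)
  qed
  note closed = stage_closed
  have "\<exists>\<tau>\<in>A.contractive_tracial_states. \<tau> (\<psi> i0 b0) = T (i0, b0)"
  proof (rule tracial_state_extending[of "\<lambda>i b. T (i, b)"])
    fix i b b' assume b: "b \<in> carrier (B i)" "b' \<in> carrier (B i)"
    show "T (i, b \<oplus>\<^bsub>B i\<^esub> b') = T (i, b) + T (i, b')"
      by (rule unique[OF closed(2)[OF b] tendsto_add[OF lim[OF b(1)] lim[OF b(2)]]])
         (use b kx conn in \<open>simp add: connecting_simps point_trace_add\<close>)
    show "T (i, b \<otimes>\<^bsub>B i\<^esub> b') = T (i, b' \<otimes>\<^bsub>B i\<^esub> b)"
    proof (rule unique[OF closed(1)[OF b] lim[OF closed(1)[OF b(2,1)]]])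
      fix j assume "i < j"
      then have c: "connecting \<phi> i j b \<in> carrier (B j)" "connecting \<phi> i j b' \<in> carrier (B j)"
        using b conn by auto
      show "?t j (connecting \<phi> i j (b \<otimes>\<^bsub>B i\<^esub> b')) = ?t j (connecting \<phi> i j (b' \<otimes>\<^bsub>B i\<^esub> b))"
        using \<open>i < j\<close> b point_trace_comm[OF kx c] by (simp add: connecting_simps)
    qed
  next
    fix i b c assume b: "b \<in> carrier (B i)"
    show "T (i, c \<odot>\<^bsub>B i\<^esub> b) = c * T (i, b)"
      by (rule unique[OF closed(3)[OF b] tendsto_mult_left[OF lim[OF b]]])
         (use b kx conn in \<open>simp add: connecting_simps point_trace_smult\<close>)
    show "T (i, star (B i) b \<otimes>\<^bsub>B i\<^esub> b) \<in> \<real>\<^sub>\<ge>\<^sub>0"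
    proof (rule Lim_in_closed_set[OF closed_nonneg_Reals_complex _ G(1) lim])
      show "star (B i) b \<otimes>\<^bsub>B i\<^esub> b \<in> carrier (B i)" by (intro closed b)
      show "\<forall>\<^sub>F j in G. ?t j (connecting \<phi> i j (star (B i) b \<otimes>\<^bsub>B i\<^esub> b)) \<in> \<real>\<^sub>\<ge>\<^sub>0"
        using ev_ge[of i]
        by eventually_elim (use b kx conn closed in \<open>simp add: connecting_simps point_trace_pos\<close>)
    qed
    show "T (Suc i, \<phi> i b) = T (i, b)"
      by (rule unique[OF unital_star_homD(1)[OF hom b] lim[OF b]]) (simp add: connecting_step)
    show "cmod (T (i, b)) \<le> cnorm A (\<psi> i b)"
    proof (rule tendsto_le[OF G(1)])
      show "((\<lambda>j. cnorm (B j) (connecting \<phi> i j b)) \<longlongrightarrow> cnorm A (\<psi> i b)) G"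
        by (rule tendsto_mono[OF Gseq norm_limit[OF b]])
      show "((\<lambda>j. cmod (?t j (connecting \<phi> i j b))) \<longlongrightarrow> cmod (T (i, b))) G"
        by (intro tendsto_norm lim b)
      show "\<forall>\<^sub>F j in G. cmod (?t j (connecting \<phi> i j b)) \<le> cnorm (B j) (connecting \<phi> i j b)"
        using ev_ge[of i] by eventually_elim (use b kx conn in \<open>simp add: point_trace_norm\<close>)
    qed
  next
    fix i
    have "\<one>\<^bsub>B i\<^esub> \<in> carrier (B i)" using central_mem[of i "\<lambda>_ _. 1"] by (simp add: central_one)
    then show "T (i, \<one>\<^bsub>B i\<^esub>) = 1"
      by (rule unique[OF _ tendsto_const]) (use kx in \<open>simp add: connecting_simps point_trace_one\<close>)
  next
    fix \<tau> assume "\<tau> \<in> A.contractive_tracial_states" "\<And>i b. b \<in> carrier (B i) \<Longrightarrow> \<tau> (\<psi> i b) = T (i, b)"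
    then show "\<exists>\<tau>\<in>A.contractive_tracial_states. \<tau> (\<psi> i0 b0) = T (i0, b0)" using b0 by blast
  qed
  then obtain \<tau> where \<tau>: "\<tau> \<in> A.contractive_tracial_states" "\<tau> (\<psi> i0 b0) = T (i0, b0)" by blast
  have "\<epsilon> \<le> Re (T (i0, b0))"
  proof (rule tendsto_lowerbound[OF tendsto_Re[OF lim[OF b0]] _ G(1)])
    show "\<forall>\<^sub>F j in G. \<epsilon> \<le> Re (?t j (connecting \<phi> i0 j b0))"
    proof (rule eventually_mono[OF ev_good])
      fix j assume "?good j"
      then show "\<epsilon> \<le> Re (?t j (connecting \<phi> i0 j b0))" by (rule good)
    qed
  qed
  then show ?thesis using \<tau> by (intro bexI[of _ \<tau>]) auto
qed

end

section \<open>Eigenvalue patterns near a level\<close>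

context AH_limit
begin

lemma central_cong:
  assumes "\<And>l x. \<lbrakk>l < h i; x \<in> topspace (X i l)\<rbrakk> \<Longrightarrow> F l x = G l x"
  shows "central i F = central i G"
  unfolding central_def by (intro restrict_ext) (use assms in auto)

lemma tracial_state_central_add:
  assumes \<tau>: "\<tau> \<in> tracial_states A"
    and F: "\<And>l. l < h i \<Longrightarrow> continuous_map (X i l) euclideanreal (F l)"
    and G: "\<And>l. l < h i \<Longrightarrow> continuous_map (X i l) euclideanreal (G l)"
  shows "\<tau> (\<psi> i (central i (\<lambda>l x. F l x + G l x))) = \<tau> (\<psi> i (central i F)) + \<tau> (\<psi> i (central i G))"
proof -
  have mem: "central i F \<in> carrier (B i)" "central i G \<in> carrier (B i)"
    using F G by (auto intro!: central_mem)
  show ?thesis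
    unfolding central_add \<psi>_simps(3)[OF mem]
    by (rule A.tracial_statesD(1)[OF \<tau> \<psi>_simps(1)[OF mem(1)] \<psi>_simps(1)[OF mem(2)]])
qed

text \<open>The difference of the two functions is the square of a continuous function.\<close>

lemma tracial_state_central_mono:
  assumes \<tau>: "\<tau> \<in> tracial_states A"
    and F: "\<And>l. l < h i \<Longrightarrow> continuous_map (X i l) euclideanreal (F l)"
    and G: "\<And>l. l < h i \<Longrightarrow> continuous_map (X i l) euclideanreal (G l)"
    and le: "\<And>l x. \<lbrakk>l < h i; x \<in> topspace (X i l)\<rbrakk> \<Longrightarrow> F l x \<le> G l x"
  shows "Re (\<tau> (\<psi> i (central i F))) \<le> Re (\<tau> (\<psi> i (central i G)))"
proof -
  define D where "D l x = sqrt (G l x - F l x)" for l x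
  have contD: "continuous_map (X i l) euclideanreal (D l)" if "l < h i" for l
    unfolding D_def
    by (intro continuous_map_euclidean_comp[of _ _ sqrt] continuous_map_diff F G that continuous_intros)
  have contD2: "continuous_map (X i l) euclideanreal (\<lambda>x. (D l x)\<^sup>2)" if "l < h i" for l
    by (intro continuous_map_euclidean_comp[OF contD[OF that]] continuous_intros)
  have mem: "central i D \<in> carrier (B i)" using contD by (rule central_mem)
  have "central i G = central i (\<lambda>l x. F l x + (D l x)\<^sup>2)"
    by (rule central_cong) (use le in \<open>simp add: D_def\<close>)
  then have eq: "\<tau> (\<psi> i (central i G)) = \<tau> (\<psi> i (central i F)) + \<tau> (\<psi> i (central i (\<lambda>l x. (D l x)\<^sup>2)))"
    using tracial_state_central_add[OF \<tau> F contD2] by simp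
  have "\<psi> i (central i (\<lambda>l x. (D l x)\<^sup>2)) = star A (\<psi> i (central i D)) \<otimes>\<^bsub>A\<^esub> \<psi> i (central i D)"
    unfolding central_square by (simp add: \<psi>_simps mem stage_closed)
  then have "\<tau> (\<psi> i (central i (\<lambda>l x. (D l x)\<^sup>2))) \<in> \<real>\<^sub>\<ge>\<^sub>0"
    using A.tracial_statesD(3)[OF \<tau> \<psi>_simps(1)[OF mem]] by simp
  then show ?thesis unfolding eq by (simp add: complex_nonneg_Reals_iff)
qed

text \<open>The countable set of extremal tracial states excludes countably many levels, so a level \<open>c\<close> remains
between \<open>u\<close> and \<open>v\<close> such that the narrowing tents around it tend to zero at every extremal tracial
state. By the maximum principle some tent is then small at all contractive tracial states at once,
and hence at the traces of all points of all late stages.\<close>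

lemma eigenvalues_rarely_near_level:
  assumes ev: "continuous_eigenvalue_maps h X r p \<phi> M lam"
    and E: "countable (extremal_tracial_states A)"
    and l: "l < h i" and g: "continuous_map (X i l) euclideanreal g"
    and \<epsilon>: "0 < \<epsilon>" and uv: "u < v"
  shows "\<exists>c N. u < c \<and> c < v \<and> N0 \<le> N \<and> (\<forall>\<^sub>F j in sequentially. \<forall>k<h j. \<forall>x\<in>topspace (X j k).
     real (card {m. m < M i j l k \<and> 2 * real N * \<bar>g (lam i j l k m x) - c\<bar> \<le> 1}) \<le> \<epsilon> * real (n j k))"
proof -
  let ?on = "\<lambda>(G :: 'x \<Rightarrow> real) l'. if l' = l then G else (\<lambda>_. 0)"
  define \<mu> where "\<mu> \<tau> G = Re (\<tau> (\<psi> i (central i (?on G))))" for \<tau> :: "'a \<Rightarrow> complex" and G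
  let ?tent = "\<lambda>c N x. tent N c (g x)"
  have on: "continuous_map (X i l') euclideanreal (?on G l')"
    if "continuous_map (X i l) euclideanreal G" for G l'
    using that by simp
  have tent: "continuous_map (X i l) euclideanreal (?tent c N)" for c N
    by (rule continuous_map_tent[OF g])
  have mono: "\<mu> \<tau> G \<le> \<mu> \<tau> H"
    if "\<tau> \<in> tracial_states A" "continuous_map (X i l) euclideanreal G"
      "continuous_map (X i l) euclideanreal H" "\<And>x. x \<in> topspace (X i l) \<Longrightarrow> G x \<le> H x" for \<tau> G H
    unfolding \<mu>_def by (rule tracial_state_central_mono[OF that(1)]) (use that on in auto)
  have "countable {c. \<exists>\<epsilon>>0. \<forall>N. \<epsilon> \<le> \<mu> \<tau> (?tent c N)}" if \<tau>: "\<tau> \<in> tracial_states A" for \<tau>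
  proof (rule countable_charged_levels[OF _ _ _ g])
    fix G H assume GH: "continuous_map (X i l) euclideanreal G" "continuous_map (X i l) euclideanreal H"
    have "?on (\<lambda>x. G x + H x) = (\<lambda>l' x. ?on G l' x + ?on H l' x)" by (auto simp: fun_eq_iff)
    then show "\<mu> \<tau> (\<lambda>x. G x + H x) = \<mu> \<tau> G + \<mu> \<tau> H"
      unfolding \<mu>_def using tracial_state_central_add[OF \<tau>, of i "?on G" "?on H"] on[OF GH(1)] on[OF GH(2)]
      by simp
  next
    have "\<mu> \<tau> (\<lambda>_. 1) \<le> Re (\<tau> (\<psi> i (central i (\<lambda>_ _. 1))))"
      unfolding \<mu>_def by (rule tracial_state_central_mono[OF \<tau>]) (auto simp: on)
    also have "\<dots> = 1"
      unfolding central_one \<psi>_simps(4) A.tracial_statesD(4)[OF \<tau>] by simp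
    finally show "\<mu> \<tau> (\<lambda>_. 1) \<le> 1" .
  qed (rule mono[OF \<tau>])
  then have "countable (\<Union>\<tau>\<in>extremal_tracial_states A. {c. \<exists>\<epsilon>>0. \<forall>N. \<epsilon> \<le> \<mu> \<tau> (?tent c N)})"
    using E by (intro countable_UN) (auto simp: extremal_tracial_states_def)
  moreover have "uncountable {u<..<v}" using uv by (simp add: uncountable_open_interval)
  ultimately obtain c where c: "u < c" "c < v"
      and null: "\<And>\<tau> \<epsilon>. \<lbrakk>\<tau> \<in> extremal_tracial_states A; 0 < \<epsilon>\<rbrakk> \<Longrightarrow> \<exists>N. \<mu> \<tau> (?tent c N) < \<epsilon>"
  proof -
    assume *: "\<And>c. \<lbrakk>u < c; c < v; \<And>\<tau> \<epsilon>. \<lbrakk>\<tau> \<in> extremal_tracial_states A; 0 < \<epsilon>\<rbrakk> \<Longrightarrow> \<exists>N. \<mu> \<tau> (?tent c N) < \<epsilon>\<rbrakk> \<Longrightarrow> thesis"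
    let ?bad = "\<Union>\<tau>\<in>extremal_tracial_states A. {c. \<exists>\<epsilon>>0. \<forall>N. \<epsilon> \<le> \<mu> \<tau> (?tent c N)}"
    assume "countable ?bad" "uncountable {u<..<v}"
    then have "\<not> {u<..<v} \<subseteq> ?bad" using countable_subset by blast
    then obtain c where "c \<in> {u<..<v}" "c \<notin> ?bad" by blast
    then show thesis by (intro *[of c]) (auto simp: not_le)
  qed
  let ?b = "\<lambda>N. central i (?on (?tent c N))"
  have b_mem: "?b N \<in> carrier (B i)" for N by (rule central_mem) (use on tent in blast)
  have dec: "\<mu> \<tau> (?tent c N') \<le> \<mu> \<tau> (?tent c N)"
    if "\<tau> \<in> A.contractive_tracial_states" "N \<le> N'" for \<tau> N N'
    using that by (intro mono tent tent_antimono) (auto simp: A.contractive_tracial_states_def)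
  (* \<epsilon> / 2 because a tent counts a nearby eigenvalue only with weight at least 1 / 2 *)
  obtain N1 where N1: "\<And>\<tau>. \<tau> \<in> A.contractive_tracial_states \<Longrightarrow> \<mu> \<tau> (?tent c N1) < \<epsilon> / 2"
  proof (rule ccontr)
    assume "\<not> thesis"
    then have "\<exists>\<tau>\<in>A.contractive_tracial_states. \<epsilon> / 2 \<le> Re (\<tau> (\<psi> i (?b N)))" for N
      using that[of N] unfolding \<mu>_def by (meson not_le)
    then have "\<exists>\<tau>\<in>extremal_tracial_states A \<inter> A.contractive_tracial_states. \<forall>N. \<epsilon> / 2 \<le> Re (\<tau> (\<psi> i (?b N)))"
      using dec[unfolded \<mu>_def]
      by (intro A.large_at_extremal_tracial_state \<psi>_simps(1) b_mem) auto
    then obtain \<tau> where "\<tau> \<in> extremal_tracial_states A" "\<And>N. \<epsilon> / 2 \<le> \<mu> \<tau> (?tent c N)"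
      unfolding \<mu>_def by blast
    then show False using null[of \<tau> "\<epsilon> / 2"] \<epsilon> by (force simp: not_le[symmetric])
  qed
  define N where "N = max N0 N1"
  have small: "\<mu> \<tau> (?tent c N) < \<epsilon> / 2" if "\<tau> \<in> A.contractive_tracial_states" for \<tau>
    using dec[OF that, of N1 N] N1[OF that] by (simp add: N_def)
  have "\<not> (\<exists>\<^sub>F j in sequentially. \<exists>k<h j. \<exists>x\<in>topspace (X j k).
      \<epsilon> / 2 \<le> Re (point_trace j k x (connecting \<phi> i j (?b N))))"
    using tracial_state_from_points[OF b_mem, of "\<epsilon> / 2"] small unfolding \<mu>_def by (meson not_le)
  then have "\<forall>\<^sub>F j in sequentially. \<forall>k<h j. \<forall>x\<in>topspace (X j k).
      Re (point_trace j k x (connecting \<phi> i j (?b N))) < \<epsilon> / 2"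
    unfolding not_frequently by (rule eventually_mono) (auto simp: not_le)
  then have "\<forall>\<^sub>F j in sequentially. \<forall>k<h j. \<forall>x\<in>topspace (X j k).
     real (card {m. m < M i j l k \<and> 2 * real N * \<bar>g (lam i j l k m x) - c\<bar> \<le> 1}) \<le> \<epsilon> * real (n j k)"
    using eventually_gt_at_top[of i]
  proof eventually_elim
    case (elim j)
    show ?case
    proof (intro allI impI ballI)
      fix k x assume k: "k < h j" and x: "x \<in> topspace (X j k)"
      let ?y = "\<lambda>m. lam i j l k m x"
      let ?I = "{m. m < M i j l k \<and> 2 * real N * \<bar>g (?y m) - c\<bar> \<le> 1}"
      have "(\<Sum>m<M i j l k. tent N c (g (?y m))) * real (n i l) / real (n j k) < \<epsilon> / 2"
        using elim(1) k x point_trace_connecting_central[OF ev elim(2) l k x tent[of N c]] by fastforce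
      then have sum_small: "(\<Sum>m<M i j l k. tent N c (g (?y m))) * real (n i l) < \<epsilon> / 2 * real (n j k)"
        using n_pos[OF k] by (simp add: field_simps)
      have "real (card ?I) * (1 / 2) \<le> (\<Sum>m\<in>?I. tent N c (g (?y m)))"
        by (rule sum_bounded_below, rule tent_ge_half) simp
      also have "\<dots> \<le> (\<Sum>m<M i j l k. tent N c (g (?y m)))"
        by (intro sum_mono2) (auto simp: tent_nonneg)
      also have "\<dots> \<le> (\<Sum>m<M i j l k. tent N c (g (?y m))) * real (n i l)"
        using n_pos[OF l] mult_left_mono[of 1 "real (n i l)" "\<Sum>m<M i j l k. tent N c (g (?y m))"]
        by (simp add: tent_nonneg sum_nonneg)
      finally show "real (card ?I) \<le> \<epsilon> * real (n j k)" using sum_small by simp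
    qed
  qed
  then show ?thesis using c by (intro exI[of _ c] exI[of _ N]) (simp add: N_def)
qed

end

text \<open>The bound \<open>3/4\<close> leaves room below it for the levels at which the functions are made steep.\<close>

lemma subordinate_functions:
  fixes X :: "'x topology"
  assumes X: "compact_space X" "Hausdorff_space X"
    and cover: "\<And>U. U \<in> \<U> \<Longrightarrow> openin X U" "topspace X \<subseteq> \<Union>\<U>"
  obtains F :: "'x set" and g where "finite F" "\<And>y. y \<in> F \<Longrightarrow> continuous_map X euclideanreal (g y)"
    "\<And>y. y \<in> F \<Longrightarrow> \<exists>U\<in>\<U>. \<forall>x\<in>topspace X. 0 < g y x \<longrightarrow> x \<in> U"
    "\<And>x. x \<in> topspace X \<Longrightarrow> \<exists>y\<in>F. (3/4 :: real) < g y x"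
proof -
  have "completely_regular_space X"
    using X compact_Hausdorff_or_regular_imp_normal_space normal_imp_completely_regular_space by blast
  have "\<exists>g U. U \<in> \<U> \<and> continuous_map X euclideanreal g \<and> g y = 1 \<and> (\<forall>x\<in>topspace X. 0 < g x \<longrightarrow> x \<in> U)"
    if y: "y \<in> topspace X" for y
  proof -
    obtain U where U: "U \<in> \<U>" "y \<in> U" using cover(2) y by blast
    then have "closedin X (topspace X - U)" "y \<in> topspace X - (topspace X - U)"
      using cover(1) y by auto
    then obtain f :: "'x \<Rightarrow> real" where f: "continuous_map X (top_of_set {0..1}) f" "f y = 0" "f ` (topspace X - U) \<subseteq> {1}"
      using \<open>completely_regular_space X\<close> unfolding completely_regular_space_def by meson
    then have "continuous_map X euclideanreal (\<lambda>x. 1 - f x)"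
      by (intro continuous_map_diff) (auto simp: continuous_map_in_subtopology)
    then show ?thesis using U(1) f by (intro exI[of _ "\<lambda>x. 1 - f x"] exI[of _ U]) force
  qed
  then obtain g U where g: "\<And>y. y \<in> topspace X \<Longrightarrow> U y \<in> \<U> \<and> continuous_map X euclideanreal (g y) \<and>
      g y y = 1 \<and> (\<forall>x\<in>topspace X. 0 < g y x \<longrightarrow> x \<in> U y)" by metis
  define V where "V y = {x \<in> topspace X. g y x \<in> {3/4<..}}" for y
  have "openin X (V y)" if "y \<in> topspace X" for y
    unfolding V_def using g[OF that] by (intro openin_continuous_map_preimage[of X euclideanreal]) auto
  moreover have "topspace X \<subseteq> \<Union>(V ` topspace X)" using g by (auto simp: V_def)
  ultimately obtain \<F> where \<F>: "finite \<F>" "\<F> \<subseteq> V ` topspace X" "topspace X \<subseteq> \<Union>\<F>"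
    using X(1) unfolding compact_space_alt by (metis (no_types, lifting) imageE)
  obtain F where F: "finite F" "F \<subseteq> topspace X" "\<F> = V ` F"
    using \<F>(1,2) by (metis finite_subset_image)
  show thesis
  proof (rule that[OF F(1), of g])
    show "\<exists>y\<in>F. 3/4 < g y x" if "x \<in> topspace X" for x
      using that \<F>(3) F(3) by (auto simp: V_def)
  qed (use g F(2) in blast)+
qed

text \<open>The function that rises linearly from \<open>0\<close> to \<open>1\<close> on the interval of length \<open>1 / N\<close> centred at \<open>c\<close>.\<close>

definition ramp :: "nat \<Rightarrow> real \<Rightarrow> real \<Rightarrow> real" where
  "ramp N c y = max 0 (min 1 (real N * (y - c) + 1/2))"

lemma ramp_bounds: "0 \<le> ramp N c y" "ramp N c y \<le> 1"
  by (auto simp: ramp_def)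

lemma ramp_intermediate: "\<lbrakk>0 < ramp N c y; ramp N c y < 1\<rbrakk> \<Longrightarrow> 2 * real N * \<bar>y - c\<bar> \<le> 1"
proof -
  assume "0 < ramp N c y" "ramp N c y < 1"
  then have "\<bar>real N * (y - c)\<bar> \<le> 1/2" by (auto simp: ramp_def max_def min_def abs_le_iff split: if_splits)
  then show ?thesis by (simp add: abs_mult)
qed

lemma ramp_pos_imp_pos:
  assumes "4 \<le> N" "1/4 < c" "0 < ramp N c y"
  shows "0 < y"
proof (rule ccontr)
  assume "\<not> 0 < y"
  then have "real N * (y - c) \<le> real N * (- (1/4))" using assms by (intro mult_left_mono) auto
  then have "real N * (y - c) \<le> - 1" using assms(1) by simp
  then show False using assms(3) by (auto simp: ramp_def)
qed

lemma ramp_eq_1: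
  assumes "4 \<le> N" "c < 1/2" "3/4 < y"
  shows "ramp N c y = 1"
proof -
  have "4 * (1/4) \<le> real N * (y - c)" using assms by (intro mult_mono) auto
  then show ?thesis by (auto simp: ramp_def)
qed

lemma continuous_map_ramp:
  "continuous_map X euclideanreal g \<Longrightarrow> continuous_map X euclideanreal (\<lambda>x. ramp N c (g x))"
  unfolding ramp_def
  by (intro continuous_map_real_max continuous_map_real_min continuous_map_add continuous_map_diff continuous_map_real_mult
      continuous_map_const[THEN iffD2] disjI2) auto

lemma induced_cover_open_cover:
  assumes \<alpha>: "\<alpha> \<in> component_covers h X i" and l: "l < h i"
  shows "\<And>U. U \<in> induced_cover \<alpha> l \<Longrightarrow> openin (X i l) U" "topspace (X i l) \<subseteq> \<Union>(induced_cover \<alpha> l)"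
proof -
  have op: "\<And>W. W \<in> \<alpha> \<Longrightarrow> openin (sum_topology (X i) {..<h i}) W"
    using \<alpha> by (auto simp: component_covers_def finite_open_cover_def)
  fix U assume "U \<in> induced_cover \<alpha> l"
  then have "openin (sum_topology (X i) {..<h i}) ({l} \<times> U)" using op by (simp add: induced_cover_def)
  then have "\<forall>l'\<in>{..<h i}. openin (X i l') {x. (l', x) \<in> {l} \<times> U}"
    unfolding openin_sum_topology by (rule conjunct2)
  then have "openin (X i l) {x. (l, x) \<in> {l} \<times> U}" by (rule bspec) (use l in simp)
  then show "openin (X i l) U" by simp
next
  have un: "\<Union>\<alpha> = Sigma {..<h i} (topspace \<circ> X i)"
    and comp: "\<And>W. W \<in> \<alpha> \<Longrightarrow> \<exists>l<h i. W \<subseteq> {l} \<times> topspace (X i l)"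
    using \<alpha> by (auto simp: component_covers_def finite_open_cover_def)
  show "topspace (X i l) \<subseteq> \<Union>(induced_cover \<alpha> l)"
  proof
    fix x assume "x \<in> topspace (X i l)"
    then have "(l, x) \<in> \<Union>\<alpha>" using l un by auto
    then obtain W where W: "W \<in> \<alpha>" "(l, x) \<in> W" by blast
    then obtain l' where "W \<subseteq> {l'} \<times> topspace (X i l')" using comp by blast
    then have "fst z = l'" if "z \<in> W" for z
      using that by (metis mem_Times_iff singletonD subsetD)
    then have fst_W: "fst z = l" if "z \<in> W" for z
      using W(2) that by (metis fst_conv)
    have "W = {l} \<times> (snd ` W)"
    proof (rule Set.set_eqI)
      show "z \<in> W \<longleftrightarrow> z \<in> {l} \<times> (snd ` W)" for z
        using fst_W by (cases z) (force simp: image_iff)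
    qed
    then have "snd ` W \<in> induced_cover \<alpha> l" using W(1) by (simp add: induced_cover_def)
    moreover have "x \<in> snd ` W" using W(2) by force
    ultimately show "x \<in> \<Union>(induced_cover \<alpha> l)" by blast
  qed
qed

context AH_limit
begin

text \<open>The coordinates at stage \<open>j\<close> are the ramps of the Urysohn functions at the eigenvalues. Choosing all
levels between \<open>1/4\<close> and \<open>1/2\<close> and all slopes at least \<open>4\<close> ensures that a ramp vanishes where its
Urysohn function does, and that at each eigenvalue some ramp equals \<open>1\<close>.\<close>

lemma eigenvalue_cover_dim_small:
  assumes ev: "continuous_eigenvalue_maps h X r p \<phi> M lam"
    and E: "countable (extremal_tracial_states A)"
    and \<alpha>: "\<alpha> \<in> component_covers h X i" and \<delta>: "0 < \<delta>"
  shows "\<forall>\<^sub>F j in sequentially. \<forall>k<h j.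
    real (cover_dim (X j k) (eigenvalue_cover h X M lam i j k \<alpha>)) \<le> \<delta> * real (n j k)"
proof -
  define subordinate where "subordinate l F g \<longleftrightarrow> finite F \<and>
      (\<forall>y\<in>F. continuous_map (X i l) euclideanreal (g y)) \<and>
      (\<forall>y\<in>F. \<exists>U\<in>induced_cover \<alpha> l. \<forall>x\<in>topspace (X i l). 0 < g y x \<longrightarrow> x \<in> U) \<and>
      (\<forall>x\<in>topspace (X i l). \<exists>y\<in>F. 3/4 < g y x)" for l and F :: "'x set" and g :: "'x \<Rightarrow> 'x \<Rightarrow> real"
  have "\<exists>F g. subordinate l F g" if l: "l < h i" for l
  proof (rule subordinate_functions[OF compact[OF l] Hausdorff[OF l] induced_cover_open_cover[OF \<alpha> l]])
    fix F :: "'x set" and g :: "'x \<Rightarrow> 'x \<Rightarrow> real"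
    assume "finite F" "\<And>y. y \<in> F \<Longrightarrow> continuous_map (X i l) euclideanreal (g y)"
      "\<And>y. y \<in> F \<Longrightarrow> \<exists>U\<in>induced_cover \<alpha> l. \<forall>x\<in>topspace (X i l). 0 < g y x \<longrightarrow> x \<in> U"
      "\<And>x. x \<in> topspace (X i l) \<Longrightarrow> \<exists>y\<in>F. (3/4 :: real) < g y x"
    then have "subordinate l F g" unfolding subordinate_def by blast
    then show "\<exists>F g. subordinate l F g" by blast
  qed
  then obtain F g where "\<And>l. l < h i \<Longrightarrow> subordinate l (F l) (g l)" by metis
  then have fin: "finite (F l)"
    and cont: "y \<in> F l \<Longrightarrow> continuous_map (X i l) euclideanreal (g l y)"
    and subord: "y \<in> F l \<Longrightarrow>
      \<exists>U\<in>induced_cover \<alpha> l. \<forall>x\<in>topspace (X i l). 0 < g l y x \<longrightarrow> x \<in> U"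
    and large: "x \<in> topspace (X i l) \<Longrightarrow> \<exists>y\<in>F l. 3/4 < g l y x" if "l < h i" for l x y
    using that unfolding subordinate_def by blast+
  let ?P = "Sigma {..<h i} F"
  have finP: "finite ?P" using fin by auto
  (* \<epsilon> for each of the functions; the summand 1 avoids a division by zero *)
  define \<epsilon> where "\<epsilon> = \<delta> / (real (card ?P) + 1)"
  have \<epsilon>: "0 < \<epsilon>" using \<delta> by (simp add: \<epsilon>_def add_nonneg_pos)
  define good where "good l y c N \<longleftrightarrow> 1/4 < c \<and> c < 1/2 \<and> 4 \<le> N \<and>
      (\<forall>\<^sub>F j in sequentially. \<forall>k<h j. \<forall>x\<in>topspace (X j k).
        real (card {m. m < M i j l k \<and> 2 * real N * \<bar>g l y (lam i j l k m x) - c\<bar> \<le> 1}) \<le> \<epsilon> * real (n j k))"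
    for l y c and N :: nat
  have "\<exists>c N. good l y c N" if "l < h i" "y \<in> F l" for l y
    unfolding good_def by (rule eigenvalues_rarely_near_level[OF ev E that(1) cont[OF that] \<epsilon>]) simp
  then obtain c N where "\<And>l y. \<lbrakk>l < h i; y \<in> F l\<rbrakk> \<Longrightarrow> good l y (c l y) (N l y)" by metis
  then have c: "1/4 < c l y" "c l y < 1/2" "4 \<le> N l y"
    and rare: "\<forall>\<^sub>F j in sequentially. \<forall>k<h j. \<forall>x\<in>topspace (X j k).
     real (card {m. m < M i j l k \<and> 2 * real (N l y) * \<bar>g l y (lam i j l k m x) - c l y\<bar> \<le> 1}) \<le> \<epsilon> * real (n j k)"
    if "l < h i" "y \<in> F l" for l y
    using that unfolding good_def by blast+
  have "\<forall>\<^sub>F j in sequentially. \<forall>z\<in>?P. \<forall>k<h j. \<forall>x\<in>topspace (X j k).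
     real (card {m. m < M i j (fst z) k \<and>
       2 * real (N (fst z) (snd z)) * \<bar>g (fst z) (snd z) (lam i j (fst z) k m x) - c (fst z) (snd z)\<bar> \<le> 1})
     \<le> \<epsilon> * real (n j k)"
    using finP rare by (intro eventually_ball_finite) auto
  then show ?thesis
    using eventually_gt_at_top[of i]
  proof eventually_elim
    case (elim j)
    show ?case
    proof (intro allI impI)
      fix k assume k: "k < h j"
      define T where "T = {(l, m, y). l < h i \<and> m < M i j l k \<and> y \<in> F l}"
      define f where "f = (\<lambda>(l, m, y) x. ramp (N l y) (c l y) (g l y (lam i j l k m x)))"
      have lam: "continuous_map (X j k) (X i l) (lam i j l k m)" if "l < h i" "m < M i j l k" for l m
        using ev elim(2) that k unfolding continuous_eigenvalue_maps_def by blast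
      have lam_in: "lam i j l k m x \<in> topspace (X i l)" if "l < h i" "m < M i j l k" "x \<in> topspace (X j k)" for l m x
        using continuous_map_image_subset_topspace[OF lam[OF that(1,2)]] that(3) by blast
      have "T \<subseteq> (\<lambda>(l, y, m). (l, m, y)) ` (SIGMA l:{..<h i}. F l \<times> {..<M i j l k})"
        by (force simp: T_def)
      then have finT: "finite T"
        by (rule finite_subset) (auto intro!: finite_imageI finite_SigmaI fin)
      have "cover_dim (X j k) (eigenvalue_cover h X M lam i j k \<alpha>) \<le> nat \<lfloor>\<delta> * real (n j k)\<rfloor>"
      proof (rule cover_dim_le_card_intermediate[OF finT nonempty[OF k], of f])
        fix t assume "t \<in> T"
        then obtain l m y where t: "t = (l, m, y)" "l < h i" "m < M i j l k" "y \<in> F l" by (auto simp: T_def)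
        show "continuous_map (X j k) euclideanreal (f t)"
          unfolding t(1) f_def prod.case
          using continuous_map_compose[OF lam[OF t(2,3)] continuous_map_ramp[OF cont[OF t(2,4)]]]
          by (simp add: o_def)
      next
        show "0 \<le> f t x \<and> f t x \<le> 1" for t x
          by (auto simp: f_def ramp_bounds split: prod.split)
      next
        fix x assume x: "x \<in> topspace (X j k)"
        let ?near = "\<lambda>(l, y). {m. m < M i j l k \<and> 2 * real (N l y) * \<bar>g l y (lam i j l k m x) - c l y\<bar> \<le> 1}"
        have fin_near: "finite (?near z)" for z by (auto split: prod.split)
        have "{t \<in> T. 0 < f t x \<and> f t x < 1} \<subseteq> (\<lambda>((l, y), m). (l, m, y)) ` (SIGMA z:?P. ?near z)"
        proof
          fix t assume "t \<in> {t \<in> T. 0 < f t x \<and> f t x < 1}"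
          then obtain l m y where t: "t = (l, m, y)" "l < h i" "m < M i j l k" "y \<in> F l"
              "0 < f t x" "f t x < 1" by (auto simp: T_def)
          then have "2 * real (N l y) * \<bar>g l y (lam i j l k m x) - c l y\<bar> \<le> 1"
            by (intro ramp_intermediate) (auto simp: f_def)
          then show "t \<in> (\<lambda>((l, y), m). (l, m, y)) ` (SIGMA z:?P. ?near z)"
            using t by (intro image_eqI[of _ _ "((l, y), m)"]) auto
        qed
        then have "card {t \<in> T. 0 < f t x \<and> f t x < 1} \<le> card (SIGMA z:?P. ?near z)"
          using finP fin_near by (intro surj_card_le) (auto intro!: finite_SigmaI)
        moreover have "card (SIGMA z:?P. ?near z) = (\<Sum>z\<in>?P. card (?near z))"
          by (rule card_SigmaI[OF finP]) (use fin_near in blast)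
        ultimately have "card {t \<in> T. 0 < f t x \<and> f t x < 1} \<le> (\<Sum>z\<in>?P. card (?near z))" by linarith
        then have "real (card {t \<in> T. 0 < f t x \<and> f t x < 1}) \<le> (\<Sum>z\<in>?P. real (card (?near z)))"
          unfolding of_nat_sum[symmetric] of_nat_le_iff .
        also have "\<dots> \<le> (\<Sum>z\<in>?P. \<epsilon> * real (n j k))"
          using elim(1) k x by (intro sum_mono) (auto split: prod.split)
        also have "\<dots> = real (card ?P) * \<epsilon> * real (n j k)" by simp
        also have "\<dots> \<le> \<delta> * real (n j k)"
          using \<delta> by (intro mult_right_mono) (auto simp: \<epsilon>_def field_simps)
        finally show "card {t \<in> T. 0 < f t x \<and> f t x < 1} \<le> nat \<lfloor>\<delta> * real (n j k)\<rfloor>"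
          by (simp add: le_nat_floor)
      next
        fix S assume "S \<subseteq> T"
        have "\<exists>U. U \<in> induced_cover \<alpha> l \<and> (\<forall>x\<in>topspace (X j k). (\<forall>t\<in>S. 0 < f t x) \<and> (\<forall>t\<in>T - S. f t x < 1) \<longrightarrow>
            lam i j l k m x \<in> U)" if lm: "l < h i" "m < M i j l k" for l m
        proof (cases "\<exists>y\<in>F l. (l, m, y) \<in> S")
          case True
          then obtain y where y: "y \<in> F l" "(l, m, y) \<in> S" by blast
          obtain U where U: "U \<in> induced_cover \<alpha> l" "\<And>x. \<lbrakk>x \<in> topspace (X i l); 0 < g l y x\<rbrakk> \<Longrightarrow> x \<in> U"
            using subord[OF lm(1) y(1)] by blast
          have "lam i j l k m x \<in> U" if "x \<in> topspace (X j k)" "\<forall>t\<in>S. 0 < f t x" for x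
          proof (rule U(2)[OF lam_in[OF lm that(1)]])
            have "0 < f (l, m, y) x" using that(2) y(2) by blast
            then show "0 < g l y (lam i j l k m x)"
              using c[OF lm(1) y(1)] by (simp add: f_def ramp_pos_imp_pos)
          qed
          then show ?thesis using U(1) by blast
        next
          case False
          (* no point satisfies the conditions, as some coordinate of the eigenvalue equals 1, so any member serves *)
          obtain U where U: "U \<in> induced_cover \<alpha> l"
            using induced_cover_open_cover(2)[OF \<alpha> lm(1)] nonempty[OF lm(1)] by blast
          have "\<not> (\<forall>t\<in>T - S. f t x < 1)" if x: "x \<in> topspace (X j k)" for x
          proof -
            obtain y where y: "y \<in> F l" "3/4 < g l y (lam i j l k m x)"
              using large[OF lm(1) lam_in[OF lm x]] by blast
            have "f (l, m, y) x = 1"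
              using c[OF lm(1) y(1)] y(2) by (auto simp: f_def intro: ramp_eq_1)
            moreover have "(l, m, y) \<in> T - S" using False y(1) lm by (auto simp: T_def)
            ultimately show ?thesis by force
          qed
          then show ?thesis using U by blast
        qed
        then obtain U where U: "\<And>l m. \<lbrakk>l < h i; m < M i j l k\<rbrakk> \<Longrightarrow> U l m \<in> induced_cover \<alpha> l"
            "\<And>l m x. \<lbrakk>l < h i; m < M i j l k; x \<in> topspace (X j k); \<forall>t\<in>S. 0 < f t x; \<forall>t\<in>T - S. f t x < 1\<rbrakk>
              \<Longrightarrow> lam i j l k m x \<in> U l m"
          by metis
        define s where "s = (\<lambda>(l, m). {x \<in> topspace (X j k). lam i j l k m x \<in> U l m})"
        let ?I = "{(l, m). l < h i \<and> m < M i j l k}"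
        have "topspace (X j k) \<inter> (\<Inter>z\<in>?I. s z) \<in> eigenvalue_cover h X M lam i j k \<alpha>"
          unfolding eigenvalue_cover_def cover_join_def using U(1)
          by (intro CollectI exI[of _ s] conjI refl) (auto simp: s_def)
        moreover have "x \<in> topspace (X j k) \<inter> (\<Inter>z\<in>?I. s z)"
          if "x \<in> topspace (X j k)" "\<forall>t\<in>S. 0 < f t x" "\<forall>t\<in>T - S. f t x < 1" for x
          using that U(2) by (auto simp: s_def)
        ultimately show "\<exists>V\<in>eigenvalue_cover h X M lam i j k \<alpha>. \<forall>x\<in>topspace (X j k).
            (\<forall>t\<in>S. 0 < f t x) \<and> (\<forall>t\<in>T - S. f t x < 1) \<longrightarrow> x \<in> V" by blast
      qed
      then have "real (cover_dim (X j k) (eigenvalue_cover h X M lam i j k \<alpha>)) \<le> real (nat \<lfloor>\<delta> * real (n j k)\<rfloor>)"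
        by simp
      also have "\<dots> \<le> \<delta> * real (n j k)" using \<delta> by simp
      finally show "real (cover_dim (X j k) (eigenvalue_cover h X M lam i j k \<alpha>)) \<le> \<delta> * real (n j k)" .
    qed
  qed
qed

lemma mean_dim_stage_eq_0:
  assumes ev: "continuous_eigenvalue_maps h X r p \<phi> M lam"
    and E: "countable (extremal_tracial_states A)"
  shows "mean_dim_stage h X n M lam i = 0"
proof -
  have "lim (\<lambda>j. ereal (Max ((\<lambda>k. real (cover_dim (X j k) (eigenvalue_cover h X M lam i j k \<alpha>)) / real (n j k))
      ` {..<h j}))) = 0" (is "lim (\<lambda>j. ereal (?q j)) = 0") if \<alpha>: "\<alpha> \<in> component_covers h X i" for \<alpha>
  proof -
    have "?q \<longlonglongrightarrow> 0"
    proof (rule tendstoI)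
      fix e :: real assume e: "0 < e"
      have "\<forall>\<^sub>F j in sequentially. \<forall>k<h j.
          real (cover_dim (X j k) (eigenvalue_cover h X M lam i j k \<alpha>)) \<le> e / 2 * real (n j k)"
        using e by (intro eigenvalue_cover_dim_small[OF ev E \<alpha>]) simp
      then show "\<forall>\<^sub>F j in sequentially. dist (?q j) 0 < e"
      proof eventually_elim
        case (elim j)
        let ?c = "\<lambda>k. real (cover_dim (X j k) (eigenvalue_cover h X M lam i j k \<alpha>)) / real (n j k)"
        have fin: "finite (?c ` {..<h j})" "?c ` {..<h j} \<noteq> {}" using h_pos[of j] by auto
        have "?c k \<le> e / 2" if "k < h j" for k
          using elim n_pos[OF that] that by (simp add: pos_divide_le_eq)
        then have "?q j \<le> e / 2" using fin by (subst Max_le_iff) auto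
        moreover have "0 \<le> ?q j"
        proof -
          have "?c 0 \<le> ?q j" using h_pos[of j] fin by (intro Max_ge) auto
          moreover have "0 \<le> ?c 0" by simp
          ultimately show ?thesis by linarith
        qed
        ultimately show ?case using e by (simp add: dist_real_def)
      qed
    qed
    then have "(\<lambda>j. ereal (?q j)) \<longlonglongrightarrow> ereal 0" by simp
    then show ?thesis by (simp add: limI zero_ereal_def)
  qed
  moreover have "component_covers h X i \<noteq> {}"
  proof -
    have "openin (sum_topology (X i) {..<h i}) ({l} \<times> topspace (X i l))" if "l < h i" for l
      unfolding openin_sum_topology
    proof (intro conjI ballI)
      fix l'
      have "{x. (l', x) \<in> {l} \<times> topspace (X i l)} = (if l' = l then topspace (X i l) else {})" by auto
      then show "openin (X i l') {x. (l', x) \<in> {l} \<times> topspace (X i l)}" by auto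
    qed (use that in auto)
    then have "(\<lambda>l. {l} \<times> topspace (X i l)) ` {..<h i} \<in> component_covers h X i"
      unfolding component_covers_def finite_open_cover_def by auto
    then show ?thesis by blast
  qed
  ultimately show ?thesis
    unfolding mean_dim_stage_def by (simp cong: SUP_cong)
qed

end

theorem corollary3p19:
  fixes h :: "nat \<Rightarrow> nat"
    and X :: "nat \<Rightarrow> nat \<Rightarrow> 'x topology"
    and r n :: "nat \<Rightarrow> nat \<Rightarrow> nat"
    and p :: "nat \<Rightarrow> nat \<Rightarrow> 'x \<Rightarrow> complex mat"
    and \<phi> :: "nat \<Rightarrow> (nat \<Rightarrow> 'x \<Rightarrow> complex mat) \<Rightarrow> nat \<Rightarrow> 'x \<Rightarrow> complex mat"
    and A :: "'a cstar"
    and \<psi> :: "nat \<Rightarrow> (nat \<Rightarrow> 'x \<Rightarrow> complex mat) \<Rightarrow> 'a"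
    and M :: "nat \<Rightarrow> nat \<Rightarrow> nat \<Rightarrow> nat \<Rightarrow> nat"
    and lam :: "nat \<Rightarrow> nat \<Rightarrow> nat \<Rightarrow> nat \<Rightarrow> nat \<Rightarrow> 'x \<Rightarrow> 'x"
  assumes "AH_system h X r p n \<phi>"
    and "cstar_inductive_limit (AH_stage h X r p) \<phi> A \<psi>"
    and "continuous_eigenvalue_maps h X r p \<phi> M lam"
    and "countable (extremal_tracial_states A)"
  shows "mean_dimension h X n M lam = 0"
proof -
  interpret AH_limit h X r p n \<phi> A \<psi>
    using assms(1,2) by (simp add: AH_limit_def AH_limit_axioms_def)
  have "mean_dim_stage h X n M lam = (\<lambda>_. 0)"
    using mean_dim_stage_eq_0[OF assms(3,4)] by blast
  then show ?thesis by (simp add: mean_dimension_def limI)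
qed

end
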